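(* Let $\alpha\in(0,2)$, $U\in\mathcal{C}^2(\mathbb{S}^1)$ and $V\in\mathcal{C}^2(\mathbb{R}^2\setminus\{0\})$, $V(x)=|x|^{-\alpha}U(x/|x|)$. Assume that there is $\vartheta^*\in\mathbb{S}^1$ with $U(\vartheta)\ge U(\vartheta^* )>0$ for all $\vartheta\in\mathbb{S}^1$ and $U''(\vartheta^* )>0$. Given $h<0$, there exist $\bar r>0$ and $\bar\delta>0$ such that, setting $$Q_0=\{q_0=re^{i\vartheta_0}:\ r\in(0,\bar r)\text{ and }\vartheta_0\in(\vartheta^*-\bar\delta,\vartheta^*+\bar\delta)\},$$ one has $$\mathcal{W}^s_{loc}(\bar r,\bar\delta)=\bigcup_{q_0\in Q_0}\mathfrak{m}_h(q_0),$$ where $\mathcal{W}^s_{loc}(\bar r,\bar\delta)$ is the local stable manifold of $(0,\vartheta^*,\vartheta^*+\pi)$ and $\mathfrak{m}_h(q_0)$ is the set of minimizers starting at $q_0$, reparametrized in McGehee coordinates, both defined in the context. Moreover, for every $q_0\in Q_0$, the Maupertuis functional $\mathcal{M}_h$ admits a unique minimizer in $H^{q_0}_{coll}$.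
   Context: Identify $\mathbb{R}^2\simeq\mathbb{C}$ and $\mathbb{S}^1\simeq\mathbb{R}/2\pi\mathbb{Z}$; $U(\vartheta)$ denotes $U$ at the point $e^{i\vartheta}$, and $'$ on $U$ is $d/d\vartheta$. **McGehee coordinates.** For a solution $x=x(t)=re^{i\vartheta}$ of $\ddot x=\nabla V(x)$, $\frac12|\dot x|^2-V(x)=h$, let $\varphi\in\mathbb{S}^1$ be the direction of the velocity: $\dot x=|\dot x|e^{i\varphi}$, where $|\dot x|=r^{-\alpha/2}z$, $z=\sqrt{2U(\vartheta)+2hr^\alpha}$. With the new time $\tau$ given by $dt/d\tau=z\,r^{1+\alpha/2}$ the motion satisfies ($'=d/d\tau$) $$r'=2r(U(\vartheta)+hr^\alpha)\cos(\varphi-\vartheta),\quad \vartheta'=2(U(\vartheta)+hr^\alpha)\sin(\varphi-\vartheta),\quad \varphi'=U'(\vartheta)\cos(\varphi-\vartheta)+\alpha U(\vartheta)\sin(\varphi-\vartheta),$$ a system which makes sense also at $r=0$ and has $(0,\vartheta^*,\vartheta^*+\pi)$ as a hyperbolic equilibrium. **Local stable manifold.** $\mathcal{W}^s$ is the (two-dimensional) stable manifold of $(0,\vartheta^*,\vartheta^*+\pi)$. Near the equilibrium it is a graph: there are $r_{loc},\delta_{loc}>0$ and a $\mathcal{C}^2$ function $\Psi\colon[0,r_{loc})\times(\vartheta^*-\delta_{loc},\vartheta^*+\delta_{loc})\to\mathbb{S}^1$ with $\Psi(0,\vartheta^* )=\vartheta^*+\pi$ such that, for $(r,\vartheta)\in(0,r_{loc})\times(\vartheta^*-\delta_{loc},\vartheta^*+\delta_{loc})$,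 the point $(r,\vartheta,\varphi)$ belongs to $\mathcal{W}^s$ if and only if $\varphi=\Psi(r,\vartheta)$. For $\bar r\le r_{loc}$, $\bar\delta\le\delta_{loc}$, $$\mathcal{W}^s_{loc}(\bar r,\bar\delta)=\{(r,\vartheta,\Psi(r,\vartheta)):\ r\in[0,\bar r),\ \vartheta\in(\vartheta^*-\bar\delta,\vartheta^*+\bar\delta)\}\subseteq\mathcal{W}^s.$$ **Minimizers.** For $q\in\mathbb{R}^2\setminus\{0\}$, $$H^q_{coll}=\{u\in H^1([0,1];\mathbb{R}^2):\ u(0)=q,\ u(1)=0,\ |u(s)|\le|q|\ \forall s\in[0,1]\},$$ $$\mathcal{M}_h(u)=\frac12\int_0^1|\dot u|^2\,ds\int_0^1(h+V(u))\,ds\in\mathbb{R}\cup\{+\infty\}.$$ A minimizer $u$ at positive level gives, after the time rescaling $x(t)=u(\omega t)$ with $\omega^2=\int_0^1(h+V(u))\big/\bigl(\frac12\int_0^1|\dot u|^2\bigr)$, a solution of $\ddot x=\nabla V(x)$, $\frac12|\dot x|^2-V(x)=h$ that reaches the origin at the final time. Then $$\mathfrak{m}_h(q)=\{\gamma_\varphi:\ \text{the reparametrization of }\gamma_\varphi\text{ minimizes }\mathcal{M}_h\text{ in }H^q_{coll},\ \varphi\in\mathbb{S}^1\},$$ where $\gamma_\varphi=\gamma_\varphi(\tau)$, $\tau>0$, is the orbit in McGehee coordinates $(r(\tau),\vartheta(\tau),\varphi(\tau))$ of such a solution with starting position $q$ and direction $\varphi$ of the starting velocity. In the claim, the union is understood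 as the set of points of these orbits.
   Formalization: The equality is proved for the points of W^s_loc with r>0, since points with r=0 (e.g. the equilibrium) lie on no minimizing orbit; Ψ need only be continuous, and W^s may be taken relative to any neighbourhood of the equilibrium. *)

theory Defs
  imports "HOL-Analysis.Analysis"
begin

text \<open>
  The plane is \<^typ>\<open>complex\<close>. A point of the circle is a unit complex number: an angle \<open>\<theta>\<close>
  enters as \<open>cis \<theta>\<close>, and \<open>U(\<theta>)\<close> is \<open>U (cis \<theta>)\<close>, so that the derivatives of \<open>U\<close> on the circle
  are those of \<open>\<lambda>\<theta>. U (cis \<theta>)\<close>.
\<close>

definition C2_circle :: "(complex \<Rightarrow> real) \<Rightarrow> bool" where
  "C2_circle U \<longleftrightarrow> (\<lambda>\<theta>. U (cis \<theta>)) differentiable_on UNIV \<and>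
     deriv (\<lambda>\<theta>. U (cis \<theta>)) differentiable_on UNIV \<and>
     continuous_on UNIV (deriv (deriv (\<lambda>\<theta>. U (cis \<theta>))))"

text \<open>
  The homogeneous potential. It is only meaningful off the origin; there it is of class \<open>C\<^sup>2\<close> as
  soon as \<open>U\<close> is.
\<close>

definition potential :: "real \<Rightarrow> (complex \<Rightarrow> real) \<Rightarrow> complex \<Rightarrow> real" where
  "potential \<alpha> U x = cmod x powr (-\<alpha>) * U (x / complex_of_real (cmod x))"


section \<open>The Maupertuis functional\<close>

text \<open>
  \<open>H\<^sup>1([0,1]; \<real>\<^sup>2)\<close> through continuous representatives, i.e. the primitives of square integrable
  functions. Only the values on \<open>[0,1]\<close> matter.
\<close>

definition is_weak_deriv :: "(real \<Rightarrow> complex) \<Rightarrow> (real \<Rightarrow> complex) \<Rightarrow> bool" where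
  "is_weak_deriv u v \<longleftrightarrow> set_integrable lborel {0..1} v \<and>
     set_integrable lborel {0..1} (\<lambda>s. (cmod (v s))\<^sup>2) \<and>
     (\<forall>t\<in>{0..1}. u t = u 0 + (LINT s:{0..t}|lborel. v s))"

definition H1 :: "(real \<Rightarrow> complex) set" where
  "H1 = {u. \<exists>v. is_weak_deriv u v}"

text \<open>Determined up to null sets in \<open>[0,1]\<close>, so integrals do not depend on the choice.\<close>

definition weak_deriv :: "(real \<Rightarrow> complex) \<Rightarrow> real \<Rightarrow> complex" where
  "weak_deriv u = (SOME v. is_weak_deriv u v)"

definition H_coll :: "complex \<Rightarrow> (real \<Rightarrow> complex) set" where
  "H_coll q = {u \<in> H1. u 0 = q \<and> u 1 = 0 \<and> (\<forall>s\<in>{0..1}. cmod (u s) \<le> cmod q)}"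

definition kinetic :: "(real \<Rightarrow> complex) \<Rightarrow> real" where
  "kinetic u = 1/2 * (LINT s:{0..1}|lborel. (cmod (weak_deriv u s))\<^sup>2)"

text \<open>
  \<open>\<integral> (h + V(u))\<close> with values in \<open>\<real> \<union> {+\<infinity>}\<close>. As \<open>V > 0\<close> and \<open>V(x) \<rightarrow> +\<infinity>\<close> for \<open>x \<rightarrow> 0\<close>, the
  potential is extended by \<open>V(0) = +\<infinity>\<close>; the conversion to \<^typ>\<open>ennreal\<close> relies on \<open>V > 0\<close>.
\<close>

definition shifted_potential :: "real \<Rightarrow> (complex \<Rightarrow> real) \<Rightarrow> real \<Rightarrow> (real \<Rightarrow> complex) \<Rightarrow> ereal" where
  "shifted_potential \<alpha> U h u = ereal h +
     enn2ereal (\<integral>\<^sup>+s\<in>{0..1}. (if u s = 0 then \<infinity> else ennreal (potential \<alpha> U (u s))) \<partial>lborel)"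

definition maupertuis :: "real \<Rightarrow> (complex \<Rightarrow> real) \<Rightarrow> real \<Rightarrow> (real \<Rightarrow> complex) \<Rightarrow> ereal" where
  "maupertuis \<alpha> U h u = ereal (kinetic u) * shifted_potential \<alpha> U h u"

definition is_minimizer ::
  "real \<Rightarrow> (complex \<Rightarrow> real) \<Rightarrow> real \<Rightarrow> complex \<Rightarrow> (real \<Rightarrow> complex) \<Rightarrow> bool" where
  "is_minimizer \<alpha> U h q u \<longleftrightarrow> u \<in> H_coll q \<and>
     (\<forall>w\<in>H_coll q. maupertuis \<alpha> U h u \<le> maupertuis \<alpha> U h w)"

text \<open>Uniqueness is equality on \<open>[0,1]\<close>, since elements of \<^const>\<open>H1\<close> are arbitrary outside.\<close>

definition has_unique_minimizer ::
  "real \<Rightarrow> (complex \<Rightarrow> real) \<Rightarrow> real \<Rightarrow> complex \<Rightarrow> bool" where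
  "has_unique_minimizer \<alpha> U h q \<longleftrightarrow>
     (\<exists>u. is_minimizer \<alpha> U h q u \<and>
       (\<forall>w. is_minimizer \<alpha> U h q w \<longrightarrow> (\<forall>s\<in>{0..1}. w s = u s)))"

definition rescaling :: "real \<Rightarrow> (complex \<Rightarrow> real) \<Rightarrow> real \<Rightarrow> (real \<Rightarrow> complex) \<Rightarrow> real" where
  "rescaling \<alpha> U h u = sqrt (real_of_ereal (shifted_potential \<alpha> U h u) / kinetic u)"


section \<open>Collision solutions and their orbits in McGehee coordinates\<close>

text \<open>\<open>x\<close> has velocity \<open>v\<close>, solves \<open>x'' = \<nabla>V(x)\<close> at energy \<open>h\<close>, and collides at time \<open>T\<close>.\<close>

definition collision_solution ::
  "real \<Rightarrow> (complex \<Rightarrow> real) \<Rightarrow> real \<Rightarrow> real \<Rightarrow> (real \<Rightarrow> complex) \<Rightarrow> (real \<Rightarrow> complex) \<Rightarrow> bool" where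
  "collision_solution \<alpha> U h T x v \<longleftrightarrow> T > 0 \<and>
     (\<forall>t\<in>{0..<T}. x t \<noteq> 0 \<and>
        (x has_vector_derivative v t) (at t within {0..<T}) \<and>
        (\<exists>g. GDERIV (potential \<alpha> U) (x t) :> g \<and>
             (v has_vector_derivative g) (at t within {0..<T})) \<and>
        1/2 * (cmod (v t))\<^sup>2 - potential \<alpha> U (x t) = h) \<and>
     (x \<longlongrightarrow> 0) (at_left T)"

text \<open>
  \<open>tm\<close> is the old time \<open>t\<close> as a function of the new time \<open>\<tau>\<close>, governed by
  \<open>dt/d\<tau> = z r\<^bsup>1+\<alpha>/2\<^esup>\<close> with \<open>z = sqrt (2U(\<theta>) + 2hr\<^sup>\<alpha>)\<close>.
\<close>

definition mcgehee_orbit ::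
  "real \<Rightarrow> (complex \<Rightarrow> real) \<Rightarrow> real \<Rightarrow> real \<Rightarrow> (real \<Rightarrow> complex) \<Rightarrow> (real \<Rightarrow> complex) \<Rightarrow>
   (real \<Rightarrow> real \<times> complex \<times> complex) \<Rightarrow> bool" where
  "mcgehee_orbit \<alpha> U h T x v \<gamma> \<longleftrightarrow>
     (\<exists>tm. tm 0 = 0 \<and>
       (\<forall>\<tau>\<ge>0. tm \<tau> \<in> {0..<T} \<and> v (tm \<tau>) \<noteq> 0 \<and>
          \<gamma> \<tau> = (cmod (x (tm \<tau>)), sgn (x (tm \<tau>)), sgn (v (tm \<tau>))) \<and>
          (tm has_real_derivative
             sqrt (2 * U (sgn (x (tm \<tau>))) + 2 * h * cmod (x (tm \<tau>)) powr \<alpha>) *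
             cmod (x (tm \<tau>)) powr (1 + \<alpha>/2)) (at \<tau> within {0..})))"

text \<open>
  The orbits \<open>\<gamma>\<close>, to be read on \<open>\<tau> > 0\<close>, of the solutions \<open>x(t) = u(\<omega>t)\<close> given by the minimizers \<open>u\<close>.
\<close>

definition minimizer_orbits ::
  "real \<Rightarrow> (complex \<Rightarrow> real) \<Rightarrow> real \<Rightarrow> complex \<Rightarrow> (real \<Rightarrow> real \<times> complex \<times> complex) set" where
  "minimizer_orbits \<alpha> U h q =
     {\<gamma>. \<exists>u v. is_minimizer \<alpha> U h q u \<and> 0 < maupertuis \<alpha> U h u \<and>
        (let \<omega> = rescaling \<alpha> U h u; x = (\<lambda>t. u (\<omega> * t))
         in collision_solution \<alpha> U h (1 / \<omega>) x v \<and> mcgehee_orbit \<alpha> U h (1 / \<omega>) x v \<gamma>)}"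


section \<open>The local stable manifold\<close>

definition mcgehee_system ::
  "real \<Rightarrow> (complex \<Rightarrow> real) \<Rightarrow> real \<Rightarrow> (real \<Rightarrow> real) \<Rightarrow> (real \<Rightarrow> real) \<Rightarrow> (real \<Rightarrow> real) \<Rightarrow> bool" where
  "mcgehee_system \<alpha> U h r \<theta> \<phi> \<longleftrightarrow>
     (\<forall>\<tau>\<ge>0. r \<tau> \<ge> 0 \<and>
        (r has_real_derivative
           2 * r \<tau> * (U (cis (\<theta> \<tau>)) + h * r \<tau> powr \<alpha>) * cos (\<phi> \<tau> - \<theta> \<tau>)) (at \<tau> within {0..}) \<and>
        (\<theta> has_real_derivative
           2 * (U (cis (\<theta> \<tau>)) + h * r \<tau> powr \<alpha>) * sin (\<phi> \<tau> - \<theta> \<tau>)) (at \<tau> within {0..}) \<and>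
        (\<phi> has_real_derivative
           deriv (\<lambda>s. U (cis s)) (\<theta> \<tau>) * cos (\<phi> \<tau> - \<theta> \<tau>) +
           \<alpha> * U (cis (\<theta> \<tau>)) * sin (\<phi> \<tau> - \<theta> \<tau>)) (at \<tau> within {0..}))"

text \<open>
  The stable manifold of \<open>(0, \<theta>\<^sup>*, \<theta>\<^sup>* + \<pi>)\<close> relative to a neighbourhood \<open>N\<close>: the initial points of
  the solutions that stay in \<open>N\<close> and converge to the equilibrium. It is the global stable manifold
  for \<open>N = UNIV\<close>.
\<close>

definition stable_manifold ::
  "real \<Rightarrow> (complex \<Rightarrow> real) \<Rightarrow> real \<Rightarrow> real \<Rightarrow> (real \<times> complex \<times> complex) set \<Rightarrow>
   (real \<times> complex \<times> complex) set" where
  "stable_manifold \<alpha> U h \<theta>s N =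
     {(r 0, cis (\<theta> 0), cis (\<phi> 0)) | r \<theta> \<phi>.
        mcgehee_system \<alpha> U h r \<theta> \<phi> \<and>
        (\<forall>\<tau>\<ge>0. (r \<tau>, cis (\<theta> \<tau>), cis (\<phi> \<tau>)) \<in> N) \<and>
        ((\<lambda>\<tau>. (r \<tau>, cis (\<theta> \<tau>), cis (\<phi> \<tau>))) \<longlongrightarrow> (0, cis \<theta>s, cis (\<theta>s + pi))) at_top}"

text \<open>
  Near the equilibrium the stable manifold is the graph of \<open>\<Psi>\<close>. The graph is taken relative to a
  neighbourhood \<open>N\<close> because orbits of the global stable manifold may travel far away before
  converging, and then have other points over the same \<open>(r, \<theta>)\<close>. Only continuity of \<open>\<Psi>\<close> is
  required: because of the terms in \<open>r\<^sup>\<alpha>\<close>, it need not be of class \<open>C\<^sup>2\<close> up to \<open>r = 0\<close>.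
\<close>

definition stable_graph ::
  "real \<Rightarrow> (complex \<Rightarrow> real) \<Rightarrow> real \<Rightarrow> real \<Rightarrow> (real \<times> complex \<times> complex) set \<Rightarrow>
   real \<Rightarrow> real \<Rightarrow> (real \<Rightarrow> real \<Rightarrow> complex) \<Rightarrow> bool" where
  "stable_graph \<alpha> U h \<theta>s N rloc \<delta>loc \<Psi> \<longleftrightarrow>
     open N \<and> (0, cis \<theta>s, cis (\<theta>s + pi)) \<in> N \<and> rloc > 0 \<and> \<delta>loc > 0 \<and>
     (\<forall>r\<in>{0..<rloc}. \<forall>\<theta>\<in>{\<theta>s - \<delta>loc<..<\<theta>s + \<delta>loc}. cmod (\<Psi> r \<theta>) = 1) \<and>
     continuous_on ({0..<rloc} \<times> {\<theta>s - \<delta>loc<..<\<theta>s + \<delta>loc}) (\<lambda>(r, \<theta>). \<Psi> r \<theta>) \<and>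
     \<Psi> 0 \<theta>s = cis (\<theta>s + pi) \<and>
     (\<forall>r\<in>{0<..<rloc}. \<forall>\<theta>\<in>{\<theta>s - \<delta>loc<..<\<theta>s + \<delta>loc}. \<forall>\<phi>.
        (r, cis \<theta>, cis \<phi>) \<in> stable_manifold \<alpha> U h \<theta>s N \<longleftrightarrow> cis \<phi> = \<Psi> r \<theta>)"

definition W_loc ::
  "real \<Rightarrow> (real \<Rightarrow> real \<Rightarrow> complex) \<Rightarrow> real \<Rightarrow> real \<Rightarrow> (real \<times> complex \<times> complex) set" where
  "W_loc \<theta>s \<Psi> rb \<delta>b =
     {(r, cis \<theta>, \<Psi> r \<theta>) | r \<theta>. r \<in> {0..<rb} \<and> \<theta> \<in> {\<theta>s - \<delta>b<..<\<theta>s + \<delta>b}}"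

definition Q0 :: "real \<Rightarrow> real \<Rightarrow> real \<Rightarrow> complex set" where
  "Q0 \<theta>s rb \<delta>b =
     {complex_of_real r * cis \<theta>0 | r \<theta>0. r \<in> {0<..<rb} \<and> \<theta>0 \<in> {\<theta>s - \<delta>b<..<\<theta>s + \<delta>b}}"

end

theory Submission
  imports Defs
begin

text \<open>
  In the coordinates \<open>(s, \<theta>)\<close>, \<open>s = - ln r\<close>, the Jacobi length of a path is
  \<open>\<integral> G(s, \<theta>) sqrt (ds\<^sup>2 + d\<theta>\<^sup>2)\<close> with \<open>G = r powr (1 - \<alpha>/2) * sqrt (2 (U(\<theta>) + h r\<^sup>\<alpha>))\<close>. The orbits of the
  McGehee system near the equilibrium are the geodesics \<open>\<theta>(s)\<close>, which satisfy a second order equation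
  with a saddle at \<open>\<theta>s\<close>; by a Lyapunov--Perron contraction through every point near the collision there
  is a ray, i.e. a solution decaying to the saddle. Along a ray \<open>\<theta>0\<close> with
  slope \<open>\<theta>0' = - p\<close>, action \<open>S(s)\<close> and momentum \<open>P = G p / sqrt (1 + p\<^sup>2)\<close>, the function \<open>W(s, \<theta>) = S(s) + P(s) (\<theta> - \<theta>0(s))\<close>
  satisfies \<open>\<bar>\<nabla>W\<bar> \<le> G\<close>, because \<open>U\<close> is uniformly convex near \<open>\<theta>s\<close>, with equality only on the ray.
  Hence \<open>W\<close> calibrates the ray: \<open>W(q)\<^sup>2 / 4\<close> is a lower bound of the Maupertuis functional, attained only by the ray
  in its natural time. So a ray is the unique minimizer from its starting point; it belongs to the stable manifold,
  hence to the graph of \<open>\<Psi>\<close>, and \<open>\<bar>\<theta> - \<theta>s\<bar>\<close> decreases along it, so that it does not leave the sector.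
\<close>

section \<open>Decaying solutions at a saddle\<close>

text \<open>A field of extremals near the collision would call for differentiability of the stable
  manifold in its initial points, delicate at \<open>r = 0\<close> because of the terms in
  \<open>r powr \<alpha>\<close>. The calibration therefore uses one ray only: extending its action
  linearly in the angle needs no regularity beyond that of the ray. Three obstacles shape the rest.
  An admissible path may leave the domain of \<open>W\<close>, wind round the origin or collide
  early, so a second, global subsolution takes over at the exit. The functional is a product of two
  integrals \<open>K\<close> and \<open>Pt\<close>, not a length; the calibration bounds
  \<open>c * K + Pt / c\<close> from below for every weight \<open>c > 0\<close>, and the optimal
  \<open>c\<close> recovers the product and fixes the time parametrization of a minimizer. Finally,
  rays are constructed on \<open>s > - d\<close> with \<open>d > 0\<close>, beyond their starting
  point: this gives two-sided derivatives and an open domain for \<open>W\<close> around that point,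
  and it lets every point of the graph appear at a strictly positive time on the orbit of a
  minimizer that starts slightly earlier.\<close>

lemma exp_tail_integral:
  fixes q :: "real \<Rightarrow> real"
  assumes cont: "continuous_on {m<..} q" and "\<gamma> > 0"
    and bound: "\<And>x. x > m \<Longrightarrow> \<bar>q x\<bar> \<le> K * exp (- \<gamma> * x)" and "s > m"
  shows "q integrable_on {s..}"
    and "\<bar>integral {s..} q\<bar> \<le> K / \<gamma> * exp (- \<gamma> * s)"
    and "((\<lambda>s. integral {s..} q) has_real_derivative - q s) (at s)"
proof -
  have exp_int: "((\<lambda>x. K * exp (- \<gamma> * x)) has_integral K * (exp (- \<gamma> * a) / \<gamma>)) {a..}" for a
    by (intro has_integral_mult_right has_integral_exp_minus_to_infinity \<open>\<gamma> > 0\<close>)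
  have integrable: "q integrable_on {a..}" if "a > m" for a
    by (rule measurable_bounded_by_integrable_imp_integrable[where g = "\<lambda>x. K * exp (- \<gamma> * x)"])
      (use that exp_int bound cont in \<open>auto intro!: continuous_imp_measurable_on_sets_lebesgue
        intro: continuous_on_subset\<close>)
  then show "q integrable_on {s..}" using \<open>s > m\<close> .
  have "norm (integral {s..} q) \<le> integral {s..} (\<lambda>x. K * exp (- \<gamma> * x))"
    by (rule integral_norm_bound_integral) (use integrable exp_int bound \<open>s > m\<close> in auto)
  also have "\<dots> = K / \<gamma> * exp (- \<gamma> * s)"
    using integral_unique[OF exp_int] by simp
  finally show "\<bar>integral {s..} q\<bar> \<le> K / \<gamma> * exp (- \<gamma> * s)" by simp
  \<comment> \<open>A base point strictly between \<open>m\<close> and \<open>s\<close> turns the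
    tail near \<open>s\<close> into a constant minus an integral over a compact interval.\<close>
  define l where "l = (m + s) / 2"
  have l: "m < l" "l < s" using \<open>s > m\<close> by (auto simp: l_def)
  have split: "integral {t..} q = integral {l..} q - integral {l..t} q" if "t \<ge> l" for t
  proof -
    have "integral ({l..t} \<union> {t..}) q = integral {l..t} q + integral {t..} q"
    proof (rule integral_Un)
      have "{l..t} \<inter> {t..} = {t}" using that by auto
      then show "negligible ({l..t} \<inter> {t..})" by simp
      show "q integrable_on {l..t}"
        by (rule integrable_continuous_real) (use cont l in \<open>auto intro: continuous_on_subset\<close>)
    qed (use integrable l that in auto)
    moreover have "{l..t} \<union> {t..} = {l..}" using that by auto
    ultimately show ?thesis by simp
  qed
  have "((\<lambda>t. integral {l..t} q) has_real_derivative q s) (at s within {l..s + 1})"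
    by (rule integral_has_real_derivative) (use cont l in \<open>auto intro: continuous_on_subset\<close>)
  then have "((\<lambda>t. integral {l..t} q) has_real_derivative q s) (at s)"
    using l by (simp add: at_within_Icc_at)
  then have "((\<lambda>t. integral {l..} q - integral {l..t} q) has_real_derivative 0 - q s) (at s)"
    by (intro DERIV_diff DERIV_const)
  then have "((\<lambda>t. integral {l..} q - integral {l..t} q) has_real_derivative - q s) (at s)"
    by simp
  then show "((\<lambda>s. integral {s..} q) has_real_derivative - q s) (at s)"
    by (rule has_field_derivative_transform_within_open[where S = "{l<..}"])
      (use l in \<open>auto intro: split[symmetric]\<close>)
qed

text \<open>
  Bounded solutions of \<open>y' = b y + g\<close> and \<open>z' = - a z + y\<close>, the latter with the value \<open>z0\<close>
  at \<open>1\<close>.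
\<close>

definition unstable_part :: "real \<Rightarrow> (real \<Rightarrow> real) \<Rightarrow> real \<Rightarrow> real" where
  "unstable_part b g s = - exp (b * s) * integral {s..} (\<lambda>x. exp (- b * x) * g x)"

definition stable_part :: "real \<Rightarrow> real \<Rightarrow> (real \<Rightarrow> real) \<Rightarrow> real \<Rightarrow> real" where
  "stable_part a z0 y s = exp (- a * (s - 1)) * z0 +
     exp (- a * s) * (integral {0..s} (\<lambda>x. exp (a * x) * y x) - integral {0..1} (\<lambda>x. exp (a * x) * y x))"

context
  fixes b :: real and g :: "real \<Rightarrow> real" and G :: real
  assumes b: "b > 0" and g: "continuous_on UNIV g" and G: "\<And>x. \<bar>g x\<bar> \<le> G"
begin

lemma unstable_part_integrand:
  shows "continuous_on UNIV (\<lambda>x. exp (- b * x) * g x)"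
    and "\<bar>exp (- b * x) * g x\<bar> \<le> G * exp (- b * x)"
  using G[of x] by (auto intro!: continuous_intros g simp: abs_mult mult.commute)

lemmas unstable_part_tail =
  exp_tail_integral[OF continuous_on_subset[OF unstable_part_integrand(1) subset_UNIV] b
    unstable_part_integrand(2)]

lemma unstable_part_bound: "\<bar>unstable_part b g s\<bar> \<le> G / b"
proof -
  have "\<bar>unstable_part b g s\<bar> \<le> exp (b * s) * (G / b * exp (- b * s))"
    unfolding unstable_part_def abs_mult abs_minus_cancel abs_exp_cancel
    by (intro mult_left_mono unstable_part_tail(2)[where m = "s - 1"]) auto
  also have "\<dots> = G / b * (exp (b * s) * exp (- b * s))"
    by (simp only: ac_simps)
  also have "\<dots> = G / b" by (simp flip: exp_add)
  finally show ?thesis .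
qed

lemma unstable_part_deriv:
  "(unstable_part b g has_real_derivative b * unstable_part b g s + g s) (at s)"
proof -
  have "((\<lambda>s. - exp (b * s) * integral {s..} (\<lambda>x. exp (- b * x) * g x)) has_real_derivative
     b * unstable_part b g s + g s) (at s)"
    apply (rule derivative_eq_intros unstable_part_tail(3)[of "s - 1"] refl | simp)+
    using b by (simp add: unstable_part_def exp_minus field_simps)
  then show ?thesis
    unfolding unstable_part_def[abs_def] .
qed

end

lemma unstable_part_diff:
  assumes "b > 0" "continuous_on UNIV g" "continuous_on UNIV g'"
    "\<And>x. \<bar>g x\<bar> \<le> G" "\<And>x. \<bar>g' x\<bar> \<le> G'"
  shows "unstable_part b g s - unstable_part b g' s = unstable_part b (\<lambda>x. g x - g' x) s"
proof -
  have "integral {s..} (\<lambda>x. exp (- b * x) * (g x - g' x)) =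
    integral {s..} (\<lambda>x. exp (- b * x) * g x) - integral {s..} (\<lambda>x. exp (- b * x) * g' x)"
    using unstable_part_tail(1)[of b g G "s - 1" s] unstable_part_tail(1)[of b g' G' "s - 1" s] assms
    by (simp add: right_diff_distrib integral_diff)
  then show ?thesis
    unfolding unstable_part_def by (simp add: right_diff_distrib[of "exp (b * s)"])
qed

context
  fixes a :: real and y :: "real \<Rightarrow> real" and Y :: real
  assumes a: "a > 0" and y: "continuous_on {0..} y" and Y: "\<And>x. x \<ge> 0 \<Longrightarrow> \<bar>y x\<bar> \<le> Y"
begin

lemma stable_part_deriv:
  assumes "s > 0"
  shows "(stable_part a z0 y has_real_derivative - a * stable_part a z0 y s + y s) (at s)"
proof -
  have "((\<lambda>t. integral {0..t} (\<lambda>x. exp (a * x) * y x)) has_real_derivative exp (a * s) * y s)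
    (at s within {0..s + 1})"
    by (rule integral_has_real_derivative)
      (use assms y in \<open>auto intro!: continuous_intros intro: continuous_on_subset\<close>)
  then have J: "((\<lambda>t. integral {0..t} (\<lambda>x. exp (a * x) * y x)) has_real_derivative exp (a * s) * y s) (at s)"
    using assms by (simp add: at_within_Icc_at)
  have "((\<lambda>s. exp (- a * (s - 1)) * z0 + exp (- a * s) *
      (integral {0..s} (\<lambda>x. exp (a * x) * y x) - integral {0..1} (\<lambda>x. exp (a * x) * y x)))
    has_real_derivative - a * stable_part a z0 y s + y s) (at s)"
    apply (rule derivative_eq_intros J refl)+
    by (simp add: stable_part_def exp_minus field_simps)
  then show ?thesis
    unfolding stable_part_def[abs_def] .
qed

lemma stable_part_continuous: "continuous_on {0..} (stable_part a z0 y)"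
proof -
  let ?J = "\<lambda>t. integral {0..t} (\<lambda>x. exp (a * x) * y x)"
  have "continuous (at s within {0..}) ?J" if "s \<ge> 0" for s
  proof -
    have "(\<lambda>x. exp (a * x) * y x) integrable_on {0..s + 1}"
      by (rule integrable_continuous_real)
        (use y in \<open>auto intro!: continuous_intros intro: continuous_on_subset\<close>)
    from indefinite_integral_continuous_1[OF this]
    have "continuous (at s within {0..s + 1}) ?J"
      using that by (auto simp: continuous_on_eq_continuous_within)
    moreover have "at s within {0..s + 1} = at s within {0..}"
      by (rule at_within_nhd[where S = "{..<s + 1}"]) auto
    ultimately show ?thesis by (simp add: continuous_within)
  qed
  then have "continuous_on {0..} ?J"
    by (auto simp: continuous_on_eq_continuous_within)
  then show ?thesis
    unfolding stable_part_def[abs_def] by (intro continuous_intros) auto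
qed

text \<open>The factor \<open>exp a\<close> is the price of prescribing the value at 1 instead of 0:
  between 0 and 1 the contracting equation is followed backwards.\<close>

lemma stable_part_bound:
  assumes "s \<ge> 0"
  shows "\<bar>stable_part a z0 y s\<bar> \<le> exp a * \<bar>z0\<bar> + exp a / a * Y"
proof -
  let ?q = "\<lambda>x. exp (a * x) * y x"
  have int: "?q integrable_on {u..v}" if "u \<ge> 0" for u v
    by (rule integrable_continuous_real)
      (use that y in \<open>auto intro!: continuous_intros intro: continuous_on_subset\<close>)
  have bound: "\<bar>integral {u..v} ?q\<bar> \<le> Y * (exp (a * v) - exp (a * u)) / a" if "0 \<le> u" "u \<le> v" for u v
  proof -
    have "((\<lambda>x. Y * exp (a * x)) has_integral Y * exp (a * v) / a - Y * exp (a * u) / a) {u..v}"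
      using a that by (intro fundamental_theorem_of_calculus)
        (auto intro!: derivative_eq_intros simp flip: has_real_derivative_iff_has_vector_derivative)
    note I = this
    have "norm (integral {u..v} ?q) \<le> integral {u..v} (\<lambda>x. Y * exp (a * x))"
      by (rule integral_norm_bound_integral)
        (use I int that Y in \<open>auto simp: abs_mult mult.commute[of _ "exp _"]\<close>)
    also have "\<dots> = Y * exp (a * v) / a - Y * exp (a * u) / a"
      using I by (rule integral_unique)
    finally show ?thesis by (simp add: right_diff_distrib diff_divide_distrib)
  qed
  have Y0: "Y \<ge> 0" using Y[of 0] by linarith
  have J: "\<bar>integral {0..s} ?q - integral {0..1} ?q\<bar> \<le> exp (a * s) * (exp a / a * Y)"
  proof (cases "s \<le> 1")
    case True
    then have "integral {0..1} ?q = integral {0..s} ?q + integral {s..1} ?q"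
      using assms Henstock_Kurzweil_Integration.integral_combine[of 0 s 1 ?q] int[of 0 1] by simp
    then have "\<bar>integral {0..s} ?q - integral {0..1} ?q\<bar> \<le> Y * (exp (a * 1) - exp (a * s)) / a"
      using bound[of s 1] assms True by simp
    also have "\<dots> \<le> Y * exp a / a"
      using a Y0 by (intro divide_right_mono mult_left_mono) auto
    also have "\<dots> \<le> exp (a * s) * (Y * exp a / a)"
      using mult_right_mono[of 1 "exp (a * s)" "Y * exp a / a"] assms a Y0 by simp
    finally show ?thesis by (simp add: mult.commute)
  next
    case False
    then have "integral {0..s} ?q = integral {0..1} ?q + integral {1..s} ?q"
      using assms Henstock_Kurzweil_Integration.integral_combine[of 0 1 s ?q] int[of 0 s] by simp
    then have "\<bar>integral {0..s} ?q - integral {0..1} ?q\<bar> \<le> Y * (exp (a * s) - exp (a * 1)) / a"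
      using bound[of 1 s] assms False by simp
    also have "\<dots> \<le> Y * exp (a * s) / a"
      using a Y0 by (intro divide_right_mono mult_left_mono) auto
    also have "\<dots> \<le> exp a * (Y * exp (a * s) / a)"
      using mult_right_mono[of 1 "exp a" "Y * exp (a * s) / a"] assms a Y0 by simp
    finally show ?thesis by (simp add: mult_ac)
  qed
  have "\<bar>stable_part a z0 y s\<bar> \<le> exp (- a * (s - 1)) * \<bar>z0\<bar> +
      exp (- a * s) * \<bar>integral {0..s} ?q - integral {0..1} ?q\<bar>"
    unfolding stable_part_def by (rule abs_triangle_ineq[THEN order_trans]) (simp add: abs_mult)
  also have "\<dots> \<le> exp a * \<bar>z0\<bar> + exp (- a * s) * (exp (a * s) * (exp a / a * Y))"
    using assms a J by (intro add_mono mult_right_mono mult_left_mono) (auto simp: algebra_simps)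
  also have "exp (- a * s) * (exp (a * s) * (exp a / a * Y)) = exp a / a * Y"
    by (simp add: exp_minus)
  finally show ?thesis .
qed

end

lemma stable_part_diff:
  assumes "continuous_on {0..} y" "continuous_on {0..} y'" "s \<ge> 0"
  shows "stable_part a z0 y s - stable_part a z0 y' s = stable_part a 0 (\<lambda>x. y x - y' x) s"
proof -
  have int: "(\<lambda>x. exp (a * x) * w x) integrable_on {0..v}" if "continuous_on {0..} w" for v w
    by (rule integrable_continuous_real)
      (use that in \<open>auto intro!: continuous_intros intro: continuous_on_subset\<close>)
  show ?thesis
    unfolding stable_part_def using int[OF assms(1)] int[OF assms(2)]
    by (simp add: right_diff_distrib integral_diff algebra_simps)
qed


text \<open>The linear part has the eigenvalues \<open>- a\<close> and \<open>b\<close>, with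
  unstable coordinate \<open>a * x - p\<close>. After multiplication by
  \<open>exp (\<mu> * s)\<close>, decay at rate \<open>\<mu>\<close> becomes boundedness, and the
  weighted coordinates \<open>\<xi>\<close> of \<open>x\<close> and \<open>\<eta>\<close> of
  \<open>a * x - p\<close> solve two scalar linear equations. The unknown of the fixed point problem
  is the weighted nonlinearity \<open>g\<close> and not the orbit, which is recovered from
  \<open>g\<close> by \<open>unstable_part\<close> and \<open>stable_part\<close>. \<open>K\<close>
  bounds this linear step, measured by the sum of the sizes of \<open>x\<close> and
  \<open>p\<close>; the condition on \<open>L\<close> makes the contraction constant 1/2. The value
  is prescribed at 1 so that the orbit also exists to the left of that point.\<close>

lemma saddle_stable_orbit:
  fixes f :: "real \<Rightarrow> real \<Rightarrow> real \<Rightarrow> real"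
  defines "K \<equiv> \<lambda>a b \<mu>. ((1 + a) * (exp (a - \<mu>) / (a - \<mu>)) + 1) / (b + \<mu>)"
  assumes "0 < \<mu>" "\<mu> < a" "0 < b" "0 < \<epsilon>"
    and cont: "continuous_on ({0..} \<times> {-\<epsilon>..\<epsilon>} \<times> {-\<epsilon>..\<epsilon>}) (\<lambda>(s, x, p). f s x p)"
    and zero: "\<And>s. s \<ge> 0 \<Longrightarrow> f s 0 0 = 0"
    and lip: "\<And>s x p x' p'. \<lbrakk>s \<ge> 0; \<bar>x\<bar> \<le> \<epsilon>; \<bar>p\<bar> \<le> \<epsilon>; \<bar>x'\<bar> \<le> \<epsilon>; \<bar>p'\<bar> \<le> \<epsilon>\<rbrakk> \<Longrightarrow>
      \<bar>f s x p - f s x' p'\<bar> \<le> L * (\<bar>x - x'\<bar> + \<bar>p - p'\<bar>)"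
    and L: "0 \<le> L" "2 * K a b \<mu> * L \<le> 1"
    and x0: "2 * (1 + a) * exp a * \<bar>x0\<bar> \<le> \<epsilon>"
  obtains x p where "x 1 = x0"
    and "\<And>s. s > 0 \<Longrightarrow> (x has_real_derivative - p s) (at s)"
    and "\<And>s. s > 0 \<Longrightarrow> (p has_real_derivative (b - a) * p s - a * b * x s + f s (x s) (p s)) (at s)"
    and "\<And>s. s \<ge> 0 \<Longrightarrow> \<bar>x s\<bar> \<le> \<epsilon> * exp (- \<mu> * s)"
    and "\<And>s. s \<ge> 0 \<Longrightarrow> \<bar>p s\<bar> \<le> \<epsilon> * exp (- \<mu> * s)"
proof -
  define a' where "a' = a - \<mu>"
  define b' where "b' = b + \<mu>"
  define K0 where "K0 = K a b \<mu>"
  define C where "C = exp a' / a'"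
  have pos: "a' > 0" "b' > 0" "C > 0" "a > 0" "K0 > 0"
    using assms by (auto simp: a'_def b'_def C_def K0_def intro!: divide_pos_pos add_pos_pos)
  have K0: "K0 = ((1 + a) * C + 1) / b'"
    by (simp add: K0_def K_def C_def a'_def b'_def)
  \<comment> \<open>Half of \<open>\<epsilon>\<close> is reserved for the contribution of the
    initial value \<open>x0\<close>, the other half for the contribution \<open>K0 * \<rho>\<close>
    of \<open>g\<close>.\<close>
  define \<rho> where "\<rho> = \<epsilon> / (2 * K0)"
  have \<rho>: "\<rho> > 0" using pos \<open>\<epsilon> > 0\<close> by (simp add: \<rho>_def)
  define \<eta> where "\<eta> = unstable_part b'"
  define \<xi> where "\<xi> = (\<lambda>g. stable_part a' (exp \<mu> * x0) (\<eta> g))"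
  define X where "X = (\<lambda>g s. exp (- \<mu> * s) * \<xi> g s)"
  define P where "P = (\<lambda>g s. exp (- \<mu> * s) * (a * \<xi> g s - \<eta> g s))"
  \<comment> \<open>The nonlinearity is controlled for nonnegative times only. Freezing the time at
    \<open>max 0 s\<close> yields a bounded continuous function on the whole line, an element of the
    complete space on which the contraction acts.\<close>
  define T where "T = (\<lambda>g s. - exp (\<mu> * max 0 s) * f (max 0 s) (X g (max 0 s)) (P g (max 0 s)))"
  have \<eta>_bound: "\<bar>\<eta> g s\<bar> \<le> G / b'" if "continuous_on UNIV g" "\<And>x. \<bar>g x\<bar> \<le> G" for g G s
    unfolding \<eta>_def by (rule unstable_part_bound) (use that pos in auto)
  have \<eta>_deriv: "(\<eta> g has_real_derivative b' * \<eta> g s + g s) (at s)"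
    if "continuous_on UNIV g" "\<And>x. \<bar>g x\<bar> \<le> G" for g G s
    unfolding \<eta>_def by (rule unstable_part_deriv) (use that pos in auto)
  have \<eta>_cont: "continuous_on S (\<eta> g)" if "continuous_on UNIV g" "\<And>x. \<bar>g x\<bar> \<le> G" for g G S
    by (rule continuous_at_imp_continuous_on) (use \<eta>_deriv[OF that] DERIV_isCont in blast)
  have \<xi>_bound: "\<bar>\<xi> g s\<bar> \<le> exp a * \<bar>x0\<bar> + C * (G / b')"
    if "continuous_on UNIV g" "\<And>x. \<bar>g x\<bar> \<le> G" "s \<ge> 0" for g G s
  proof -
    have "\<bar>\<xi> g s\<bar> \<le> exp a' * \<bar>exp \<mu> * x0\<bar> + exp a' / a' * (G / b')"
      unfolding \<xi>_def
      by (rule stable_part_bound) (use that pos \<eta>_cont[OF that(1,2)] \<eta>_bound[OF that(1,2)] in auto)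
    also have "exp a' * \<bar>exp \<mu> * x0\<bar> = exp a * \<bar>x0\<bar>"
      by (simp add: abs_mult a'_def exp_diff)
    finally show ?thesis by (simp add: C_def)
  qed
  have \<xi>_cont: "continuous_on {0..} (\<xi> g)" if "continuous_on UNIV g" "\<And>x. \<bar>g x\<bar> \<le> G" for g G
    unfolding \<xi>_def
    by (rule stable_part_continuous) (use that pos \<eta>_cont[OF that] \<eta>_bound[OF that] in auto)
  have sum_bound: "\<bar>\<xi> g s\<bar> + \<bar>a * \<xi> g s - \<eta> g s\<bar> \<le> \<epsilon>"
    if g: "continuous_on UNIV g" "\<And>x. \<bar>g x\<bar> \<le> \<rho>" and "s \<ge> 0" for g s
  proof -
    have "\<bar>a * \<xi> g s - \<eta> g s\<bar> \<le> a * \<bar>\<xi> g s\<bar> + \<bar>\<eta> g s\<bar>"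
      using pos by (auto intro!: abs_triangle_ineq4[THEN order_trans] simp: abs_mult)
    then have "\<bar>\<xi> g s\<bar> + \<bar>a * \<xi> g s - \<eta> g s\<bar> \<le> (1 + a) * \<bar>\<xi> g s\<bar> + \<bar>\<eta> g s\<bar>"
      by (simp add: algebra_simps)
    also have "\<dots> \<le> (1 + a) * (exp a * \<bar>x0\<bar> + C * (\<rho> / b')) + \<rho> / b'"
      using \<xi>_bound[OF that] \<eta>_bound[OF g] pos by (intro add_mono mult_left_mono) auto
    also have "\<dots> = (1 + a) * exp a * \<bar>x0\<bar> + K0 * \<rho>"
      using pos by (simp add: K0 field_simps)
    also have "\<dots> \<le> \<epsilon> / 2 + \<epsilon> / 2"
    proof (rule add_mono)
      have "2 * ((1 + a) * exp a * \<bar>x0\<bar>) \<le> \<epsilon>" using x0 by (simp only: mult.assoc)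
      then show "(1 + a) * exp a * \<bar>x0\<bar> \<le> \<epsilon> / 2" by linarith
    qed (use pos in \<open>simp add: \<rho>_def\<close>)
    finally show ?thesis by simp
  qed
  have small: "\<bar>X g s\<bar> \<le> \<epsilon> * exp (- \<mu> * s)" "\<bar>P g s\<bar> \<le> \<epsilon> * exp (- \<mu> * s)" "\<bar>X g s\<bar> \<le> \<epsilon>" "\<bar>P g s\<bar> \<le> \<epsilon>"
    if g: "continuous_on UNIV g" "\<And>x. \<bar>g x\<bar> \<le> \<rho>" and s: "s \<ge> 0" for g s
  proof -
    have *: "\<bar>\<xi> g s\<bar> \<le> \<epsilon>" "\<bar>a * \<xi> g s - \<eta> g s\<bar> \<le> \<epsilon>" using sum_bound[OF that] by linarith+
    show "\<bar>X g s\<bar> \<le> \<epsilon> * exp (- \<mu> * s)" "\<bar>P g s\<bar> \<le> \<epsilon> * exp (- \<mu> * s)"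
      using * by (auto simp: X_def P_def abs_mult mult.commute)
    moreover have "\<epsilon> * exp (- \<mu> * s) \<le> \<epsilon>"
      using s \<open>\<epsilon> > 0\<close> \<open>\<mu> > 0\<close> by simp
    ultimately show "\<bar>X g s\<bar> \<le> \<epsilon>" "\<bar>P g s\<bar> \<le> \<epsilon>" by linarith+
  qed
  have exp_cancel: "exp (\<mu> * s) * (exp (- \<mu> * s) * w) = w" for s w :: real
    by (simp add: exp_minus)
  have T_diff: "\<bar>T g s - T g' s\<bar> \<le> G / 2"
    if g: "continuous_on UNIV g" "\<And>x. \<bar>g x\<bar> \<le> \<rho>" and g': "continuous_on UNIV g'" "\<And>x. \<bar>g' x\<bar> \<le> \<rho>"
      and G: "\<And>x. \<bar>g x - g' x\<bar> \<le> G" for g g' G s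
  proof -
    define t where "t = max 0 s"
    have t: "t \<ge> 0" by (simp add: t_def)
    have d\<eta>: "\<eta> g u - \<eta> g' u = \<eta> (\<lambda>x. g x - g' x) u" for u
      unfolding \<eta>_def by (rule unstable_part_diff) (use g g' pos in auto)
    have cd: "continuous_on UNIV (\<lambda>x. g x - g' x)"
      by (intro continuous_intros g g')
    have b\<eta>: "\<bar>\<eta> g u - \<eta> g' u\<bar> \<le> G / b'" for u
      unfolding d\<eta> by (rule \<eta>_bound[OF cd G])
    have "\<xi> g t - \<xi> g' t = stable_part a' 0 (\<lambda>u. \<eta> g u - \<eta> g' u) t"
      using stable_part_diff[of "\<eta> g" "\<eta> g'" t a' "exp \<mu> * x0"] \<eta>_cont[OF g] \<eta>_cont[OF g'] t
      by (simp add: \<xi>_def)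
    also have "\<bar>\<dots>\<bar> \<le> exp a' * \<bar>0\<bar> + exp a' / a' * (G / b')"
      by (rule stable_part_bound)
        (use pos b\<eta> t \<eta>_cont[OF g] \<eta>_cont[OF g'] in \<open>auto intro!: continuous_intros\<close>)
    finally have b\<xi>: "\<bar>\<xi> g t - \<xi> g' t\<bar> \<le> C * (G / b')" by (simp add: C_def)
    have "T g s - T g' s = exp (\<mu> * t) * (f t (X g' t) (P g' t) - f t (X g t) (P g t))"
      by (simp add: T_def t_def algebra_simps)
    also have "\<bar>\<dots>\<bar> = exp (\<mu> * t) * \<bar>f t (X g' t) (P g' t) - f t (X g t) (P g t)\<bar>"
      by (simp add: abs_mult)
    also have "\<dots> \<le> exp (\<mu> * t) * (L * (\<bar>X g' t - X g t\<bar> + \<bar>P g' t - P g t\<bar>))"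
      by (intro mult_left_mono lip small g g' t) auto
    also have "\<bar>X g' t - X g t\<bar> = exp (- \<mu> * t) * \<bar>\<xi> g t - \<xi> g' t\<bar>"
      by (simp add: X_def abs_mult abs_minus_commute flip: right_diff_distrib)
    also have "\<bar>P g' t - P g t\<bar> = exp (- \<mu> * t) * \<bar>a * (\<xi> g t - \<xi> g' t) - (\<eta> g t - \<eta> g' t)\<bar>"
    proof -
      have "P g' t - P g t = - (exp (- \<mu> * t) * (a * (\<xi> g t - \<xi> g' t) - (\<eta> g t - \<eta> g' t)))"
        by (simp add: P_def algebra_simps)
      then show ?thesis by (simp add: abs_mult)
    qed
    also have "exp (\<mu> * t) * (L * (exp (- \<mu> * t) * \<bar>\<xi> g t - \<xi> g' t\<bar> +
        exp (- \<mu> * t) * \<bar>a * (\<xi> g t - \<xi> g' t) - (\<eta> g t - \<eta> g' t)\<bar>)) =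
      L * (\<bar>\<xi> g t - \<xi> g' t\<bar> + \<bar>a * (\<xi> g t - \<xi> g' t) - (\<eta> g t - \<eta> g' t)\<bar>)"
      using exp_cancel[of t "L * (\<bar>\<xi> g t - \<xi> g' t\<bar> + \<bar>a * (\<xi> g t - \<xi> g' t) - (\<eta> g t - \<eta> g' t)\<bar>)"]
      by (simp only: distrib_left mult.left_commute)
    also have "\<dots> \<le> L * (K0 * G)"
    proof (rule mult_left_mono)
      have "\<bar>a * (\<xi> g t - \<xi> g' t) - (\<eta> g t - \<eta> g' t)\<bar> \<le> a * \<bar>\<xi> g t - \<xi> g' t\<bar> + \<bar>\<eta> g t - \<eta> g' t\<bar>"
        using pos by (auto intro!: abs_triangle_ineq4[THEN order_trans] simp: abs_mult)
      then have "\<bar>\<xi> g t - \<xi> g' t\<bar> + \<bar>a * (\<xi> g t - \<xi> g' t) - (\<eta> g t - \<eta> g' t)\<bar> \<le>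
          (1 + a) * \<bar>\<xi> g t - \<xi> g' t\<bar> + \<bar>\<eta> g t - \<eta> g' t\<bar>"
        by (simp add: algebra_simps)
      also have "\<dots> \<le> (1 + a) * (C * (G / b')) + G / b'"
        using b\<xi> b\<eta> pos by (intro add_mono mult_left_mono) auto
      also have "\<dots> = K0 * G" using pos by (simp add: K0 field_simps)
      finally show "\<bar>\<xi> g t - \<xi> g' t\<bar> + \<bar>a * (\<xi> g t - \<xi> g' t) - (\<eta> g t - \<eta> g' t)\<bar> \<le> K0 * G" .
    qed (use L in auto)
    also have "L * (K0 * G) \<le> G / 2"
    proof -
      have "G \<ge> 0" using G[of 0] by linarith
      then have "(2 * K0 * L) * G \<le> 1 * G" using L by (intro mult_right_mono) (auto simp: K0_def)
      then show ?thesis by (simp add: algebra_simps)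
    qed
    finally show ?thesis .
  qed
  have T_bound: "\<bar>T g s\<bar> \<le> \<rho>" if g: "continuous_on UNIV g" "\<And>x. \<bar>g x\<bar> \<le> \<rho>" for g s
  proof -
    define t where "t = max 0 s"
    have t: "t \<ge> 0" by (simp add: t_def)
    have "\<bar>T g s\<bar> = exp (\<mu> * t) * \<bar>f t (X g t) (P g t) - f t 0 0\<bar>"
      using zero[OF t] by (simp add: T_def t_def abs_mult)
    also have "\<dots> \<le> exp (\<mu> * t) * (L * (\<bar>X g t - 0\<bar> + \<bar>P g t - 0\<bar>))"
      using \<open>\<epsilon> > 0\<close> by (intro mult_left_mono lip small g t) auto
    also have "\<dots> = exp (\<mu> * t) * (exp (- \<mu> * t) * (L * (\<bar>\<xi> g t\<bar> + \<bar>a * \<xi> g t - \<eta> g t\<bar>)))"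
      unfolding X_def P_def abs_mult diff_zero abs_exp_cancel by (simp only: distrib_left mult.left_commute)
    also have "\<dots> = L * (\<bar>\<xi> g t\<bar> + \<bar>a * \<xi> g t - \<eta> g t\<bar>)"
      by (rule exp_cancel)
    also have "\<dots> \<le> L * \<epsilon>"
      using L by (intro mult_left_mono sum_bound g t)
    also have "\<dots> \<le> \<rho>"
    proof -
      have "2 * K0 * L * \<epsilon> \<le> 1 * \<epsilon>" using L \<open>\<epsilon> > 0\<close> by (intro mult_right_mono) (auto simp: K0_def)
      then show ?thesis using pos by (simp add: \<rho>_def field_simps)
    qed
    finally show ?thesis .
  qed
  have T_cont: "continuous_on UNIV (T g)" if g: "continuous_on UNIV g" "\<And>x. \<bar>g x\<bar> \<le> \<rho>" for g
  proof -
    have XP: "continuous_on {0..} (X g)" "continuous_on {0..} (P g)"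
      unfolding X_def P_def by (intro continuous_intros \<xi>_cont[OF g] \<eta>_cont[OF g])+
    have "continuous_on {0..} (\<lambda>s. case (s, X g s, P g s) of (s, x, p) \<Rightarrow> f s x p)"
      by (rule continuous_on_compose2[OF cont])
        (use XP small(3,4)[OF g] in \<open>auto intro!: continuous_intros simp: abs_le_iff\<close>, (force simp: abs_le_iff)+)
    then have "continuous_on {0..} (\<lambda>s. - exp (\<mu> * s) * f s (X g s) (P g s))"
      by (auto intro!: continuous_intros)
    then have "continuous_on UNIV (\<lambda>s. (\<lambda>s. - exp (\<mu> * s) * f s (X g s) (P g s)) (max 0 s))"
      by (rule continuous_on_compose2) (auto intro!: continuous_intros)
    then show ?thesis unfolding T_def by simp
  qed
  define B where "B = (cball 0 \<rho> :: (real \<Rightarrow>\<^sub>C real) set)"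
  have B: "continuous_on UNIV (apply_bcontfun g)" "\<bar>apply_bcontfun g x\<bar> \<le> \<rho>" if "g \<in> B" for g x
    using that norm_bounded[of g x] by (auto simp: B_def)
  define \<Phi> where "\<Phi> = (\<lambda>g. Bcontfun (T (apply_bcontfun g)))"
  have \<Phi>: "apply_bcontfun (\<Phi> g) = T (apply_bcontfun g)" if "g \<in> B" for g
    unfolding \<Phi>_def
    by (rule Bcontfun_inverse) (rule bcontfun_normI[of _ \<rho>], use T_cont T_bound B[OF that] in auto)
  have "\<exists>!g\<in>B. \<Phi> g = g"
  proof (rule Banach_fix)
    show "complete B" unfolding B_def by (simp add: complete_eq_closed)
    show "B \<noteq> {}" using \<rho> by (simp add: B_def)
    show "(0::real) \<le> 1 / 2" "(1 / 2 :: real) < 1" by auto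
    show "\<Phi> ` B \<subseteq> B"
    proof safe
      fix g assume g: "g \<in> B"
      have "norm (\<Phi> g) \<le> \<rho>"
        by (rule norm_bound) (use T_bound[OF B(1)[OF g] B(2)[OF g]] \<Phi>[OF g] in auto)
      then show "\<Phi> g \<in> B" by (simp add: B_def)
    qed
    fix g g' assume g: "g \<in> B" "g' \<in> B"
    show "dist (\<Phi> g) (\<Phi> g') \<le> 1 / 2 * dist g g'"
    proof (rule dist_bound)
      fix s
      have "\<bar>T g s - T g' s\<bar> \<le> dist g g' / 2"
      proof (rule T_diff)
        show "\<bar>g x - g' x\<bar> \<le> dist g g'" for x
          using dist_bounded[of g x g'] by (simp add: dist_real_def)
      qed (use g B in auto)
      then show "dist (\<Phi> g s) (\<Phi> g' s) \<le> 1 / 2 * dist g g'"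
        using \<Phi> g by (simp add: dist_real_def)
    qed
  qed
  then obtain g where g: "g \<in> B" and fp: "\<Phi> g = g" by blast
  note gB = B(1)[OF g] B(2)[OF g]
  have fp': "g s = - exp (\<mu> * s) * f s (X g s) (P g s)" if "s \<ge> 0" for s
    using fun_cong[OF \<Phi>[OF g], of s] fp that by (simp add: T_def)
  have d\<xi>: "(\<xi> g has_real_derivative - a' * \<xi> g s + \<eta> g s) (at s)" if "s > 0" for s
    unfolding \<xi>_def by (rule stable_part_deriv) (use that pos \<eta>_cont[OF gB] \<eta>_bound[OF gB] in auto)
  have dX: "(X g has_real_derivative - P g s) (at s)" if "s > 0" for s
    unfolding X_def P_def
    apply (rule derivative_eq_intros d\<xi>[OF that] refl)+
    by (simp add: a'_def algebra_simps)
  have dP: "(P g has_real_derivative (b - a) * P g s - a * b * X g s + f s (X g s) (P g s)) (at s)"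
    if "s > 0" for s
  proof -
    have "exp (- \<mu> * s) * g s = - f s (X g s) (P g s)"
      using fp'[of s] that by (simp add: exp_minus)
    then show ?thesis
      unfolding P_def
      apply -
      apply (rule derivative_eq_intros d\<xi>[OF that] \<eta>_deriv[OF gB] refl)+
      by (simp add: a'_def b'_def X_def P_def algebra_simps)
  qed
  show ?thesis
  proof (rule that)
    show "X g 1 = x0"
      by (simp add: X_def \<xi>_def stable_part_def exp_minus)
  qed (use dX dP small(1,2)[OF gB] in auto)
qed

section \<open>Paths with square integrable derivative\<close>

text \<open>Half-lines form an intersection-stable generator of the Borel sets, so a Dynkin argument
  carries the equality of the integrals to all Borel sets, and these determine a density almost
  everywhere.\<close>

lemma interval_integrals_determine_AE:
  fixes f g :: "real \<Rightarrow> 'b::{second_countable_topology, banach}"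
  assumes f: "integrable lborel f" and g: "integrable lborel g"
    and eq: "\<And>t. set_lebesgue_integral lborel {..t} f = set_lebesgue_integral lborel {..t} g"
  shows "AE x in lborel. f x = g x"
proof (rule sigma_finite_measure.density_unique_banach[OF sigma_finite_lborel f g])
  define D where "D = (\<lambda>x. f x - g x)"
  have D: "integrable lborel D" using f g by (simp add: D_def)
  have set_D: "set_integrable lborel S D" if "S \<in> sets borel" for S
    unfolding set_integrable_def by (rule integrable_mult_indicator) (use that D in auto)
  have diff: "set_lebesgue_integral lborel S D =
      set_lebesgue_integral lborel S f - set_lebesgue_integral lborel S g" if "S \<in> sets borel" for S
  proof -
    have "set_integrable lborel S f" "set_integrable lborel S g"
      unfolding set_integrable_def by (auto intro!: integrable_mult_indicator f g simp: that)
    then show ?thesis by (simp add: D_def set_integral_diff)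
  qed
  \<comment> \<open>The complement step of the induction needs the integral over the whole line,
    which is a limit of half-line integrals.\<close>
  have total: "(LINT x:UNIV|lborel. D x) = 0"
  proof -
    have "(\<lambda>n::nat. LINT x:{..real n}|lborel. D x) \<longlonglongrightarrow> (LINT x:(\<Union>n::nat. {..real n})|lborel. D x)"
      by (rule set_integral_cont_up) (auto simp: incseq_def intro!: set_D)
    moreover have "(\<Union>n::nat. {..real n}) = UNIV" using real_arch_simple by fastforce
    ultimately show ?thesis using eq by (simp add: diff LIMSEQ_const_iff)
  qed
  have zero: "S \<in> sets borel \<and> (LINT x:S|lborel. D x) = 0"
    if S: "S \<in> sigma_sets UNIV (range (\<lambda>a::real. {..a}))" for S
  proof -
    have "Int_stable (range (\<lambda>a::real. {..a}))" "range (\<lambda>a::real. {..a}) \<subseteq> Pow UNIV"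
      by (auto simp: Int_stable_def)
    from this S show ?thesis
    proof (induction rule: sigma_sets_induct_disjoint)
      case (basic A)
      then show ?case using eq diff by auto
    next
      case (compl A)
      have "(LINT x:(A \<union> (UNIV - A))|lborel. D x) = (LINT x:A|lborel. D x) + (LINT x:(UNIV - A)|lborel. D x)"
        by (rule set_integral_Un) (use compl in \<open>auto intro!: set_D\<close>)
      then show ?case using compl total by (simp add: borel_comp flip: Compl_eq_Diff_UNIV)
    next
      case (union A)
      have "(LINT x:(\<Union>i. A i)|lborel. D x) = (\<Sum>i. (LINT x:(A i)|lborel. D x))"
        by (rule lebesgue_integral_countable_add)
          (use union in \<open>auto intro!: set_D simp: disjoint_family_on_def\<close>)
      then show ?case using union by auto
    qed (auto simp: set_lebesgue_integral_def)
  qed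
  fix S :: "real set" assume "S \<in> sets lborel"
  then have "S \<in> sigma_sets UNIV (range (\<lambda>a::real. {..a}))"
    by (simp add: borel_eq_atMost)
  with zero diff show "set_lebesgue_integral lborel S f = set_lebesgue_integral lborel S g"
    by (metis eq_iff_diff_eq_0)
qed

lemma
  assumes "is_weak_deriv u v"
  shows weak_deriv_integrable: "set_integrable lborel {0..1} v"
    and weak_deriv_square_integrable: "set_integrable lborel {0..1} (\<lambda>s. (cmod (v s))\<^sup>2)"
    and weak_deriv_increment: "t \<in> {0..1} \<Longrightarrow> u t - u 0 = (LINT s:{0..t}|lborel. v s)"
  using assms unfolding is_weak_deriv_def by (blast, blast, metis add_diff_cancel_left')

lemma weak_deriv_unique:
  assumes v: "is_weak_deriv u v" and w: "is_weak_deriv u w"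
  shows "AE s in lborel. s \<in> {0..1} \<longrightarrow> v s = w s"
proof -
  have "AE s in lborel. indicat_real {0..1} s *\<^sub>R v s = indicat_real {0..1} s *\<^sub>R w s"
  proof (rule interval_integrals_determine_AE)
    show "integrable lborel (\<lambda>s. indicat_real {0..1} s *\<^sub>R v s)"
      "integrable lborel (\<lambda>s. indicat_real {0..1} s *\<^sub>R w s)"
      using weak_deriv_integrable[OF v] weak_deriv_integrable[OF w] by (auto simp: set_integrable_def)
    fix t :: real
    \<comment> \<open>Cutting the derivatives off outside \<open>{0..1}\<close> makes every
      half-line integral an increment of \<open>u\<close> from 0, also for \<open>t\<close> outside
      the unit interval.\<close>
    have cut: "(LINT s:{..t}|lborel. indicat_real {0..1} s *\<^sub>R f s) = (LINT s:{0..min t 1}|lborel. f s)"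
      for f :: "real \<Rightarrow> complex"
      unfolding set_lebesgue_integral_def
      by (rule Bochner_Integration.integral_cong) (auto simp: indicator_def)
    have "(LINT s:{0..min t 1}|lborel. v s) = (LINT s:{0..min t 1}|lborel. w s)"
    proof (cases "t < 0")
      case False
      then have "min t 1 \<in> {0..1}" by auto
      then show ?thesis using weak_deriv_increment[OF v] weak_deriv_increment[OF w] by metis
    qed (auto simp: set_lebesgue_integral_def)
    then show "(LINT s:{..t}|lborel. indicat_real {0..1} s *\<^sub>R v s) =
        (LINT s:{..t}|lborel. indicat_real {0..1} s *\<^sub>R w s)"
      by (simp add: cut)
  qed
  then show ?thesis
    by (rule AE_mp) (auto simp: indicator_def)
qed

text \<open>Frees all later computations from the arbitrary choice made in
  \<open>weak_deriv\<close>.\<close>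

lemma kinetic_eq:
  assumes v: "is_weak_deriv u v"
  shows "kinetic u = 1/2 * (LINT s:{0..1}|lborel. (cmod (v s))\<^sup>2)"
proof -
  have w: "is_weak_deriv u (weak_deriv u)"
    unfolding weak_deriv_def by (rule someI[of _ v]) (rule v)
  have "(LINT s:{0..1}|lborel. (cmod (weak_deriv u s))\<^sup>2) = (LINT s:{0..1}|lborel. (cmod (v s))\<^sup>2)"
    unfolding set_lebesgue_integral_def
  proof (rule integral_cong_AE)
    show "(\<lambda>s. indicat_real {0..1} s *\<^sub>R (cmod (weak_deriv u s))\<^sup>2) \<in> borel_measurable lborel"
      "(\<lambda>s. indicat_real {0..1} s *\<^sub>R (cmod (v s))\<^sup>2) \<in> borel_measurable lborel"
      using weak_deriv_square_integrable[OF v] weak_deriv_square_integrable[OF w] borel_measurable_integrable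
      unfolding set_integrable_def by blast+
    show "AE s in lborel. indicat_real {0..1} s *\<^sub>R (cmod (weak_deriv u s))\<^sup>2 =
        indicat_real {0..1} s *\<^sub>R (cmod (v s))\<^sup>2"
      using weak_deriv_unique[OF v w] by (rule AE_mp) (auto simp: indicator_def)
  qed
  then show ?thesis by (simp add: kinetic_def)
qed

section \<open>The chain rule along absolutely continuous paths\<close>

context
  fixes u v :: "real \<Rightarrow> complex"
  assumes uv: "is_weak_deriv u v"
begin

lemma weak_deriv_set_integrable:
  assumes "0 \<le> a" "b \<le> 1"
  shows "set_integrable lborel {a..b} v"
    and "set_integrable lborel {a..b} (\<lambda>s. cmod (v s))"
    and "set_integrable lborel {a..b} (\<lambda>s. (cmod (v s))\<^sup>2)"
proof -
  note * = weak_deriv_integrable[OF uv] weak_deriv_square_integrable[OF uv]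
  show "set_integrable lborel {a..b} v"
    by (rule set_integrable_subset[OF *(1)]) (use assms in auto)
  then show "set_integrable lborel {a..b} (\<lambda>s. cmod (v s))"
    by (rule set_integrable_norm)
  show "set_integrable lborel {a..b} (\<lambda>s. (cmod (v s))\<^sup>2)"
    by (rule set_integrable_subset[OF *(2)]) (use assms in auto)
qed

lemmas weak_deriv_integrable_on =
  set_borel_integral_eq_integral(1)[OF weak_deriv_set_integrable(1)]
  set_borel_integral_eq_integral(1)[OF weak_deriv_set_integrable(2)]

lemma path_increment:
  assumes "0 \<le> a" "a \<le> b" "b \<le> 1"
  shows "u b - u a = integral {a..b} v"
proof -
  have *: "u t - u 0 = integral {0..t} v" if "t \<in> {0..1}" for t
    using weak_deriv_increment[OF uv that] that
      set_borel_integral_eq_integral(2)[OF weak_deriv_set_integrable(1), of 0 t] by simp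
  have "integral {0..b} v = integral {0..a} v + integral {a..b} v"
    using assms Henstock_Kurzweil_Integration.integral_combine[of 0 a b v] weak_deriv_integrable_on(1)[of 0 b]
    by simp
  moreover have "u b - u a = (u b - u 0) - (u a - u 0)" by simp
  ultimately show ?thesis using *[of a] *[of b] assms by simp
qed

lemma path_continuous: "continuous_on {0..1} u"
proof -
  have "continuous_on {0..1} (\<lambda>t. u 0 + integral {0..t} v)"
    by (intro continuous_intros indefinite_integral_continuous_1 weak_deriv_integrable_on) auto
  then show ?thesis
  proof (rule continuous_on_eq)
    show "u 0 + integral {0..t} v = u t" if "t \<in> {0..1}" for t
      using path_increment[of 0 t] that by (metis add.commute atLeastAtMost_iff diff_add_cancel order_refl)
  qed
qed

lemma path_product_integrable:
  assumes "0 \<le> a" "b \<le> 1" and B: "continuous_on {a..b} B"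
  shows "set_integrable lborel {a..b} (\<lambda>s. Re (B s * v s))"
proof -
  have "bounded (B ` {a..b})"
    by (intro compact_imp_bounded compact_continuous_image B) auto
  then obtain M where M: "\<And>s. s \<in> {a..b} \<Longrightarrow> cmod (B s) \<le> M"
    unfolding bounded_iff by blast
  have "set_integrable lborel {a..b} (\<lambda>s. B s * v s)"
    unfolding set_integrable_def
  proof (rule Bochner_Integration.integrable_bound)
    show "integrable lborel (\<lambda>s. M *\<^sub>R (indicat_real {a..b} s *\<^sub>R v s))"
      using weak_deriv_set_integrable(1)[OF assms(1,2)]
      by (intro integrable_scaleR_right) (simp add: set_integrable_def)
    have "(\<lambda>s. indicat_real {a..b} s *\<^sub>R B s) \<in> borel_measurable borel"
      by (rule borel_measurable_continuous_on_indicator[OF _ B]) simp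
    moreover have "(\<lambda>s. indicat_real {a..b} s *\<^sub>R v s) \<in> borel_measurable borel"
      using weak_deriv_set_integrable(1)[OF assms(1,2)] borel_measurable_integrable
      by (fastforce simp: set_integrable_def)
    ultimately have "(\<lambda>s. (indicat_real {a..b} s *\<^sub>R B s) * (indicat_real {a..b} s *\<^sub>R v s)) \<in> borel_measurable borel"
      by measurable
    also have "(\<lambda>s. (indicat_real {a..b} s *\<^sub>R B s) * (indicat_real {a..b} s *\<^sub>R v s)) =
        (\<lambda>s. indicat_real {a..b} s *\<^sub>R (B s * v s))"
      by (auto simp: indicator_def)
    finally show "(\<lambda>s. indicat_real {a..b} s *\<^sub>R (B s * v s)) \<in> borel_measurable lborel" by simp
    show "AE s in lborel. norm (indicat_real {a..b} s *\<^sub>R (B s * v s)) \<le>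
        norm (M *\<^sub>R (indicat_real {a..b} s *\<^sub>R v s))"
      using M by (auto simp: indicator_def norm_mult intro!: AE_I2 mult_right_mono order_trans[OF M abs_ge_self])
  qed
  then have "integrable lborel (\<lambda>s. Re (indicat_real {a..b} s *\<^sub>R (B s * v s)))"
    unfolding set_integrable_def by (rule integrable_Re)
  then show ?thesis by (simp add: set_integrable_def)
qed

text \<open>The path need not be differentiable at any given point, so no pointwise derivative is
  used. Instead the error on an interval is compared with \<open>\<epsilon>\<close> times the
  integral of \<open>cmod (v s)\<close>. This estimate is additive over adjacent intervals and holds
  on all short ones by linearizing \<open>f\<close>; bisection makes it global, and
  \<open>\<epsilon>\<close> is arbitrary.\<close>

theorem path_chain_rule:
  fixes f :: "complex \<Rightarrow> real" and A :: "complex \<Rightarrow> complex"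
  assumes ab: "0 \<le> a" "a \<le> b" "b \<le> 1" and D: "open D" "u ` {a..b} \<subseteq> D"
    and f: "\<And>x. x \<in> D \<Longrightarrow> (f has_derivative (\<lambda>y. Re (A x * y))) (at x)"
    and A: "continuous_on D A"
  shows "f (u b) - f (u a) = (LINT s:{a..b}|lborel. Re (A (u s) * v s))"
proof -
  let ?q = "\<lambda>s. Re (A (u s) * v s)"
  have uc: "continuous_on {s..t} u" if "a \<le> s" "t \<le> b" for s t
    by (rule continuous_on_subset[OF path_continuous]) (use ab that in auto)
  have Au: "continuous_on {s..t} (\<lambda>s. A (u s))" if "a \<le> s" "t \<le> b" for s t
    by (rule continuous_on_compose2[OF A uc[OF that]]) (use D that in auto)
  have q: "set_integrable lborel {s..t} ?q" if "a \<le> s" "t \<le> b" for s t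
    by (rule path_product_integrable) (use that ab Au in auto)
  have qi: "?q integrable_on {s..t}" "(LINT s:{s..t}|lborel. ?q s) = integral {s..t} ?q"
    if "a \<le> s" "t \<le> b" for s t
    using set_borel_integral_eq_integral[OF q[OF that]] by auto
  have est: "\<bar>f (u b) - f (u a) - integral {a..b} ?q\<bar> \<le> \<epsilon> * integral {a..b} (\<lambda>s. cmod (v s))" if "\<epsilon> > 0" for \<epsilon>
  proof -
    define Q where "Q p r \<longleftrightarrow> a \<le> p \<longrightarrow> r \<le> b \<longrightarrow>
      \<bar>f (u r) - f (u p) - integral {p..r} ?q\<bar> \<le> \<epsilon> * integral {p..r} (\<lambda>s. cmod (v s))" for p r
    have "Q a b"
      using \<open>a \<le> b\<close>
    proof (induction rule: Bolzano)
      case (trans p q r)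
      show ?case
        unfolding Q_def
      proof (intro impI)
        assume pr: "a \<le> p" "r \<le> b"
        have "integral {p..r} ?q = integral {p..q} ?q + integral {q..r} ?q"
          using Henstock_Kurzweil_Integration.integral_combine[of p q r ?q] qi(1)[of p r] trans pr by simp
        moreover have "integral {p..r} (\<lambda>s. cmod (v s)) = integral {p..q} (\<lambda>s. cmod (v s)) + integral {q..r} (\<lambda>s. cmod (v s))"
          using Henstock_Kurzweil_Integration.integral_combine[of p q r "\<lambda>s. cmod (v s)"]
            weak_deriv_integrable_on(2)[of p r] trans pr ab by simp
        moreover have "\<bar>f (u q) - f (u p) - integral {p..q} ?q\<bar> \<le> \<epsilon> * integral {p..q} (\<lambda>s. cmod (v s))"
          "\<bar>f (u r) - f (u q) - integral {q..r} ?q\<bar> \<le> \<epsilon> * integral {q..r} (\<lambda>s. cmod (v s))"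
          using trans pr by (auto simp: Q_def)
        ultimately show "\<bar>f (u r) - f (u p) - integral {p..r} ?q\<bar> \<le> \<epsilon> * integral {p..r} (\<lambda>s. cmod (v s))"
          by (simp add: distrib_left)
      qed
    next
      case (local t)
      let ?x = "u t"
      have xD: "?x \<in> D" using local D by auto
      have "isCont A ?x" using A \<open>open D\<close> xD continuous_on_eq_continuous_at by blast
      then obtain \<eta>1 where \<eta>1: "\<eta>1 > 0" "\<And>y. cmod (y - ?x) < \<eta>1 \<Longrightarrow> cmod (A y - A ?x) \<le> \<epsilon> / 2"
        unfolding isCont_def LIM_def using \<open>\<epsilon> > 0\<close>
        by (metis (no_types, opaque_lifting) dist_norm half_gt_zero less_eq_real_def norm_zero right_minus_eq)
      obtain \<eta>2 where \<eta>2: "\<eta>2 > 0" "ball ?x \<eta>2 \<subseteq> D"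
        using \<open>open D\<close> xD openE by blast
      define \<eta> where "\<eta> = min \<eta>1 \<eta>2"
      have \<eta>: "\<eta> > 0" using \<eta>1 \<eta>2 by (simp add: \<eta>_def)
      \<comment> \<open>Near \<open>u t\<close> the gradient of \<open>f\<close> minus its
        linearization is at most \<open>\<epsilon> / 2\<close>. This controls the increment of
        \<open>f\<close>; the other \<open>\<epsilon> / 2\<close> is spent on freezing
        \<open>A\<close> at \<open>u t\<close> inside the integral.\<close>
      have lin: "\<bar>f y' - f y - Re (A ?x * (y' - y))\<bar> \<le> \<epsilon> / 2 * cmod (y' - y)"
        if "y \<in> ball ?x \<eta>" "y' \<in> ball ?x \<eta>" for y y'
      proof -
        have "norm ((\<lambda>z. f z - Re (A ?x * z)) y' - (\<lambda>z. f z - Re (A ?x * z)) y) \<le> \<epsilon> / 2 * norm (y' - y)"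
        proof (rule differentiable_bound[of "ball ?x \<eta>"])
          fix z assume z: "z \<in> ball ?x \<eta>"
          then have "z \<in> D" using \<eta>2 by (auto simp: \<eta>_def)
          have "((\<lambda>z. f z - Re (A ?x * z)) has_derivative (\<lambda>y. Re (A z * y) - Re (A ?x * y))) (at z)"
            by (intro has_derivative_diff f \<open>z \<in> D\<close> has_derivative_Re) (auto intro!: derivative_eq_intros)
          then show "((\<lambda>z. f z - Re (A ?x * z)) has_derivative (\<lambda>y. Re (A z * y) - Re (A ?x * y))) (at z within ball ?x \<eta>)"
            by (rule has_derivative_at_withinI)
          show "onorm (\<lambda>y. Re (A z * y) - Re (A ?x * y)) \<le> \<epsilon> / 2"
          proof (rule onorm_le)
            fix y
            have "norm (Re (A z * y) - Re (A ?x * y)) = \<bar>Re ((A z - A ?x) * y)\<bar>"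
              by (simp add: left_diff_distrib)
            also have "\<dots> \<le> cmod (A z - A ?x) * cmod y"
              by (metis abs_Re_le_cmod norm_mult)
            also have "\<dots> \<le> \<epsilon> / 2 * norm y"
              using z by (intro mult_right_mono \<eta>1(2)) (auto simp: \<eta>_def dist_norm norm_minus_commute)
            finally show "norm (Re (A z * y) - Re (A ?x * y)) \<le> \<epsilon> / 2 * norm y" .
          qed
        qed (use that in auto)
        then show ?thesis by (simp add: algebra_simps)
      qed
      have "continuous (at t within {a..b}) u"
        using uc[of a b] local by (auto simp: continuous_on_eq_continuous_within)
      then obtain d where d: "d > 0" "\<And>s. s \<in> {a..b} \<Longrightarrow> dist s t < d \<Longrightarrow> dist (u s) ?x < \<eta>"
        unfolding continuous_within_eps_delta using \<eta> by blast
      show ?case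
        unfolding Q_def
      proof (intro exI[of _ d] conjI allI impI, rule d(1))
        fix p r assume pr: "p \<le> t \<and> t \<le> r \<and> r - p < d" and in_ab: "a \<le> p" "r \<le> b"
        have near: "u s \<in> ball ?x \<eta>" if "s \<in> {p..r}" for s
          using d(2)[of s] that pr in_ab by (auto simp: dist_commute dist_real_def)
        have I: "u r - u p = integral {p..r} v" "v integrable_on {p..r}" "(\<lambda>s. cmod (v s)) integrable_on {p..r}"
          using path_increment[of p r] weak_deriv_integrable_on pr in_ab ab by auto
        have vle: "cmod (u r - u p) \<le> integral {p..r} (\<lambda>s. cmod (v s))"
          unfolding I(1) by (rule integral_norm_bound_integral) (use I in auto)
        have xi: "(\<lambda>s. Re (A ?x * v s)) integrable_on {p..r}"
          "integral {p..r} (\<lambda>s. Re (A ?x * v s)) = Re (A ?x * (u r - u p))"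
        proof -
          have "((\<lambda>s. Re (A ?x * v s)) has_integral Re (A ?x * integral {p..r} v)) {p..r}"
            by (intro has_integral_Re has_integral_mult_right integrable_integral I)
          then show "(\<lambda>s. Re (A ?x * v s)) integrable_on {p..r}"
            "integral {p..r} (\<lambda>s. Re (A ?x * v s)) = Re (A ?x * (u r - u p))"
            by (auto simp: I intro: integral_unique)
        qed
        have "norm (integral {p..r} (\<lambda>s. ?q s - Re (A ?x * v s))) \<le> integral {p..r} (\<lambda>s. \<epsilon> / 2 * cmod (v s))"
        proof (rule integral_norm_bound_integral)
          show "(\<lambda>s. ?q s - Re (A ?x * v s)) integrable_on {p..r}"
            using qi(1)[of p r] xi in_ab pr by (intro integrable_diff) auto
          show "(\<lambda>s. \<epsilon> / 2 * cmod (v s)) integrable_on {p..r}"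
            using I(3) by (intro integrable_on_mult_right)
          fix s assume s: "s \<in> {p..r}"
          have "norm (?q s - Re (A ?x * v s)) = \<bar>Re ((A (u s) - A ?x) * v s)\<bar>"
            by (simp add: left_diff_distrib)
          also have "\<dots> \<le> cmod (A (u s) - A ?x) * cmod (v s)"
            by (metis abs_Re_le_cmod norm_mult)
          also have "\<dots> \<le> \<epsilon> / 2 * cmod (v s)"
            using near[OF s] by (intro mult_right_mono \<eta>1(2)) (auto simp: \<eta>_def dist_norm norm_minus_commute)
          finally show "norm (?q s - Re (A ?x * v s)) \<le> \<epsilon> / 2 * cmod (v s)" .
        qed
        then have "\<bar>integral {p..r} ?q - Re (A ?x * (u r - u p))\<bar> \<le> \<epsilon> / 2 * integral {p..r} (\<lambda>s. cmod (v s))"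
          using qi(1)[of p r] xi in_ab pr by (simp add: integral_diff)
        moreover have "\<bar>f (u r) - f (u p) - Re (A ?x * (u r - u p))\<bar> \<le> \<epsilon> / 2 * integral {p..r} (\<lambda>s. cmod (v s))"
          using lin[of "u p" "u r"] near[of p] near[of r] pr vle \<open>\<epsilon> > 0\<close>
          by (smt (verit) atLeastAtMost_iff half_gt_zero mult_left_mono)
        ultimately show "\<bar>f (u r) - f (u p) - integral {p..r} ?q\<bar> \<le> \<epsilon> * integral {p..r} (\<lambda>s. cmod (v s))"
          by linarith
      qed
    qed
    then show ?thesis by (simp add: Q_def)
  qed
  have "f (u b) - f (u a) - integral {a..b} ?q = 0"
  proof (rule ccontr)
    define Iv where "Iv = integral {a..b} (\<lambda>s. cmod (v s))"
    define E where "E = \<bar>f (u b) - f (u a) - integral {a..b} ?q\<bar>"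
    assume "f (u b) - f (u a) - integral {a..b} ?q \<noteq> 0"
    then have E: "E > 0" by (simp add: E_def)
    have "Iv \<ge> 0" unfolding Iv_def by (rule integral_nonneg) (use weak_deriv_integrable_on ab in auto)
    \<comment> \<open>The denominator \<open>Iv + 1\<close> keeps the choice of
      \<open>\<epsilon>\<close> meaningful when \<open>Iv\<close> is 0.\<close>
    then have "E \<le> E / (2 * (Iv + 1)) * Iv" using est[of "E / (2 * (Iv + 1))"] E by (simp add: E_def Iv_def)
    also have "\<dots> < E" using E \<open>Iv \<ge> 0\<close> by (simp add: field_simps add_strict_increasing)
    finally show False by simp
  qed
  then show ?thesis using qi(2)[of a b] by simp
qed

end

text \<open>If the two continuous functions differed at \<open>s\<close>, they would differ on an
  interval to the right of \<open>s\<close>, which has positive measure. The right side is available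
  at the left end point \<open>a\<close> too. The lemma upgrades the almost everywhere identities
  coming from vanishing integrals.\<close>

lemma AE_zero_imp_zero:
  fixes g :: "real \<Rightarrow> 'b::t2_space"
  assumes cont: "continuous_on {a..<b} g" "continuous_on {a..<b} k"
    and AE: "AE s in lborel. s \<in> {a..<b} \<longrightarrow> g s = k s" and s: "s \<in> {a..<b}"
  shows "g s = k s"
proof (rule ccontr)
  assume "g s \<noteq> k s"
  then obtain A B where AB: "open A" "open B" "g s \<in> A" "k s \<in> B" "A \<inter> B = {}"
    using hausdorff[OF \<open>g s \<noteq> k s\<close>] by metis
  have "(g \<longlongrightarrow> g s) (at s within {a..<b})" "(k \<longlongrightarrow> k s) (at s within {a..<b})"
    using cont s unfolding continuous_on by auto
  then have "\<forall>\<^sub>F t in at s within {a..<b}. g t \<in> A" "\<forall>\<^sub>F t in at s within {a..<b}. k t \<in> B"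
    using topological_tendstoD AB(1-4) by metis+
  then have "\<forall>\<^sub>F t in at s within {a..<b}. g t \<noteq> k t"
    by eventually_elim (use AB in auto)
  then obtain d where d: "d > 0" "\<And>t. t \<in> {a..<b} \<Longrightarrow> t \<noteq> s \<Longrightarrow> dist t s < d \<Longrightarrow> g t \<noteq> k t"
    unfolding eventually_at by blast
  define t where "t = (s + min b (s + d)) / 2"
  have t: "s < t" "t < b" "t < s + d"
    using s d by (auto simp: t_def)
  obtain N where N: "N \<in> null_sets lborel" "{x \<in> space lborel. \<not> (x \<in> {a..<b} \<longrightarrow> g x = k x)} \<subseteq> N"
    using AE by (auto simp: eventually_ae_filter)
  have "{s..t} \<subseteq> N"
  proof
    fix x assume x: "x \<in> {s..t}"
    then have "g x \<noteq> k x" using d(2)[of x] \<open>g s \<noteq> k s\<close> s t by (cases "x = s") (auto simp: dist_real_def)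
    moreover have "x \<in> {a..<b}" using x s t by auto
    ultimately show "x \<in> N" using N(2) by auto
  qed
  then have "emeasure lborel {s..t} \<le> emeasure lborel N"
    using N(1) by (intro emeasure_mono) auto
  then show False using N(1) t by (auto simp: null_sets_def)
qed

text \<open>Links the extended integral of the functional, with value infinity at collisions, to an
  ordinary integral: a finite value excludes collisions outside a null set, and off a null set the
  two integrands agree.\<close>

lemma finite_potential_integral:
  fixes V :: "complex \<Rightarrow> real" and u :: "real \<Rightarrow> complex"
  assumes u: "continuous_on {0..1} u" and V: "V \<in> borel_measurable borel" "\<And>x. V x \<ge> 0"
  defines "I \<equiv> \<integral>\<^sup>+s\<in>{0..1}. (if u s = 0 then \<infinity> else ennreal (V (u s))) \<partial>lborel"
  shows "I \<noteq> \<infinity> \<Longrightarrow> AE s in lborel. s \<in> {0..1} \<longrightarrow> u s \<noteq> 0"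
    and "I \<noteq> \<infinity> \<Longrightarrow> set_integrable lborel {0..1} (\<lambda>s. V (u s))"
    and "AE s in lborel. s \<in> {0..1} \<longrightarrow> u s \<noteq> 0 \<Longrightarrow> set_integrable lborel {0..1} (\<lambda>s. V (u s)) \<Longrightarrow>
      I = ennreal (LINT s:{0..1}|lborel. V (u s))"
proof -
  \<comment> \<open>Outside \<open>{0..1}\<close> the path is arbitrary and possibly not measurable,
    hence the cut-off.\<close>
  define g where "g = (\<lambda>s. indicat_real {0..1} s *\<^sub>R u s)"
  have g: "g \<in> borel_measurable borel"
    unfolding g_def by (rule borel_measurable_continuous_on_indicator[OF _ u]) simp
  have [measurable]: "(\<lambda>s. V (g s)) \<in> borel_measurable borel"
    by (rule measurable_compose[OF g V(1)])
  note [measurable] = g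
  have I: "I = (\<integral>\<^sup>+s. (if g s = 0 then \<infinity> else ennreal (V (g s))) * indicator {0..1} s \<partial>lborel)"
    unfolding I_def by (rule nn_integral_cong) (auto simp: g_def indicator_def)
  have eq: "indicat_real {0..1} s *\<^sub>R V (u s) = indicat_real {0..1} s *\<^sub>R V (g s)" for s
    by (auto simp: g_def indicator_def)
  have I2: "I = (\<integral>\<^sup>+s. ennreal (indicat_real {0..1} s *\<^sub>R V (u s)) \<partial>lborel)"
    if "AE s in lborel. s \<in> {0..1} \<longrightarrow> u s \<noteq> 0"
    unfolding I_def
    by (rule nn_integral_cong_AE, use that in eventually_elim) (auto simp: indicator_def)
  show AE: "AE s in lborel. s \<in> {0..1} \<longrightarrow> u s \<noteq> 0" if "I \<noteq> \<infinity>"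
  proof -
    have "AE s in lborel. (if g s = 0 then \<infinity> else ennreal (V (g s))) * indicator {0..1} s \<noteq> \<infinity>"
      by (rule nn_integral_noteq_infinite) (use that I in \<open>auto simp: V(1)\<close>)
    then show ?thesis
      by eventually_elim (auto simp: g_def indicator_def split: if_splits)
  qed
  show "set_integrable lborel {0..1} (\<lambda>s. V (u s))" if "I \<noteq> \<infinity>"
    unfolding set_integrable_def
  proof (rule integrableI_nonneg)
    show "(\<lambda>s. indicat_real {0..1} s *\<^sub>R V (u s)) \<in> borel_measurable lborel"
      unfolding eq by measurable
    show "(\<integral>\<^sup>+s. ennreal (indicat_real {0..1} s *\<^sub>R V (u s)) \<partial>lborel) < \<infinity>"
      using I2[OF AE[OF that]] that by (simp add: top.not_eq_extremum)
  qed (use V(2) in auto)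
  show "I = ennreal (LINT s:{0..1}|lborel. V (u s))"
    if "AE s in lborel. s \<in> {0..1} \<longrightarrow> u s \<noteq> 0" "set_integrable lborel {0..1} (\<lambda>s. V (u s))"
    unfolding I2[OF that(1)] set_lebesgue_integral_def
    by (rule nn_integral_eq_integral) (use that V(2) in \<open>auto simp: set_integrable_def\<close>)
qed

text \<open>Completing the square: up to the factor \<open>2 * c\<close> the expression is the
  square of \<open>cmod (c * v + cnj A)\<close> plus the defect of the subsolution inequality.
  Equality therefore yields both the velocity and the Hamilton--Jacobi equation.\<close>

lemma calibration_square:
  fixes A v :: complex and c Q :: real
  assumes "c > 0" "(cmod A)\<^sup>2 \<le> 2 * Q"
  shows "0 \<le> c / 2 * (cmod v)\<^sup>2 + Q / c + Re (A * v)"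
    and "c / 2 * (cmod v)\<^sup>2 + Q / c + Re (A * v) = 0 \<Longrightarrow> v = - cnj A / c \<and> (cmod A)\<^sup>2 = 2 * Q"
proof -
  have sq: "c / 2 * (cmod v)\<^sup>2 + Q / c + Re (A * v) =
      ((cmod (c * v + cnj A))\<^sup>2 + (2 * Q - (cmod A)\<^sup>2)) / (2 * c)"
    using \<open>c > 0\<close> unfolding cmod_power2 by (simp add: field_simps power2_eq_square)
  show "0 \<le> c / 2 * (cmod v)\<^sup>2 + Q / c + Re (A * v)"
    unfolding sq using assms by (intro divide_nonneg_pos add_nonneg_nonneg) auto
  assume "c / 2 * (cmod v)\<^sup>2 + Q / c + Re (A * v) = 0"
  then have "(cmod (c * v + cnj A))\<^sup>2 + (2 * Q - (cmod A)\<^sup>2) = 0"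
    using sq \<open>c > 0\<close> by simp
  then have "(cmod (c * v + cnj A))\<^sup>2 = 0" and "(cmod A)\<^sup>2 = 2 * Q"
    using assms(2) zero_le_power2[of "cmod (c * v + cnj A)"] by linarith+
  then show "v = - cnj A / c \<and> (cmod A)\<^sup>2 = 2 * Q"
    using \<open>c > 0\<close> by (simp add: field_simps eq_neg_iff_add_eq_0)
qed

text \<open>
  A calibrated piece of a path: the gradient of \<open>f\<close> is the conjugate of \<open>A\<close>, and \<open>f\<close> is a
  subsolution of the Hamilton--Jacobi equation along the path.
\<close>

locale calibrated_path =
  fixes u v :: "real \<Rightarrow> complex" and a b c fb :: real and D :: "complex set"
    and f :: "complex \<Rightarrow> real" and A :: "complex \<Rightarrow> complex" and Q :: "real \<Rightarrow> real"
  assumes uv: "is_weak_deriv u v" and ab: "0 \<le> a" "a < b" "b \<le> 1" and c: "c > 0"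
    and D: "open D" "u ` {a..<b} \<subseteq> D"
    and f: "\<And>x. x \<in> D \<Longrightarrow> (f has_derivative (\<lambda>y. Re (A x * y))) (at x)"
    and A: "continuous_on D A"
    and end_value: "((\<lambda>s. f (u s)) \<longlongrightarrow> fb) (at_left b)"
    and subsolution: "\<And>s. s \<in> {a..<b} \<Longrightarrow> (cmod (A (u s)))\<^sup>2 \<le> 2 * Q s"
    and Q: "set_integrable lborel {a..b} Q"
begin

definition density :: "real \<Rightarrow> real" where
  "density s = c / 2 * (cmod (v s))\<^sup>2 + Q s / c"

text \<open>The gap between the density and the rate at which \<open>f\<close> decreases along the
  path. It is nonnegative, and its integral measures how far the path is from being
  calibrated.\<close>

definition excess :: "real \<Rightarrow> real" where
  "excess s = density s + Re (A (u s) * v s)"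

lemma density_integrable: "set_integrable lborel {a..b} density"
  unfolding density_def
  using weak_deriv_set_integrable(3)[OF uv, of a b] ab Q
  by (intro set_integral_add set_integrable_mult_right set_integrable_divide) auto

lemma excess_nonneg: "s \<in> {a..<b} \<Longrightarrow> 0 \<le> excess s"
  unfolding excess_def density_def by (rule calibration_square(1)[OF c subsolution])

lemma density_nonneg: "s \<in> {a..<b} \<Longrightarrow> 0 \<le> density s"
proof -
  assume "s \<in> {a..<b}"
  then have "0 \<le> 2 * Q s" using subsolution[of s] zero_le_power2 order_trans by blast
  then show ?thesis using c by (simp add: density_def)
qed

lemma path_cont: "continuous_on {a..<b} u"
  by (rule continuous_on_subset[OF path_continuous[OF uv]]) (use ab in auto)

lemma A_cont: "continuous_on {a..<b} (\<lambda>s. A (u s))"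
  by (rule continuous_on_compose2[OF A path_cont]) (use D in auto)

lemma excess_integral:
  assumes t: "t \<in> {a..<b}"
  shows "set_integrable lborel {a..t} excess"
    and "(LINT s:{a..t}|lborel. excess s) = (LINT s:{a..t}|lborel. density s) + f (u t) - f (u a)"
proof -
  have d: "set_integrable lborel {a..t} density"
    by (rule set_integrable_subset[OF density_integrable]) (use t in auto)
  have q: "set_integrable lborel {a..t} (\<lambda>s. Re (A (u s) * v s))"
    by (rule path_product_integrable[OF uv]) (use t ab in \<open>auto intro: continuous_on_subset[OF A_cont]\<close>)
  show "set_integrable lborel {a..t} excess"
    unfolding excess_def by (rule set_integral_add[OF d q])
  have "f (u t) - f (u a) = (LINT s:{a..t}|lborel. Re (A (u s) * v s))"
    by (rule path_chain_rule[OF uv _ _ _ D(1) _ f A]) (use t ab D in auto)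
  then show "(LINT s:{a..t}|lborel. excess s) = (LINT s:{a..t}|lborel. density s) + f (u t) - f (u a)"
    unfolding excess_def using set_integral_add(2)[OF d q] by simp
qed

lemma density_integral_mono:
  assumes t: "t \<in> {a..<b}"
  shows "(LINT s:{a..t}|lborel. density s) \<le> (LINT s:{a..b}|lborel. density s)"
  unfolding set_lebesgue_integral_def
proof (rule integral_mono_AE)
  show "integrable lborel (\<lambda>s. indicat_real {a..b} s *\<^sub>R density s)"
    using density_integrable by (simp add: set_integrable_def)
  show "integrable lborel (\<lambda>s. indicat_real {a..t} s *\<^sub>R density s)"
    using set_integrable_subset[OF density_integrable, of "{a..t}"] t by (auto simp: set_integrable_def)
  show "AE s in lborel. indicat_real {a..t} s *\<^sub>R density s \<le> indicat_real {a..b} s *\<^sub>R density s"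
    using AE_lborel_singleton[of b]
    by eventually_elim (use density_nonneg t in \<open>auto simp: indicator_def\<close>)
qed

text \<open>At time \<open>b\<close> the path may have left \<open>D\<close>, possibly to the
  origin, so \<open>f\<close> need not make sense there. The inequality is proved up to
  \<open>t < b\<close> and passes to the limit through \<open>end_value\<close>.\<close>

lemma calibration: "f (u a) - fb \<le> (LINT s:{a..b}|lborel. density s)"
proof (rule tendsto_upperbound)
  show "((\<lambda>t. f (u a) - f (u t)) \<longlongrightarrow> f (u a) - fb) (at_left b)"
    by (intro tendsto_intros end_value)
  have "f (u a) - f (u t) \<le> (LINT s:{a..b}|lborel. density s)" if t: "t \<in> {a..<b}" for t
  proof -
    have "0 \<le> (LINT s:{a..t}|lborel. excess s)"
      unfolding set_lebesgue_integral_def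
      by (rule integral_nonneg_AE) (use t excess_nonneg in \<open>auto simp: indicator_def\<close>)
    then show ?thesis using excess_integral(2)[OF t] density_integral_mono[OF t] by linarith
  qed
  then show "\<forall>\<^sub>F t in at_left b. f (u a) - f (u t) \<le> (LINT s:{a..b}|lborel. density s)"
    using eventually_at_left_real[OF ab(2)] by (auto elim!: eventually_mono)
qed simp

text \<open>Equality forces the nonnegative excess to vanish almost everywhere. Then
  \<open>v\<close> coincides almost everywhere with a continuous function of the path, so that
  \<open>u\<close> is continuously differentiable and follows the gradient flow of the
  calibration.\<close>

lemma calibration_equality:
  assumes eq: "(LINT s:{a..b}|lborel. density s) \<le> f (u a) - fb" and Q_cont: "continuous_on {a..<b} Q"
    and s: "s \<in> {a..<b}"
  shows "(cmod (A (u s)))\<^sup>2 = 2 * Q s"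
    and "(u has_vector_derivative - cnj (A (u s)) / c) (at s within {a..<b})"
proof -
  have zero: "(LINT s:{a..t}|lborel. excess s) = 0" if t: "t \<in> {a..<b}" for t
  proof (rule antisym)
    show "0 \<le> (LINT s:{a..t}|lborel. excess s)"
      unfolding set_lebesgue_integral_def
      by (rule integral_nonneg_AE) (use t excess_nonneg in \<open>auto simp: indicator_def\<close>)
    have "((\<lambda>r. f (u r) - fb) \<longlongrightarrow> fb - fb) (at_left b)"
      by (intro tendsto_intros end_value)
    then have "((\<lambda>r. f (u r) - fb) \<longlongrightarrow> 0) (at_left b)" by simp
    then show "(LINT s:{a..t}|lborel. excess s) \<le> 0"
    proof (rule tendsto_lowerbound)
      have "(LINT s:{a..t}|lborel. excess s) \<le> f (u r) - fb" if r: "r \<in> {t<..<b}" for r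
      proof -
        have r': "r \<in> {a..<b}" using r t by auto
        have "(LINT s:{a..t}|lborel. excess s) \<le> (LINT s:{a..r}|lborel. excess s)"
          unfolding set_lebesgue_integral_def
        proof (rule integral_mono_AE)
          show "integrable lborel (\<lambda>s. indicat_real {a..r} s *\<^sub>R excess s)"
            "integrable lborel (\<lambda>s. indicat_real {a..t} s *\<^sub>R excess s)"
            using excess_integral(1)[OF r'] excess_integral(1)[OF t] by (auto simp: set_integrable_def)
        qed (use excess_nonneg r r' in \<open>auto simp: indicator_def\<close>)
        also have "\<dots> \<le> f (u r) - fb"
          using excess_integral(2)[OF r'] density_integral_mono[OF r'] eq by linarith
        finally show ?thesis .
      qed
      then show "\<forall>\<^sub>F r in at_left b. (LINT s:{a..t}|lborel. excess s) \<le> f (u r) - fb"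
        using eventually_at_left_real[of t b] t by (auto elim!: eventually_mono)
    qed simp
  qed
  have AE_t: "AE s in lborel. s \<in> {a..t} \<longrightarrow> excess s = 0" if t: "t \<in> {a..<b}" for t
  proof -
    have "AE s in lborel. indicat_real {a..t} s *\<^sub>R excess s = 0"
      using zero[OF t] excess_integral(1)[OF t] excess_nonneg t
      unfolding set_integrable_def set_lebesgue_integral_def
      by (subst (asm) integral_nonneg_eq_0_iff_AE) (auto simp: indicator_def)
    then show ?thesis by eventually_elim (auto simp: indicator_def)
  qed
  \<comment> \<open>The half-open interval is exhausted by countably many compact ones, so that the
    exceptional null sets can be united.\<close>
  have "AE s in lborel. \<forall>n::nat. s \<in> {a..b - (b - a) / (n + 1)} \<longrightarrow> excess s = 0"
    unfolding AE_all_countable using ab by (intro allI AE_t) (auto simp: field_simps intro!: mult_right_mono)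
  then have AE0: "AE s in lborel. s \<in> {a..<b} \<longrightarrow> excess s = 0"
  proof eventually_elim
    case (elim s)
    show ?case
    proof
      assume s: "s \<in> {a..<b}"
      obtain n :: nat where "(b - a) / (b - s) \<le> n" using real_arch_simple by blast
      then have "b - a \<le> n * (b - s)" using s by (simp add: field_simps)
      also have "\<dots> \<le> (n + 1) * (b - s)" using s by (intro mult_right_mono) auto
      finally have "(b - a) / (n + 1) \<le> b - s" by (simp add: field_simps)
      then have "s \<le> b - (b - a) / (real n + 1)" by (simp add: add.commute)
      then show "excess s = 0" using elim s by auto
    qed
  qed
  have AE: "AE s in lborel. s \<in> {a..<b} \<longrightarrow> v s = - cnj (A (u s)) / c \<and> (cmod (A (u s)))\<^sup>2 = 2 * Q s"
    using AE0
  proof eventually_elim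
    case (elim s)
    then show ?case
      using calibration_square(2)[OF c subsolution, of s "v s"] by (auto simp: excess_def density_def)
  qed
  show "(cmod (A (u s)))\<^sup>2 = 2 * Q s"
    by (rule AE_zero_imp_zero[OF _ _ _ s, where g = "\<lambda>s. (cmod (A (u s)))\<^sup>2" and k = "\<lambda>s. 2 * Q s"])
      (use AE A_cont Q_cont in \<open>auto intro!: continuous_intros elim!: eventually_mono\<close>)
  define t where "t = (s + b) / 2"
  have t: "s < t" "t < b" using s by (auto simp: t_def)
  let ?w = "\<lambda>s. - cnj (A (u s)) / c"
  have w: "continuous_on {a..t} ?w"
    using c t by (intro continuous_intros continuous_on_subset[OF A_cont]) auto
  have incr: "u r = u a + integral {a..r} ?w" if r: "r \<in> {a..t}" for r
  proof -
    have "u r - u a = (LINT s:{a..r}|lborel. v s)"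
      using path_increment[OF uv, of a r] weak_deriv_set_integrable(1)[OF uv, of a r] r t ab
      by (simp add: set_borel_integral_eq_integral)
    also have "\<dots> = (LINT s:{a..r}|lborel. ?w s)"
      unfolding set_lebesgue_integral_def
    proof (rule integral_cong_AE)
      show "(\<lambda>s. indicat_real {a..r} s *\<^sub>R v s) \<in> borel_measurable lborel"
        using weak_deriv_set_integrable(1)[OF uv, of a r] r t ab
        unfolding set_integrable_def by (intro borel_measurable_integrable) auto
      have "(\<lambda>s. indicat_real {a..r} s *\<^sub>R ?w s) \<in> borel_measurable borel"
        by (rule borel_measurable_continuous_on_indicator[OF _ continuous_on_subset[OF w]]) (use r in auto)
      then show "(\<lambda>s. indicat_real {a..r} s *\<^sub>R ?w s) \<in> borel_measurable lborel" by simp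
      show "AE s in lborel. indicat_real {a..r} s *\<^sub>R v s = indicat_real {a..r} s *\<^sub>R ?w s"
        using AE by eventually_elim (use r t in \<open>auto simp: indicator_def\<close>)
    qed
    also have "\<dots> = integral {a..r} ?w"
      by (intro set_borel_integral_eq_integral borel_integrable_atLeastAtMost' continuous_on_subset[OF w])
        (use r in auto)
    finally show ?thesis by (simp add: algebra_simps)
  qed
  have "((\<lambda>r. integral {a..r} ?w) has_vector_derivative ?w s) (at s within {a..t})"
    by (rule integral_has_vector_derivative[OF w]) (use s t in auto)
  then have "((\<lambda>r. u a + integral {a..r} ?w) has_vector_derivative ?w s) (at s within {a..t})"
    by (rule has_vector_derivative_add[OF has_vector_derivative_const, unfolded add_0])
  then have "(u has_vector_derivative ?w s) (at s within {a..t})"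
    by (rule has_vector_derivative_transform[OF _ incr, rotated 2]) (use s t in auto)
  moreover have "at s within {a..t} = at s within {a..<b}"
    by (rule at_within_nhd[where S = "{..<t}"]) (use t in auto)
  ultimately show "(u has_vector_derivative - cnj (A (u s)) / c) (at s within {a..<b})"
    by simp
qed

end

section \<open>The potential in polar coordinates\<close>

text \<open>The differential of the complex logarithm at \<open>x\<close> is \<open>y / x\<close>.
  Its real and imaginary parts are the differentials of \<open>ln r\<close> and of the angle; all
  gradients below are written through these two.\<close>

lemma has_derivative_ln_cmod:
  assumes "x \<noteq> 0"
  shows "((\<lambda>y. ln (cmod y)) has_derivative (\<lambda>y. Re (y / x))) (at x)"
proof -
  have "((\<lambda>y. ln (cmod y)) has_derivative (\<lambda>y. inverse (cmod x) * (y \<bullet> sgn x))) (at x)"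
    using assms
    by (intro has_derivative_compose[OF has_derivative_norm, of x ln])
      (auto intro!: DERIV_ln[unfolded has_field_derivative_def])
  moreover have "inverse (cmod x) * (y \<bullet> sgn x) = Re (y / x)" for y
  proof -
    have "(Re x)\<^sup>2 + (Im x)\<^sup>2 = cmod x * cmod x"
      using cmod_power2[of x] by (simp only: power2_eq_square)
    then show ?thesis
      using assms by (simp add: sgn_div_norm inner_complex_def Re_divide field_simps)
  qed
  ultimately show ?thesis by simp
qed

text \<open>The branch of the angle with values within \<open>pi\<close> of \<open>t\<close>, cut
  along the ray opposite to the direction \<open>t\<close>.\<close>

definition arg_near :: "real \<Rightarrow> complex \<Rightarrow> real" where
  "arg_near t x = t + Im (Ln (x * cis (- t)))"

lemma has_derivative_arg_near:
  assumes "Re (x * cis (- t)) > 0"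
  shows "(arg_near t has_derivative (\<lambda>y. Im (y / x))) (at x)"
proof -
  have x: "x \<noteq> 0" using assms by auto
  have "((\<lambda>x. Ln (x * cis (- t))) has_field_derivative inverse (x * cis (- t)) * cis (- t)) (at x)"
    by (rule derivative_eq_intros refl | use assms in \<open>auto simp: complex_nonpos_Reals_iff\<close>)+
  moreover have "(*) (inverse (x * cis (- t)) * cis (- t)) = (\<lambda>y. y / x)"
    using x by (intro ext) (simp add: field_simps)
  ultimately have "((\<lambda>x. Ln (x * cis (- t))) has_derivative (\<lambda>y. y / x)) (at x)"
    unfolding has_field_derivative_def by (simp only:)
  then have "((\<lambda>x. t + Im (Ln (x * cis (- t)))) has_derivative (\<lambda>y. 0 + Im (y / x))) (at x)"
    by (intro has_derivative_add has_derivative_const has_derivative_Im)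
  then show ?thesis
    unfolding arg_near_def[abs_def] by simp
qed

lemma arg_near_polar:
  assumes "x \<noteq> 0"
  shows "x = complex_of_real (cmod x) * cis (arg_near t x)"
proof -
  have nz: "x * cis (- t) \<noteq> 0" using assms by simp
  have "x * cis (- t) = exp (Ln (x * cis (- t)))" using nz by simp
  also have "\<dots> = complex_of_real (exp (Re (Ln (x * cis (- t))))) * cis (Im (Ln (x * cis (- t))))"
    by (rule exp_eq_polar)
  also have "exp (Re (Ln (x * cis (- t)))) = cmod x"
    using nz by (simp add: Re_Ln norm_mult)
  finally have "x * cis (- t) * cis t = complex_of_real (cmod x) * cis (Im (Ln (x * cis (- t)))) * cis t"
    by simp
  then show ?thesis
    by (simp add: arg_near_def cis_mult mult.assoc add.commute)
qed

lemma arg_near_eq: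
  assumes "r > 0" "\<bar>\<theta> - t\<bar> < pi"
  shows "arg_near t (complex_of_real r * cis \<theta>) = \<theta>"
proof -
  have "complex_of_real r * cis \<theta> * cis (- t) = complex_of_real r * cis (\<theta> - t)"
    by (simp add: cis_mult mult.assoc)
  moreover have "Ln (complex_of_real r * cis (\<theta> - t)) = of_real (ln r) + Ln (cis (\<theta> - t))"
    using assms Ln_times_of_real[of r "cis (\<theta> - t)"] by (simp add: Ln_of_real)
  moreover have "Ln (cis (\<theta> - t)) = \<i> * of_real (\<theta> - t)"
    unfolding cis_conv_exp by (rule Ln_exp) (use assms in auto)
  ultimately have "Ln (complex_of_real r * cis \<theta> * cis (- t)) = of_real (ln r) + \<i> * of_real (\<theta> - t)"
    by (simp only:)
  then show ?thesis by (simp add: arg_near_def)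
qed

lemma arg_near_less:
  assumes "Re (x * cis (- t)) > 0"
  shows "\<bar>arg_near t x - t\<bar> < pi / 2"
proof -
  have "x * cis (- t) \<noteq> 0" using assms by force
  then show ?thesis using assms Re_Ln_pos_lt[of "x * cis (- t)"] by (simp add: arg_near_def)
qed

lemma sgn_cis_polar: "r > 0 \<Longrightarrow> sgn (complex_of_real r * cis \<theta>) = cis \<theta>"
  by (simp add: sgn_div_norm norm_mult scaleR_conv_of_real)


locale anisotropic_potential =
  fixes \<alpha> h \<theta>s :: real and U :: "complex \<Rightarrow> real"
  assumes \<alpha>: "0 < \<alpha>" "\<alpha> < 2" and C2: "C2_circle U"
    and U_min: "\<And>\<theta>. U (cis \<theta>) \<ge> U (cis \<theta>s)" and U_pos: "U (cis \<theta>s) > 0"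
    and U_nondeg: "deriv (deriv (\<lambda>\<theta>. U (cis \<theta>))) \<theta>s > 0" and h: "h < 0"
begin

definition Ua :: "real \<Rightarrow> real" where "Ua \<theta> = U (cis \<theta>)"
definition U1 :: "real \<Rightarrow> real" where "U1 = deriv Ua"
definition U2 :: "real \<Rightarrow> real" where "U2 = deriv U1"
text \<open>The degree of homogeneity of the Jacobi length at energy 0: the weight scales like
  \<open>r powr (- \<alpha> / 2)\<close>, the arc length like \<open>r\<close>.\<close>

definition \<beta> :: real where "\<beta> = 1 - \<alpha> / 2"
definition F :: "real \<Rightarrow> real \<Rightarrow> real" where "F r \<theta> = Ua \<theta> + h * r powr \<alpha>"

lemma Ua_eq: "Ua = (\<lambda>\<theta>. U (cis \<theta>))" by (simp add: Ua_def fun_eq_iff)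

lemma \<beta>: "0 < \<beta>" "\<beta> < 1" using \<alpha> by (auto simp: \<beta>_def)

lemma Ua_deriv: "(Ua has_real_derivative U1 \<theta>) (at \<theta>)"
  and U1_deriv: "(U1 has_real_derivative U2 \<theta>) (at \<theta>)"
  and U2_continuous: "continuous_on UNIV U2"
  using C2 unfolding C2_circle_def Ua_eq[symmetric] U1_def U2_def differentiable_on_def
  by (auto simp: DERIV_deriv_iff_real_differentiable)

lemma Ua_continuous: "continuous_on S Ua" and U1_continuous: "continuous_on S U1"
  using DERIV_isCont[OF Ua_deriv] DERIV_isCont[OF U1_deriv] by (auto intro!: continuous_at_imp_continuous_on)

lemmas Ua_chain = DERIV_chain2[OF Ua_deriv] and U1_chain = DERIV_chain2[OF U1_deriv]

lemma Ua_min: "Ua \<theta>s \<le> Ua \<theta>" and Ua_s_pos: "Ua \<theta>s > 0" and U2_pos: "U2 \<theta>s > 0"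
  using U_min U_pos U_nondeg by (auto simp: Ua_eq U2_def U1_def)

lemma Ua_pos: "Ua \<theta> > 0" using Ua_min[of \<theta>] Ua_s_pos by linarith

lemma U1_s: "U1 \<theta>s = 0"
  by (rule DERIV_local_min[OF Ua_deriv, of 1]) (use Ua_min in auto)

lemma potential_polar: "r > 0 \<Longrightarrow> potential \<alpha> U (complex_of_real r * cis \<theta>) = r powr (- \<alpha>) * Ua \<theta>"
  by (simp add: potential_def norm_mult Ua_def)

lemma shifted_potential_polar:
  assumes "r > 0"
  shows "h + potential \<alpha> U (complex_of_real r * cis \<theta>) = r powr (- \<alpha>) * F r \<theta>"
  using assms by (simp add: potential_polar F_def distrib_left mult.left_commute flip: powr_add)

lemma potential_nonneg: "potential \<alpha> U x \<ge> 0"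
proof (cases "x = 0")
  case False
  then show ?thesis
    using potential_polar[of "cmod x" "arg_near 0 x"] arg_near_polar[OF False, of 0] Ua_pos[of "arg_near 0 x"]
    by (metis less_eq_real_def mult_nonneg_nonneg norm_ge_zero powr_ge_zero zero_less_norm_iff)
qed (simp add: potential_def)

text \<open>Serves functions that are products of a function of \<open>ln r\<close> and a function
  of the angle: the potential, and later the global subsolution. The product form is asked for in a
  half-plane only, where the angle has a smooth branch.\<close>

lemma has_derivative_polar:
  assumes x: "x \<noteq> 0" and f: "\<And>\<rho> \<theta>. \<bar>\<theta> - t\<bar> < pi / 2 \<Longrightarrow> f (complex_of_real (exp \<rho>) * cis \<theta>) = g1 \<rho> * g2 \<theta>"
    and t: "x = complex_of_real (cmod x) * cis t"
    and g: "(g1 has_real_derivative d1) (at (ln (cmod x)))" "(g2 has_real_derivative d2) (at t)"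
  shows "(f has_derivative (\<lambda>y. d1 * g2 t * Re (y / x) + g1 (ln (cmod x)) * d2 * Im (y / x))) (at x)"
proof (rule has_derivative_transform_within_open)
  have r: "cmod x > 0" using x by simp
  have at: "arg_near t x = t"
    using arg_near_eq[OF r, of t t] t by simp
  have "x * cis (- t) = complex_of_real (cmod x) * (cis t * cis (- t))"
    using t by (metis mult.assoc)
  then have pos: "Re (x * cis (- t)) > 0"
    using r by (simp add: cis_mult)
  have "((\<lambda>y. g1 (ln (cmod y))) has_derivative (\<lambda>y. d1 * Re (y / x))) (at x)"
    using has_derivative_compose[OF has_derivative_ln_cmod[OF x] g(1)[unfolded has_field_derivative_def]] by simp
  moreover have "((\<lambda>y. g2 (arg_near t y)) has_derivative (\<lambda>y. d2 * Im (y / x))) (at x)"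
    using has_derivative_compose[OF has_derivative_arg_near[OF pos], of g2 "(*) d2"] g(2)
    by (simp add: has_field_derivative_def at)
  ultimately show "((\<lambda>y. g1 (ln (cmod y)) * g2 (arg_near t y)) has_derivative
      (\<lambda>y. d1 * g2 t * Re (y / x) + g1 (ln (cmod x)) * d2 * Im (y / x))) (at x)"
    by (rule has_derivative_eq_rhs[OF has_derivative_mult]) (auto simp: at algebra_simps)
  show "open {y. Re (y * cis (- t)) > 0}"
    by (intro open_Collect_less continuous_intros)
  show "x \<in> {y. Re (y * cis (- t)) > 0}" using pos by simp
  fix y assume "y \<in> {y. Re (y * cis (- t)) > 0}"
  then have y: "Re (y * cis (- t)) > 0" by simp
  then have "y \<noteq> 0" by auto
  then show "g1 (ln (cmod y)) * g2 (arg_near t y) = f y"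
    using f[of "arg_near t y" "ln (cmod y)"] arg_near_less[OF y] arg_near_polar[of y t] by simp
qed

lemma potential_gradient:
  fixes \<theta> :: real
  assumes "r > 0" and x_def: "x = complex_of_real r * cis \<theta>"
  shows "(potential \<alpha> U has_derivative (\<lambda>y. r powr (- \<alpha>) * (- \<alpha> * Ua \<theta> * Re (y / x) + U1 \<theta> * Im (y / x)))) (at x)"
    and "GDERIV (potential \<alpha> U) x :> cis \<theta> * (r powr (- \<alpha> - 1) * (- \<alpha> * Ua \<theta> + \<i> * U1 \<theta>))"
proof -
  have x: "x \<noteq> 0" "cmod x = r" using assms by (auto simp: norm_mult)
  have "(potential \<alpha> U has_derivative (\<lambda>y. (- \<alpha> * exp (- \<alpha> * ln (cmod x))) * Ua \<theta> * Re (y / x) +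
      exp (- \<alpha> * ln (cmod x)) * U1 \<theta> * Im (y / x))) (at x)"
  proof (rule has_derivative_polar[OF x(1), where t = \<theta> and ?d1.0 = "- \<alpha> * exp (- \<alpha> * ln (cmod x))" and ?d2.0 = "U1 \<theta>"])
    show "potential \<alpha> U (complex_of_real (exp \<rho>) * cis \<theta>) = exp (- \<alpha> * \<rho>) * Ua \<theta>" for \<rho> \<theta>
      by (simp add: potential_polar powr_def)
    show "((\<lambda>\<rho>. exp (- \<alpha> * \<rho>)) has_real_derivative - \<alpha> * exp (- \<alpha> * ln (cmod x))) (at (ln (cmod x)))"
      by (auto intro!: derivative_eq_intros)
  qed (use x Ua_deriv in \<open>auto simp: x_def\<close>)
  then show D: "(potential \<alpha> U has_derivative (\<lambda>y. r powr (- \<alpha>) * (- \<alpha> * Ua \<theta> * Re (y / x) + U1 \<theta> * Im (y / x)))) (at x)"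
    by (rule has_derivative_eq_rhs) (use \<open>r > 0\<close> in \<open>auto simp: x powr_def algebra_simps\<close>)
  have "r powr (- \<alpha>) * (- \<alpha> * Ua \<theta> * Re (y / x) + U1 \<theta> * Im (y / x)) =
      y \<bullet> (cis \<theta> * (r powr (- \<alpha> - 1) * (- \<alpha> * Ua \<theta> + \<i> * U1 \<theta>)))" for y
  proof -
    have "y / x = y * cis (- \<theta>) / r"
      by (simp add: x_def divide_inverse mult.commute mult.left_commute)
    then have y: "Re (y / x) = (Re y * cos \<theta> + Im y * sin \<theta>) / r" "Im (y / x) = (Im y * cos \<theta> - Re y * sin \<theta>) / r"
      by (simp_all add: algebra_simps)
    have r: "r powr (- \<alpha> - 1) = r powr (- \<alpha>) / r"
      using \<open>r > 0\<close> by (simp add: powr_diff)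
    show ?thesis
      unfolding y r inner_complex_def by (simp add: algebra_simps add_divide_distrib diff_divide_distrib)
  qed
  then show "GDERIV (potential \<alpha> U) x :> cis \<theta> * (r powr (- \<alpha> - 1) * (- \<alpha> * Ua \<theta> + \<i> * U1 \<theta>))"
    using D unfolding gderiv_def by simp
qed

lemma potential_continuous: "continuous_on (- {0}) (potential \<alpha> U)"
proof (intro continuous_at_imp_continuous_on ballI)
  fix x :: complex assume "x \<in> - {0}"
  then have "cmod x > 0" "x \<noteq> 0" by auto
  then show "isCont (potential \<alpha> U) x"
    using has_derivative_continuous[OF potential_gradient(1)[OF _ arg_near_polar]] by blast
qed

lemma potential_measurable: "potential \<alpha> U \<in> borel_measurable borel"
proof -
  have "(\<lambda>x. indicat_real (- {0}) x *\<^sub>R potential \<alpha> U x) \<in> borel_measurable borel"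
    by (rule borel_measurable_continuous_on_indicator[OF _ potential_continuous]) simp
  \<comment> \<open>At the origin \<open>potential\<close> takes the value 0, because
    \<open>0 powr (- \<alpha>)\<close> is 0.\<close>
  also have "(\<lambda>x. indicat_real (- {0}) x *\<^sub>R potential \<alpha> U x) = potential \<alpha> U"
    by (auto simp: fun_eq_iff potential_def indicator_def)
  finally show ?thesis .
qed

end

section \<open>Rays of the stable manifold\<close>

lemma DERIV_sqrt_compose:
  assumes "(f has_real_derivative D) (at s)" "f s > 0"
  shows "((\<lambda>s. sqrt (f s)) has_real_derivative D / (2 * sqrt (f s))) (at s)"
  by (rule DERIV_cong[OF DERIV_chain2[OF DERIV_real_sqrt assms(1)]]) (use assms(2) in \<open>auto simp: field_simps\<close>)

text \<open>
  An orbit of the McGehee system tending to the equilibrium, as a graph over \<open>s = - ln (r / r0)\<close>: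
  there \<open>\<theta>' = - p\<close> with \<open>p = tan (\<phi> - \<theta> - \<pi>)\<close>.
\<close>

locale collision_ray = anisotropic_potential +
  fixes r0 d :: real and \<theta> p :: "real \<Rightarrow> real" and k \<delta> Ub pb :: real
  assumes r0: "r0 > 0" and d: "d > 0"
    and r_small: "- h * (r0 * exp d) powr \<alpha> \<le> \<beta> * Ua \<theta>s / 2"
    and \<delta>: "0 < \<delta>" "\<delta> < pi / 2"
    and convex: "k > 0" "\<And>t. \<bar>t - \<theta>s\<bar> < \<delta> \<Longrightarrow> k \<le> U2 t"
    and \<theta>_deriv: "\<And>s. s > - d \<Longrightarrow> (\<theta> has_real_derivative - p s) (at s)"
    and p_deriv: "\<And>s. s > - d \<Longrightarrow> (p has_real_derivative (1 + (p s)\<^sup>2) *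
      ((\<beta> + \<alpha> * h * (r0 * exp (- s)) powr \<alpha> / (2 * F (r0 * exp (- s)) (\<theta> s))) * p s -
        U1 (\<theta> s) / (2 * F (r0 * exp (- s)) (\<theta> s)))) (at s)"
    and near: "\<And>s. s > - d \<Longrightarrow> \<bar>\<theta> s - \<theta>s\<bar> < \<delta>" "\<And>s. s > - d \<Longrightarrow> \<bar>p s\<bar> \<le> pb" "pb \<le> 1"
      "\<And>s. s > - d \<Longrightarrow> Ua (\<theta> s) \<le> Ub"
    and slope: "\<And>s. s > - d \<Longrightarrow> 2 * (U1 (\<theta> s))\<^sup>2 < k * Ua \<theta>s"
    and limits: "(\<theta> \<longlongrightarrow> \<theta>s) at_top" "(p \<longlongrightarrow> 0) at_top"
begin

definition rr :: "real \<Rightarrow> real" where "rr s = r0 * exp (- s)"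
definition Fs :: "real \<Rightarrow> real" where "Fs s = F (rr s) (\<theta> s)"
definition q :: "real \<Rightarrow> real" where "q s = sqrt (1 + (p s)\<^sup>2)"
definition G :: "real \<Rightarrow> real" where "G s = rr s powr \<beta> * sqrt (2 * Fs s)"
definition P :: "real \<Rightarrow> real" where "P s = G s * p s / q s"
definition S :: "real \<Rightarrow> real" where "S s = integral {s..} (\<lambda>x. G x * q x)"
text \<open>Physical time per unit of \<open>s\<close>: the arc length \<open>rr s * q s\<close>
  divided by the speed \<open>sqrt (2 * Fs s) * rr s powr (- \<alpha> / 2)\<close>.\<close>

definition dt :: "real \<Rightarrow> real" where "dt s = rr s powr (1 + \<alpha> / 2) * q s / sqrt (2 * Fs s)"
definition remaining :: "real \<Rightarrow> real" where "remaining s = integral {s..} dt"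
definition pos :: "real \<Rightarrow> complex" where "pos s = rr s * cis (\<theta> s)"
text \<open>The scalar factor enforces the speed prescribed by the energy \<open>h\<close>; the
  minus sign is there because the radius decreases as \<open>s\<close> grows.\<close>

definition vel :: "real \<Rightarrow> complex" where
  "vel s = - (sqrt (2 * Fs s) * rr s powr (- \<alpha> / 2) / q s) * (cis (\<theta> s) * (1 + \<i> * p s))"

lemma F_lower:
  assumes "0 \<le> r" "r \<le> r0 * exp d"
  shows "F r t \<ge> Ua \<theta>s / 2"
proof -
  have "r powr \<alpha> \<le> (r0 * exp d) powr \<alpha>" using assms \<alpha> by (intro powr_mono2) auto
  then have "h * r powr \<alpha> \<ge> h * (r0 * exp d) powr \<alpha>" using h by (intro mult_left_mono_neg) auto
  moreover have "\<beta> * Ua \<theta>s \<le> Ua \<theta>s" using \<beta> Ua_s_pos by simp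
  ultimately show ?thesis using r_small Ua_min[of t] by (simp add: F_def)
qed

lemma F_pos: "0 \<le> r \<Longrightarrow> r \<le> r0 * exp d \<Longrightarrow> F r t > 0"
  using F_lower[of r t] Ua_s_pos by simp

lemma rr_pos: "rr s > 0" using r0 by (simp add: rr_def)

lemma rr_less: "s > - d \<Longrightarrow> rr s < r0 * exp d" using r0 by (simp add: rr_def)

lemma rr_powr: "rr s powr a = r0 powr a * exp (- a * s)"
  using r0 by (simp add: rr_def powr_mult exp_powr_real mult.commute)

lemma rr_powr_deriv: "((\<lambda>s. rr s powr a) has_real_derivative - a * rr s powr a) (at s)"
  unfolding rr_powr by (auto intro!: derivative_eq_intros)

lemma rr_deriv: "(rr has_real_derivative - rr s) (at s)"
  unfolding rr_def[abs_def] by (auto intro!: derivative_eq_intros)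

lemma Fs_lower: "s > - d \<Longrightarrow> Fs s \<ge> Ua \<theta>s / 2"
  unfolding Fs_def by (rule F_lower) (use rr_pos[of s] rr_less[of s] in auto)

lemma Fs_pos: "s > - d \<Longrightarrow> Fs s > 0"
  using Fs_lower[of s] Ua_s_pos by simp

lemma Fs_upper: "s > - d \<Longrightarrow> Fs s \<le> Ub"
proof -
  assume "s > - d"
  moreover have "h * rr s powr \<alpha> \<le> 0" using h by (simp add: mult_nonpos_nonneg)
  ultimately show ?thesis using near(4)[of s] by (simp add: Fs_def F_def)
qed

lemma Ub_pos: "Ub > 0" using Fs_upper[of 0] Fs_pos[of 0] d by auto

lemma pb_nonneg: "0 \<le> pb" using near(2)[of 0] d by auto

lemma q_ge_1: "q s \<ge> 1" by (simp add: q_def)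

lemma q_pos: "q s > 0" using q_ge_1[of s] by linarith

lemma q_square: "(q s)\<^sup>2 = 1 + (p s)\<^sup>2" by (simp add: q_def)

lemma q_upper: "s > - d \<Longrightarrow> q s \<le> sqrt (1 + pb\<^sup>2)"
  using near(2)[of s] abs_le_square_iff[of "p s" pb] pb_nonneg by (simp add: q_def)

lemma Fs_deriv: "s > - d \<Longrightarrow> (Fs has_real_derivative - (U1 (\<theta> s) * p s + \<alpha> * h * rr s powr \<alpha>)) (at s)"
  unfolding Fs_def[abs_def] F_def
  by (rule derivative_eq_intros Ua_chain \<theta>_deriv rr_powr_deriv refl | simp)+

lemma p_deriv': "s > - d \<Longrightarrow> (p has_real_derivative (q s)\<^sup>2 *
    ((\<beta> + \<alpha> * h * rr s powr \<alpha> / (2 * Fs s)) * p s - U1 (\<theta> s) / (2 * Fs s))) (at s)"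
  using p_deriv[of s] by (simp add: q_square rr_def Fs_def)

lemma q_deriv: "(p has_real_derivative p') (at s) \<Longrightarrow> (q has_real_derivative p s * p' / q s) (at s)"
proof -
  assume p: "(p has_real_derivative p') (at s)"
  have "((\<lambda>s. 1 + (p s)\<^sup>2) has_real_derivative 2 * p s * p') (at s)"
    by (rule derivative_eq_intros p refl | simp)+
  from DERIV_sqrt_compose[OF this] show ?thesis
    unfolding q_def[abs_def] by (simp add: add_pos_nonneg)
qed

lemma sqrt_Fs_deriv: "s > - d \<Longrightarrow>
    ((\<lambda>s. sqrt (2 * Fs s)) has_real_derivative
      - sqrt (2 * Fs s) * ((U1 (\<theta> s) * p s + \<alpha> * h * rr s powr \<alpha>) / (2 * Fs s))) (at s)"
proof -
  assume s: "s > - d"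
  define A where "A = sqrt (2 * Fs s)"
  have A: "A > 0" "2 * Fs s = A * A" using Fs_pos[OF s] by (auto simp: A_def)
  have "((\<lambda>s. sqrt (2 * Fs s)) has_real_derivative
      2 * - (U1 (\<theta> s) * p s + \<alpha> * h * rr s powr \<alpha>) / (2 * A)) (at s)"
    unfolding A_def by (intro DERIV_sqrt_compose DERIV_cmult Fs_deriv s) (use Fs_pos[OF s] in auto)
  also have "2 * - (U1 (\<theta> s) * p s + \<alpha> * h * rr s powr \<alpha>) / (2 * A) =
      - A * ((U1 (\<theta> s) * p s + \<alpha> * h * rr s powr \<alpha>) / (A * A))"
    using A(1) by (simp add: field_simps)
  finally show ?thesis unfolding A(2)[symmetric] by (simp add: A_def)
qed

lemma G_pos: "s > - d \<Longrightarrow> G s > 0"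
  using Fs_pos[of s] rr_pos[of s] by (simp add: G_def)

lemma G_square: "s > - d \<Longrightarrow> (G s)\<^sup>2 = rr s powr (2 * \<beta>) * (2 * Fs s)"
  using Fs_pos[of s] by (simp add: G_def power_mult_distrib power2_eq_square[of "rr s powr \<beta>"] flip: powr_add)

lemma G_deriv: "s > - d \<Longrightarrow>
    (G has_real_derivative - G s * (\<beta> + (U1 (\<theta> s) * p s + \<alpha> * h * rr s powr \<alpha>) / (2 * Fs s))) (at s)"
  unfolding G_def[abs_def]
  by (rule DERIV_cong[OF DERIV_mult[OF rr_powr_deriv sqrt_Fs_deriv]]) (auto simp: algebra_simps)

text \<open>The Euler--Lagrange equation of the length \<open>\<integral> G sqrt (1 + p\<^sup>2) ds\<close>.\<close>

lemma P_deriv: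
  assumes s: "s > - d"
  shows "(P has_real_derivative - (G s * U1 (\<theta> s) / (2 * Fs s)) * q s) (at s)"
proof -
  define w where "w = U1 (\<theta> s) / (2 * Fs s)"
  define e where "e = \<alpha> * h * rr s powr \<alpha> / (2 * Fs s)"
  define p' where "p' = (q s)\<^sup>2 * ((\<beta> + e) * p s - w)"
  have p': "(p has_real_derivative p') (at s)"
    using p_deriv'[OF s] by (simp add: p'_def e_def w_def)
  have G': "(G has_real_derivative - G s * (\<beta> + (w * p s + e))) (at s)"
    using G_deriv[OF s] by (simp add: e_def w_def add_divide_distrib)
  have "(P has_real_derivative (((- G s * (\<beta> + (w * p s + e))) * p s + G s * p') * q s - G s * p s * (p s * p' / q s)) / (q s)\<^sup>2) (at s)"
    unfolding P_def[abs_def]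
    by (rule derivative_eq_intros G' p' q_deriv[OF p'] refl | use q_pos[of s] in \<open>simp add: power2_eq_square\<close>)+
  also have "(((- G s * (\<beta> + (w * p s + e))) * p s + G s * p') * q s - G s * p s * (p s * p' / q s)) / (q s)\<^sup>2 =
      - (G s * w) * q s"
  proof -
    have "(((- G s * (\<beta> + (w * p s + e))) * p s + G s * p') * q s - G s * p s * (p s * p' / q s)) / (q s)\<^sup>2 =
      G s * (- (\<beta> + (w * p s + e)) * p s * (q s)\<^sup>2 + p' * ((q s)\<^sup>2 - (p s)\<^sup>2)) / (q s) ^ 3"
      using q_pos[of s] by (simp add: field_simps power2_eq_square power3_eq_cube)
    also have "- (\<beta> + (w * p s + e)) * p s * (q s)\<^sup>2 + p' * ((q s)\<^sup>2 - (p s)\<^sup>2) = - w * (q s)\<^sup>2 * (1 + (p s)\<^sup>2)"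
      by (simp add: p'_def q_square) (simp add: algebra_simps power2_eq_square)
    also have "\<dots> = - w * (q s) ^ 4"
      unfolding q_square[symmetric] by (simp add: power2_eq_square power4_eq_xxxx)
    finally show ?thesis using q_pos[of s] by (simp add: field_simps power2_eq_square power3_eq_cube power4_eq_xxxx)
  qed
  finally show ?thesis by (simp add: w_def)
qed

lemma continuous_along_ray:
  shows "continuous_on {- d<..} \<theta>" "continuous_on {- d<..} p" "continuous_on {- d<..} Fs"
    "continuous_on {- d<..} q" "continuous_on {- d<..} G" "continuous_on A (\<lambda>s. rr s powr a)"
proof -
  show "continuous_on {- d<..} \<theta>" using \<theta>_deriv DERIV_isCont
    by (intro continuous_at_imp_continuous_on) blast
  show p: "continuous_on {- d<..} p" using p_deriv DERIV_isCont
    by (intro continuous_at_imp_continuous_on) blast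
  show "continuous_on {- d<..} Fs" using Fs_deriv DERIV_isCont
    by (intro continuous_at_imp_continuous_on) blast
  show "continuous_on {- d<..} q" unfolding q_def[abs_def] by (intro continuous_intros p)
  show "continuous_on {- d<..} G" using G_deriv DERIV_isCont
    by (intro continuous_at_imp_continuous_on) blast
  show "continuous_on A (\<lambda>s. rr s powr a)" using rr_powr_deriv DERIV_isCont
    by (intro continuous_at_imp_continuous_on) blast
qed

lemma S_integrand_bound:
  assumes "s > - d"
  shows "\<bar>G s * q s\<bar> \<le> (r0 powr \<beta> * sqrt (2 * Ub) * sqrt (1 + pb\<^sup>2)) * exp (- \<beta> * s)"
proof -
  have "\<bar>G s * q s\<bar> = rr s powr \<beta> * sqrt (2 * Fs s) * q s"
    using G_pos[OF assms] q_pos[of s] by (simp add: G_def)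
  also have "\<dots> \<le> rr s powr \<beta> * sqrt (2 * Ub) * sqrt (1 + pb\<^sup>2)"
    using Fs_upper[OF assms] Fs_pos[OF assms] q_upper[OF assms] q_pos[of s] Ub_pos by (intro mult_mono) auto
  finally show ?thesis by (simp add: rr_powr mult_ac)
qed

lemma S_integrand_continuous: "continuous_on {- d<..} (\<lambda>s. G s * q s)"
  by (intro continuous_intros continuous_along_ray)

lemmas S_tail = exp_tail_integral[OF S_integrand_continuous \<beta>(1) S_integrand_bound]

lemma S_deriv: "s > - d \<Longrightarrow> (S has_real_derivative - (G s * q s)) (at s)"
  unfolding S_def[abs_def] by (rule S_tail(3)) auto

lemma dt_pos: "s > - d \<Longrightarrow> dt s > 0"
  using Fs_pos[of s] rr_pos[of s] q_pos[of s] by (simp add: dt_def)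

lemma dt_bound:
  assumes "s > - d"
  shows "\<bar>dt s\<bar> \<le> (r0 powr (1 + \<alpha> / 2) * sqrt (1 + pb\<^sup>2) / sqrt (Ua \<theta>s)) * exp (- (1 + \<alpha> / 2) * s)"
proof -
  have "\<bar>dt s\<bar> = rr s powr (1 + \<alpha> / 2) * q s / sqrt (2 * Fs s)"
    using dt_pos[OF assms] unfolding dt_def by (rule abs_of_pos)
  also have "\<dots> \<le> rr s powr (1 + \<alpha> / 2) * sqrt (1 + pb\<^sup>2) / sqrt (Ua \<theta>s)"
    using q_upper[OF assms] Fs_lower[OF assms] Ua_s_pos q_pos[of s] by (intro frac_le mult_left_mono) auto
  finally show ?thesis by (simp add: rr_powr mult_ac)
qed

lemma dt_continuous: "continuous_on {- d<..} dt"
  unfolding dt_def[abs_def] using Fs_pos by (intro continuous_intros continuous_along_ray) force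

lemmas remaining_tail = exp_tail_integral[OF dt_continuous _ dt_bound]

lemma remaining_deriv: "s > - d \<Longrightarrow> (remaining has_real_derivative - dt s) (at s)"
  unfolding remaining_def[abs_def] using \<alpha> by (intro remaining_tail(3)) auto

lemma tail_limits: "(S \<longlongrightarrow> 0) at_top" "(remaining \<longlongrightarrow> 0) at_top"
proof -
  have exp0: "((\<lambda>s. K * exp (- \<gamma> * s)) \<longlongrightarrow> 0) at_top" if "\<gamma> > 0" for K \<gamma> :: real
  proof -
    have "filterlim (\<lambda>s. - (\<gamma> * s)) at_bot at_top"
      using that by (simp add: filterlim_uminus_at_bot filterlim_tendsto_pos_mult_at_top[OF tendsto_const] filterlim_ident)
    from filterlim_compose[OF exp_at_bot this] have "((\<lambda>s. exp (- \<gamma> * s)) \<longlongrightarrow> 0) at_top" by simp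
    from tendsto_mult_left[OF this, of K] show ?thesis by simp
  qed
  have ev: "\<forall>\<^sub>F s in at_top. s > - d" by (rule eventually_gt_at_top)
  have "\<And>s. s > - d \<Longrightarrow> norm (S s) \<le>
      (r0 powr \<beta> * sqrt (2 * Ub) * sqrt (1 + pb\<^sup>2)) / \<beta> * exp (- \<beta> * s)"
    unfolding S_def real_norm_def by (rule S_tail(2)) auto
  from Lim_null_comparison[OF eventually_mono[OF ev this] exp0[OF \<beta>(1)]]
  show "(S \<longlongrightarrow> 0) at_top" .
  have pos: "0 < 1 + \<alpha> / 2" using \<alpha> by simp
  then have "\<And>s. s > - d \<Longrightarrow> norm (remaining s) \<le>
      (r0 powr (1 + \<alpha> / 2) * sqrt (1 + pb\<^sup>2) / sqrt (Ua \<theta>s)) / (1 + \<alpha> / 2) * exp (- (1 + \<alpha> / 2) * s)"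
    unfolding remaining_def real_norm_def by (intro remaining_tail(2)) auto
  from Lim_null_comparison[OF eventually_mono[OF ev this] exp0[OF pos]]
  show "(remaining \<longlongrightarrow> 0) at_top" .
qed

lemma pos_norm: "cmod (pos s) = rr s"
  using rr_pos[of s] by (simp add: pos_def norm_mult)

lemma pos_nonzero: "pos s \<noteq> 0"
  using rr_pos[of s] by (simp add: pos_def)

lemma cis_deriv: "s > - d \<Longrightarrow> ((\<lambda>s. cis (\<theta> s)) has_vector_derivative - (\<i> * p s) * cis (\<theta> s)) (at s)"
  using has_derivative_cis[OF \<theta>_deriv[unfolded has_field_derivative_def]]
  by (simp add: has_vector_derivative_def scaleR_conv_of_real mult_ac)

lemma dt_vel: "s > - d \<Longrightarrow> dt s *\<^sub>R vel s = - pos s * (1 + \<i> * p s)"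
proof -
  assume s: "s > - d"
  have "rr s powr (1 + \<alpha> / 2) * rr s powr (- \<alpha> / 2) = rr s"
    using rr_pos[of s] by (simp flip: powr_add)
  then have "dt s * (sqrt (2 * Fs s) * rr s powr (- \<alpha> / 2) / q s) = rr s"
    using q_pos[of s] Fs_pos[OF s] by (simp add: dt_def)
  then have "complex_of_real (dt s) * of_real (- (sqrt (2 * Fs s) * rr s powr (- \<alpha> / 2) / q s)) = - of_real (rr s)"
    by (metis mult_minus_right of_real_minus of_real_mult)
  then have "dt s *\<^sub>R vel s = - of_real (rr s) * (cis (\<theta> s) * (1 + \<i> * p s))"
    unfolding vel_def scaleR_conv_of_real by (simp only: mult.assoc[symmetric])
  then show ?thesis by (simp add: pos_def algebra_simps)
qed

lemma pos_deriv: "s > - d \<Longrightarrow> (pos has_vector_derivative dt s *\<^sub>R vel s) (at s)"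
proof -
  assume s: "s > - d"
  have "(pos has_vector_derivative rr s * (- (\<i> * p s) * cis (\<theta> s)) + of_real (- rr s) * cis (\<theta> s)) (at s)"
    unfolding pos_def[abs_def]
    by (intro has_vector_derivative_mult has_vector_derivative_of_real rr_deriv cis_deriv s)
  moreover have "dt s *\<^sub>R vel s = rr s * (- (\<i> * p s) * cis (\<theta> s)) + of_real (- rr s) * cis (\<theta> s)"
    unfolding dt_vel[OF s] by (simp add: pos_def algebra_simps)
  ultimately show ?thesis by simp
qed

lemma vel_norm_square: "s > - d \<Longrightarrow> (cmod (vel s))\<^sup>2 = 2 * Fs s * rr s powr (- \<alpha>)"
proof -
  assume s: "s > - d"
  have "(cmod (1 + \<i> * p s))\<^sup>2 = (q s)\<^sup>2" by (simp add: cmod_power2 q_square)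
  moreover have "(rr s powr (- \<alpha> / 2))\<^sup>2 = rr s powr (- \<alpha>)" by (simp add: power2_eq_square flip: powr_add)
  ultimately show ?thesis
    using Fs_pos[OF s] q_pos[of s]
    by (simp add: vel_def norm_mult norm_divide power_mult_distrib power_divide)
qed

lemma vel_nonzero: "s > - d \<Longrightarrow> vel s \<noteq> 0"
  using vel_norm_square[of s] Fs_pos[of s] rr_pos[of s] by auto

lemma energy: "s > - d \<Longrightarrow> 1 / 2 * (cmod (vel s))\<^sup>2 - potential \<alpha> U (pos s) = h"
  using shifted_potential_polar[OF rr_pos, of s "\<theta> s"] by (simp add: vel_norm_square Fs_def pos_def mult.commute)

text \<open>Maupertuis' principle along a solution: the Jacobi weight is the speed, so the length
  element is the square of the speed times \<open>dt\<close>.\<close>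

lemma action_rate: "s > - d \<Longrightarrow> G s * q s = dt s * (cmod (vel s))\<^sup>2"
proof -
  assume s: "s > - d"
  have "rr s powr (1 + \<alpha> / 2) * rr s powr (- \<alpha>) = rr s powr \<beta>"
    by (simp add: \<beta>_def flip: powr_add)
  moreover have "2 * Fs s / sqrt (2 * Fs s) = sqrt (2 * Fs s)"
    using Fs_pos[OF s] by (simp add: real_div_sqrt)
  moreover have "dt s * (cmod (vel s))\<^sup>2 =
      (rr s powr (1 + \<alpha> / 2) * rr s powr (- \<alpha>)) * (2 * Fs s / sqrt (2 * Fs s)) * q s"
    unfolding dt_def vel_norm_square[OF s] by (simp only: times_divide_eq_left times_divide_eq_right ac_simps)
  ultimately show ?thesis by (simp only: G_def)
qed

definition force :: "real \<Rightarrow> complex" where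
  "force s = cis (\<theta> s) * (rr s powr (- \<alpha> - 1) * (- \<alpha> * Ua (\<theta> s) + \<i> * U1 (\<theta> s)))"

lemma force_gradient: "GDERIV (potential \<alpha> U) (pos s) :> force s"
  unfolding force_def by (rule potential_gradient(2)[OF rr_pos]) (simp add: pos_def)

text \<open>Newton's equation in the variable \<open>s\<close>. Its tangential part is contained in
  the speed factor of \<open>vel\<close>, fixed by the energy; the transversal part is the equation
  for \<open>p\<close>.\<close>

lemma vel_deriv: "s > - d \<Longrightarrow> (vel has_vector_derivative dt s *\<^sub>R force s) (at s)"
proof -
  assume s: "s > - d"
  define u where "u = U1 (\<theta> s) / (2 * Fs s)"
  define a where "a = \<alpha> * Ua (\<theta> s) / (2 * Fs s)"
  define R where "R = \<alpha> * h * rr s powr \<alpha> / (2 * Fs s)"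
  define e where "e = (\<beta> + R) * p s - u"
  define w where "w = (\<lambda>s. sqrt (2 * Fs s) * rr s powr (- \<alpha> / 2) / q s)"
  \<comment> \<open>Dividing \<open>Fs = Ua + h * rr powr \<alpha>\<close> by \<open>2 * Fs\<close>
    eliminates the radial term \<open>R\<close>; what is left involves only \<open>Ua\<close> and
    \<open>U1\<close>, as the force does.\<close>
  have aR: "a = \<alpha> / 2 - R"
    using Fs_pos[OF s] by (simp add: a_def R_def Fs_def F_def field_simps)
  have p': "(p has_real_derivative (q s)\<^sup>2 * e) (at s)"
    using p_deriv'[OF s] by (simp add: e_def u_def R_def)
  have F': "((\<lambda>s. sqrt (2 * Fs s)) has_real_derivative - sqrt (2 * Fs s) * (u * p s + R)) (at s)"
    using sqrt_Fs_deriv[OF s] by (simp add: u_def R_def add_divide_distrib)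
  have w': "(w has_real_derivative w s * (\<alpha> / 2 - (u * p s + R) - p s * e)) (at s)"
  proof -
    have alg: "((- A * x) * B + (y * B) * A) * Q - A * B * (z * (Q\<^sup>2 * e) / Q) = A * B / Q * (y - x - z * e) * (Q * Q)"
      if "Q > 0" for A B Q x y z e :: real
      using that by (simp add: field_simps power2_eq_square)
    show ?thesis
      unfolding w_def
      apply (rule DERIV_cong[OF DERIV_divide[OF DERIV_mult[OF F' rr_powr_deriv] q_deriv[OF p']]])
      using q_pos[of s] alg[OF q_pos[of s], of "sqrt (2 * Fs s)" "u * p s + R" "rr s powr (- \<alpha> / 2)" "\<alpha> / 2" "p s" e]
      by (auto simp: divide_eq_eq)
  qed
  have "((\<lambda>s. cis (\<theta> s) * (1 + \<i> * p s)) has_vector_derivative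
      cis (\<theta> s) * (0 + \<i> * of_real ((q s)\<^sup>2 * e)) + (- (\<i> * p s) * cis (\<theta> s)) * (1 + \<i> * p s)) (at s)"
    by (intro has_vector_derivative_mult has_vector_derivative_add has_vector_derivative_const
      has_vector_derivative_mult_right has_vector_derivative_of_real cis_deriv s p')
  from has_vector_derivative_mult[OF has_vector_derivative_of_real[OF DERIV_minus[OF w']] this]
  have "(vel has_vector_derivative of_real (- w s) * (cis (\<theta> s) * (0 + \<i> * of_real ((q s)\<^sup>2 * e)) +
        (- (\<i> * p s) * cis (\<theta> s)) * (1 + \<i> * p s)) +
      of_real (- (w s * (\<alpha> / 2 - (u * p s + R) - p s * e))) * (cis (\<theta> s) * (1 + \<i> * p s))) (at s)"
    unfolding vel_def[abs_def] w_def .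
  also have "of_real (- w s) * (cis (\<theta> s) * (0 + \<i> * of_real ((q s)\<^sup>2 * e)) +
        (- (\<i> * p s) * cis (\<theta> s)) * (1 + \<i> * p s)) +
      of_real (- (w s * (\<alpha> / 2 - (u * p s + R) - p s * e))) * (cis (\<theta> s) * (1 + \<i> * p s)) =
      of_real (- w s) * cis (\<theta> s) * (\<i> * of_real ((q s)\<^sup>2 * e) +
        of_real (\<alpha> / 2 - (u * p s + R) - p s * e) * (1 + \<i> * p s) - \<i> * p s * (1 + \<i> * p s))"
    by (simp add: algebra_simps)
  \<comment> \<open>With \<open>e\<close> and \<open>R\<close> expressed through \<open>a\<close>
    and \<open>u\<close>, the factor \<open>1 + (p s)\<^sup>2\<close> splits off from all
    terms.\<close>
  also have "\<i> * of_real ((q s)\<^sup>2 * e) + of_real (\<alpha> / 2 - (u * p s + R) - p s * e) * (1 + \<i> * p s) - \<i> * p s * (1 + \<i> * p s) =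
      of_real ((q s)\<^sup>2) * (of_real a - \<i> * of_real u)"
  proof -
    have "e = (1 - a) * p s - u" by (simp add: e_def aR \<beta>_def algebra_simps)
    moreover have "R = \<alpha> / 2 - a" using aR by simp
    ultimately show ?thesis
      unfolding q_square by (simp add: complex_eq_iff) (simp add: algebra_simps power2_eq_square power3_eq_cube)
  qed
  also have "of_real (- w s) * cis (\<theta> s) * (of_real ((q s)\<^sup>2) * (of_real a - \<i> * of_real u)) = dt s *\<^sub>R force s"
  proof -
    have r: "rr s powr (1 + \<alpha> / 2) * rr s powr (- \<alpha> - 1) = rr s powr (- \<alpha> / 2)"
      by (simp flip: powr_add)
    define A where "A = sqrt (2 * Fs s)"
    have A: "A > 0" "2 * Fs s = A * A" using Fs_pos[OF s] by (auto simp: A_def)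
    have "dt s * rr s powr (- \<alpha> - 1) = rr s powr (- \<alpha> / 2) * q s / A"
      unfolding dt_def r[symmetric] A_def by simp
    also have "\<dots> = w s * (q s)\<^sup>2 / (2 * Fs s)"
      unfolding w_def A_def[symmetric] A(2) using A(1) q_pos[of s] by (simp add: power2_eq_square)
    finally have *: "dt s * rr s powr (- \<alpha> - 1) = w s * (q s)\<^sup>2 / (2 * Fs s)" .
    have "of_real (w s) * of_real ((q s)\<^sup>2) * (of_real a - \<i> * of_real u) =
      of_real (w s * (q s)\<^sup>2 / (2 * Fs s)) * (\<alpha> * Ua (\<theta> s) - \<i> * U1 (\<theta> s))"
      by (simp add: a_def u_def complex_eq_iff)
    also have "\<dots> = dt s * (rr s powr (- \<alpha> - 1) * (\<alpha> * Ua (\<theta> s) - \<i> * U1 (\<theta> s)))"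
      unfolding *[symmetric] by simp
    finally have "of_real (w s) * of_real ((q s)\<^sup>2) * (of_real a - \<i> * of_real u) =
        dt s * (rr s powr (- \<alpha> - 1) * (\<alpha> * Ua (\<theta> s) - \<i> * U1 (\<theta> s)))" .
    then have "- cis (\<theta> s) * (of_real (w s) * of_real ((q s)\<^sup>2) * (of_real a - \<i> * of_real u)) =
        - cis (\<theta> s) * (dt s * (rr s powr (- \<alpha> - 1) * (\<alpha> * Ua (\<theta> s) - \<i> * U1 (\<theta> s))))"
      by (simp only:)
    then show ?thesis
      unfolding force_def scaleR_conv_of_real by (simp add: algebra_simps)
  qed
  finally show ?thesis .
qed

end

section \<open>Calibration by a ray\<close>

text \<open>Needed for the two time changes, which give time as an increasing function of
  \<open>s\<close>.\<close>

lemma increasing_inverse: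
  fixes f f' :: "real \<Rightarrow> real"
  assumes f: "\<And>s. s > m \<Longrightarrow> (f has_real_derivative f' s) (at s)" and pos: "\<And>s. s > m \<Longrightarrow> f' s > 0"
  obtains g where "\<And>s. s > m \<Longrightarrow> g (f s) = s"
    and "\<And>s. s > m \<Longrightarrow> (g has_real_derivative inverse (f' s)) (at (f s))"
proof -
  have less: "f a < f b" if "m < a" "a < b" for a b
  proof (rule DERIV_pos_imp_increasing[OF that(2)])
    fix x assume "a \<le> x" "x \<le> b"
    with that have "x > m" by simp
    from f[OF this] pos[OF this] show "\<exists>y. (f has_real_derivative y) (at x) \<and> y > 0" by blast
  qed
  have inj: "inj_on f {m<..}"
    by (rule inj_onI) (metis greaterThan_iff less less_irrefl linorder_less_linear)
  define g where "g = inv_into {m<..} f"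
  have g: "g (f s) = s" if "s > m" for s
    unfolding g_def by (rule inv_into_f_f[OF inj]) (use that in auto)
  show ?thesis
  proof (rule that[of g])
    show "(g has_real_derivative inverse (f' s)) (at (f s))" if s: "s > m" for s
    proof -
      have cont: "continuous_on {m<..} f"
        using f DERIV_isCont by (intro continuous_at_imp_continuous_on) blast
      have id: "(*) (f' s) \<circ> (*) (inverse (f' s)) = id"
        using pos[OF s] by (auto simp: fun_eq_iff)
      have "(g has_derivative (*) (inverse (f' s))) (at (f s))"
        using has_derivative_inverse_strong[OF open_greaterThan _ cont _ f[OF s, unfolded has_field_derivative_def] id, of g]
          s g by simp
      then show ?thesis unfolding has_field_derivative_def .
    qed
  qed (rule g)
qed

text \<open>Subtracting \<open>k / 2 * t\<^sup>2\<close> leaves a convex function. The quadratic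
  gain over the tangent is what makes the calibration strict off the ray and bounds \<open>U\<close>
  from below near its minimum.\<close>

lemma convex_tangent:
  fixes f f' f'' :: "real \<Rightarrow> real"
  assumes f: "\<And>t. t \<in> I \<Longrightarrow> (f has_real_derivative f' t) (at t)" "\<And>t. t \<in> I \<Longrightarrow> (f' has_real_derivative f'' t) (at t)"
    and I: "convex I" "a \<in> I" "b \<in> I" and k: "\<And>t. t \<in> I \<Longrightarrow> k \<le> f'' t"
  shows "k / 2 * (b - a)\<^sup>2 \<le> f b - f a - f' a * (b - a)"
proof -
  have "(f' a - k * a) * (b - a) \<le> (f b - k / 2 * b\<^sup>2) - (f a - k / 2 * a\<^sup>2)"
  proof (rule f''_imp_f'[OF I(1), where f = "\<lambda>t. f t - k / 2 * t\<^sup>2" and f' = "\<lambda>t. f' t - k * t" and f'' = "\<lambda>t. f'' t - k"])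
    show "((\<lambda>t. f t - k / 2 * t\<^sup>2) has_real_derivative f' x - k * x) (at x)" if "x \<in> I" for x
      by (rule derivative_eq_intros f(1)[OF that] refl | simp)+
    show "((\<lambda>t. f' t - k * t) has_real_derivative f'' x - k) (at x)" if "x \<in> I" for x
      by (rule derivative_eq_intros f(2)[OF that] refl | simp)+
  qed (use I k in auto)
  then show ?thesis by (simp add: algebra_simps power2_eq_square)
qed

context collision_ray
begin

lemma Ua_tangent:
  assumes "\<bar>a - \<theta>s\<bar> < \<delta>" "\<bar>b - \<theta>s\<bar> < \<delta>"
  shows "k / 2 * (b - a)\<^sup>2 \<le> Ua b - Ua a - U1 a * (b - a)"
proof (rule convex_tangent[where I = "{\<theta>s - \<delta><..<\<theta>s + \<delta>}", OF Ua_deriv U1_deriv])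
  show "k \<le> U2 t" if "t \<in> {\<theta>s - \<delta><..<\<theta>s + \<delta>}" for t
    using that by (intro convex(2)) auto
qed (use assms in auto)

text \<open>
  The calibration: the action \<open>S\<close> along the ray, extended linearly in the angle. It is a strict
  subsolution of the Hamilton--Jacobi equation off the ray.
\<close>

definition sx :: "complex \<Rightarrow> real" where "sx x = ln r0 - ln (cmod x)"
definition \<Delta> :: "complex \<Rightarrow> real" where "\<Delta> x = arg_near \<theta>s x - \<theta> (sx x)"
definition W :: "complex \<Rightarrow> real" where "W x = S (sx x) + P (sx x) * \<Delta> x"
definition Ws :: "complex \<Rightarrow> real" where
  "Ws x = - (G (sx x) / q (sx x)) - G (sx x) * U1 (\<theta> (sx x)) / (2 * Fs (sx x)) * q (sx x) * \<Delta> x"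
definition A :: "complex \<Rightarrow> complex" where "A x = - ((Ws x + \<i> * P (sx x)) / x)"
text \<open>On the half-plane \<open>arg_near \<theta>s\<close> is smooth, and in the disc
  \<open>sx\<close> exceeds \<open>- d\<close>, so all data of the ray are available.\<close>

definition sector :: "complex set" where
  "sector = {x. 0 < Re (x * cis (- \<theta>s)) \<and> cmod x < r0 * exp d}"

lemma open_sector: "open sector"
  unfolding sector_def by (intro open_Collect_conj open_Collect_less continuous_intros)

lemma sector_nonzero: "x \<in> sector \<Longrightarrow> x \<noteq> 0"
  by (auto simp: sector_def)

lemma rr_sx: "x \<noteq> 0 \<Longrightarrow> rr (sx x) = cmod x"
  using r0 by (simp add: rr_def sx_def exp_diff exp_minus)

lemma sx_greater: "x \<in> sector \<Longrightarrow> sx x > - d"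
proof -
  assume x: "x \<in> sector"
  then have "ln (cmod x) < ln (r0 * exp d)"
    using r0 sector_nonzero[OF x] by (subst ln_less_cancel_iff) (auto simp: sector_def)
  then show ?thesis using r0 by (simp add: sx_def ln_mult)
qed

lemma polar_sx: "x \<in> sector \<Longrightarrow> x = rr (sx x) * cis (arg_near \<theta>s x)"
  using arg_near_polar[of x \<theta>s] sector_nonzero rr_sx by simp

lemma pos_sector: "s > - d \<Longrightarrow> pos s \<in> sector"
proof -
  assume s: "s > - d"
  have "pos s * cis (- \<theta>s) = rr s * cis (\<theta> s - \<theta>s)" by (simp add: pos_def mult.assoc cis_mult)
  moreover have "cos (\<theta> s - \<theta>s) > 0" using near(1)[OF s] \<delta> by (intro cos_gt_zero_pi) auto
  ultimately have "Re (pos s * cis (- \<theta>s)) > 0" using rr_pos[of s] by (simp only:) simp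
  then show ?thesis using rr_less[OF s] by (simp add: sector_def pos_norm)
qed

lemma sx_pos: "sx (pos s) = s"
  using r0 by (simp add: sx_def pos_norm rr_def ln_mult)

lemma \<Delta>_pos: "s > - d \<Longrightarrow> \<Delta> (pos s) = 0"
  using near(1)[of s] \<delta> arg_near_eq[OF rr_pos, of "\<theta> s" \<theta>s s] by (simp add: \<Delta>_def sx_pos) (simp add: pos_def)

lemma W_pos: "s > - d \<Longrightarrow> W (pos s) = S s"
  by (simp add: W_def \<Delta>_pos sx_pos)

lemma \<Delta>_zero: "x \<in> sector \<Longrightarrow> \<Delta> x = 0 \<Longrightarrow> x = pos (sx x)"
  using polar_sx[of x] by (simp add: \<Delta>_def pos_def)

lemma sx_continuous: "continuous_on sector sx"
  unfolding sx_def[abs_def] by (intro continuous_intros) (auto dest: sector_nonzero)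

lemma \<Delta>_continuous: "continuous_on sector \<Delta>"
  unfolding \<Delta>_def[abs_def]
proof (intro continuous_intros)
  show "continuous_on sector (arg_near \<theta>s)"
    using has_derivative_arg_near has_derivative_continuous
    by (intro continuous_at_imp_continuous_on ballI) (fastforce simp: sector_def)
  show "continuous_on sector (\<lambda>x. \<theta> (sx x))"
    by (rule continuous_on_compose2[OF continuous_along_ray(1) sx_continuous]) (auto dest: sx_greater)
qed

lemma A_continuous: "continuous_on sector A"
proof -
  have *: "continuous_on sector (\<lambda>x. f (sx x))" if "continuous_on {- d<..} f" for f :: "real \<Rightarrow> real"
    by (rule continuous_on_compose2[OF that sx_continuous]) (auto dest: sx_greater)
  have U: "continuous_on sector (\<lambda>x. U1 (\<theta> (sx x)))"
    by (rule continuous_on_compose2[OF U1_continuous[of UNIV] *[OF continuous_along_ray(1)]]) auto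
  have "q (sx x) \<noteq> 0" "Fs (sx x) \<noteq> 0" "x \<noteq> 0" if "x \<in> sector" for x
    using q_pos[of "sx x"] Fs_pos[OF sx_greater[OF that]] sector_nonzero[OF that] by auto
  then show ?thesis
    unfolding A_def[abs_def] Ws_def P_def
    by (intro continuous_intros *[OF continuous_along_ray(2)] *[OF continuous_along_ray(3)]
      *[OF continuous_along_ray(4)] *[OF continuous_along_ray(5)] U \<Delta>_continuous) auto
qed

text \<open>Explains the formula for \<open>Ws\<close>: the derivative of \<open>W\<close> in
  \<open>s\<close> is \<open>- G * q + P * p\<close> plus the derivative of \<open>P\<close> times
  \<open>\<Delta>\<close>. The first two terms combine to \<open>- G / q\<close> because
  \<open>q\<^sup>2 - p\<^sup>2 = 1\<close>, and \<open>P_deriv\<close> gives the rest.\<close>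

lemma W_derivative:
  assumes x: "x \<in> sector"
  shows "(W has_derivative (\<lambda>y. Re (A x * y))) (at x)"
proof -
  let ?s = "sx x"
  have s: "?s > - d" by (rule sx_greater[OF x])
  have sx': "(sx has_derivative (\<lambda>y. - Re (y / x))) (at x)"
    unfolding sx_def[abs_def]
    using has_derivative_diff[OF has_derivative_const[of "ln r0"] has_derivative_ln_cmod[OF sector_nonzero[OF x]]] by simp
  have comp: "((\<lambda>y. f (sx y)) has_derivative (\<lambda>y. f' * - Re (y / x))) (at x)"
    if "(f has_real_derivative f') (at ?s)" for f f'
    using has_derivative_compose[OF sx' that[unfolded has_field_derivative_def]] by simp
  have arg': "(arg_near \<theta>s has_derivative (\<lambda>y. Im (y / x))) (at x)"
    by (rule has_derivative_arg_near) (use x in \<open>simp add: sector_def\<close>)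
  have "(\<Delta> has_derivative (\<lambda>y. Im (y / x) - - p ?s * - Re (y / x))) (at x)"
    unfolding \<Delta>_def[abs_def] by (intro has_derivative_diff arg' comp \<theta>_deriv s)
  from has_derivative_add[OF comp[OF S_deriv[OF s]] has_derivative_mult[OF comp[OF P_deriv[OF s]] this]]
  have "(W has_derivative (\<lambda>y. - (G ?s * q ?s) * - Re (y / x) +
      (P ?s * (Im (y / x) - - p ?s * - Re (y / x)) +
        - (G ?s * U1 (\<theta> ?s) / (2 * Fs ?s)) * q ?s * - Re (y / x) * \<Delta> x))) (at x)"
    unfolding W_def[abs_def] .
  moreover have "- (G ?s * q ?s) * - Re (y / x) +
      (P ?s * (Im (y / x) - - p ?s * - Re (y / x)) +
        - (G ?s * U1 (\<theta> ?s) / (2 * Fs ?s)) * q ?s * - Re (y / x) * \<Delta> x) = Re (A x * y)" for y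
  proof -
    have "G ?s * q ?s - P ?s * p ?s = G ?s * ((q ?s)\<^sup>2 - (p ?s)\<^sup>2) / q ?s"
      using q_pos[of ?s] by (simp add: P_def field_simps power2_eq_square)
    then have Gq: "G ?s * q ?s - P ?s * p ?s = G ?s / q ?s" by (simp add: q_square)
    have "A x * y = - ((Ws x + \<i> * P ?s) * (y / x))" by (simp add: A_def)
    then have "Re (A x * y) = - (Ws x * Re (y / x)) + P ?s * Im (y / x)" by (simp del: times_divide_eq_right)
    also have "- Ws x = G ?s * q ?s - P ?s * p ?s + G ?s * U1 (\<theta> ?s) / (2 * Fs ?s) * q ?s * \<Delta> x"
      unfolding Gq Ws_def by simp
    then have "- (Ws x * Re (y / x)) = (G ?s * q ?s - P ?s * p ?s + G ?s * U1 (\<theta> ?s) / (2 * Fs ?s) * q ?s * \<Delta> x) * Re (y / x)"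
      by (metis mult_minus_left)
    finally show ?thesis by (simp only:) (simp add: algebra_simps)
  qed
  ultimately show ?thesis by (simp only:)
qed

text \<open>The terms of order one in \<open>\<Delta> x\<close> cancel thanks to the Euler--Lagrange
  equation. What remains is \<open>E\<close>: twice the Taylor remainder of \<open>Ua\<close>, at
  least \<open>k * (\<Delta> x)\<^sup>2\<close> by convexity, minus the square of the term that
  comes from the derivative of \<open>P\<close>. The assumption \<open>slope\<close> makes the first
  dominate.\<close>

lemma W_subsolution:
  assumes x: "x \<in> sector" and near_x: "\<bar>arg_near \<theta>s x - \<theta>s\<bar> < \<delta>"
  shows "(cmod (A x))\<^sup>2 \<le> 2 * (h + potential \<alpha> U x)"
    and "(cmod (A x))\<^sup>2 = 2 * (h + potential \<alpha> U x) \<Longrightarrow> \<Delta> x = 0"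
proof -
  let ?s = "sx x" and ?t = "arg_near \<theta>s x"
  define u where "u = U1 (\<theta> ?s)"
  define f where "f = Fs ?s"
  define E where "E = 2 * (Ua ?t - Ua (\<theta> ?s) - u * \<Delta> x) - u\<^sup>2 * (q ?s)\<^sup>2 * (\<Delta> x)\<^sup>2 / (2 * f)"
  have s: "?s > - d" by (rule sx_greater[OF x])
  have f: "f > 0" "2 * f \<ge> Ua \<theta>s" using Fs_pos[OF s] Fs_lower[OF s] by (auto simp: f_def)
  have r: "rr ?s > 0" "cmod x = rr ?s" by (simp_all add: rr_pos rr_sx[OF sector_nonzero[OF x]] sector_nonzero[OF x])
  have Ft: "F (rr ?s) ?t = f + (Ua ?t - Ua (\<theta> ?s))" by (simp add: f_def Fs_def F_def)
  have "2 * (h + potential \<alpha> U x) = rr ?s powr (- \<alpha>) * (2 * F (rr ?s) ?t)"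
    using shifted_potential_polar[OF r(1), of ?t] polar_sx[OF x] by simp
  also have "rr ?s powr (- \<alpha>) = rr ?s powr (2 * \<beta>) / (rr ?s)\<^sup>2"
  proof -
    have "rr ?s powr (- \<alpha>) * rr ?s powr 2 = rr ?s powr (2 * \<beta>)"
      by (simp add: \<beta>_def flip: powr_add)
    then have "rr ?s powr (- \<alpha>) * (rr ?s)\<^sup>2 = rr ?s powr (2 * \<beta>)"
      using r(1) by (simp add: powr_numeral)
    then show ?thesis using r(1) by (simp add: eq_divide_eq)
  qed
  finally have HV: "2 * (h + potential \<alpha> U x) = rr ?s powr (2 * \<beta>) * (2 * F (rr ?s) ?t) / (rr ?s)\<^sup>2" by simp
  have WG: "Ws x = - G ?s * (1 / q ?s + u / (2 * f) * q ?s * \<Delta> x)" by (simp add: Ws_def u_def f_def algebra_simps)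
  have PG: "P ?s = G ?s * (p ?s / q ?s)" by (simp add: P_def)
  have split: "(1 / q ?s + u / (2 * f) * q ?s * \<Delta> x)\<^sup>2 + (p ?s / q ?s)\<^sup>2 =
      1 + u / f * \<Delta> x + (u / (2 * f) * q ?s * \<Delta> x)\<^sup>2"
  proof -
    have "(1 / q ?s)\<^sup>2 + (p ?s / q ?s)\<^sup>2 = (1 + (p ?s)\<^sup>2) / (q ?s)\<^sup>2"
      by (simp add: power_divide add_divide_distrib)
    also have "\<dots> = 1" using q_pos[of ?s] by (simp flip: q_square)
    finally show ?thesis using q_pos[of ?s] by (simp add: power2_sum)
  qed
  have cA: "(cmod (A x))\<^sup>2 = ((Ws x)\<^sup>2 + (P ?s)\<^sup>2) / (rr ?s)\<^sup>2"
    using r(2) by (simp add: A_def norm_divide power_divide cmod_power2)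
  also have "(Ws x)\<^sup>2 + (P ?s)\<^sup>2 = (G ?s)\<^sup>2 * ((1 / q ?s + u / (2 * f) * q ?s * \<Delta> x)\<^sup>2 + (p ?s / q ?s)\<^sup>2)"
    unfolding WG PG power_mult_distrib power2_minus by (simp add: algebra_simps)
  also have "\<dots> = rr ?s powr (2 * \<beta>) * (2 * f * (1 + u / f * \<Delta> x + (u / (2 * f) * q ?s * \<Delta> x)\<^sup>2))"
    unfolding split G_square[OF s] f_def[symmetric] by simp
  also have "2 * f * (1 + u / f * \<Delta> x + (u / (2 * f) * q ?s * \<Delta> x)\<^sup>2) = 2 * F (rr ?s) ?t - E"
    unfolding Ft E_def using f by (simp add: field_simps power2_eq_square)
  finally have diff: "2 * (h + potential \<alpha> U x) - (cmod (A x))\<^sup>2 = rr ?s powr (2 * \<beta>) / (rr ?s)\<^sup>2 * E"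
    unfolding HV by (simp add: algebra_simps diff_divide_distrib)
  have pos: "rr ?s powr (2 * \<beta>) / (rr ?s)\<^sup>2 > 0" using r(1) by simp
  \<comment> \<open>The subtracted constant comes from \<open>(q ?s)\<^sup>2 \<le> 2\<close>, valid
    for slopes of modulus at most 1, and from \<open>2 * f \<ge> Ua \<theta>s\<close>.\<close>
  define e where "e = k - 2 * u\<^sup>2 / Ua \<theta>s"
  have e: "e > 0" using slope[OF s] Ua_s_pos by (simp add: e_def u_def field_simps)
  have E: "E \<ge> e * (\<Delta> x)\<^sup>2"
  proof -
    have "2 * (Ua ?t - Ua (\<theta> ?s) - u * \<Delta> x) \<ge> k * (\<Delta> x)\<^sup>2"
      using Ua_tangent[OF near(1)[OF s] near_x] by (simp add: u_def \<Delta>_def)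
    moreover have "u\<^sup>2 * (q ?s)\<^sup>2 * (\<Delta> x)\<^sup>2 / (2 * f) \<le> 2 * u\<^sup>2 / Ua \<theta>s * (\<Delta> x)\<^sup>2"
    proof -
      have "\<bar>p ?s\<bar> \<le> 1" using near(2,3) s by fastforce
      then have "(q ?s)\<^sup>2 \<le> 2" by (simp add: q_square abs_square_le_1)
      then have "u\<^sup>2 * (q ?s)\<^sup>2 * (\<Delta> x)\<^sup>2 / (2 * f) \<le> u\<^sup>2 * 2 * (\<Delta> x)\<^sup>2 / Ua \<theta>s"
        using f Ua_s_pos by (intro frac_le mult_mono mult_left_mono) auto
      then show ?thesis by (simp add: mult_ac)
    qed
    ultimately show ?thesis by (simp add: E_def e_def left_diff_distrib)
  qed
  have "E \<ge> 0" using E e by (smt (verit) mult_nonneg_nonneg zero_le_power2)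
  then show "(cmod (A x))\<^sup>2 \<le> 2 * (h + potential \<alpha> U x)"
    using diff mult_nonneg_nonneg[OF less_imp_le[OF pos], of E] by linarith
  assume "(cmod (A x))\<^sup>2 = 2 * (h + potential \<alpha> U x)"
  then have "rr ?s powr (2 * \<beta>) / (rr ?s)\<^sup>2 * E = 0" using diff by linarith
  then have "E = 0" using pos by (metis less_irrefl mult_eq_0_iff)
  then have "e * (\<Delta> x)\<^sup>2 \<le> 0" using E by simp
  then show "\<Delta> x = 0" using e by (smt (verit) mult_pos_pos zero_less_power2)
qed

text \<open>\<open>W\<close> counts the action still to be spent, so on the ray its gradient is
  opposite to the velocity.\<close>

lemma A_pos:
  assumes s: "s > - d"
  shows "- cnj (A (pos s)) = vel s"
proof -
  have A: "(2 * Fs s) \<ge> 0" using Fs_pos[OF s] by simp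
  have r: "rr s powr (- \<alpha> / 2) * rr s = rr s powr \<beta>"
    using rr_pos[of s] powr_add[of "rr s" "- \<alpha> / 2" 1] by (simp add: \<beta>_def)
  have "Ws (pos s) = - (G s / q s)" by (simp add: Ws_def sx_pos \<Delta>_pos s)
  moreover have "A (pos s) * pos s = - (Ws (pos s) + \<i> * P s)"
    using pos_nonzero[of s] by (simp add: A_def sx_pos)
  ultimately have "A (pos s) * pos s = of_real (G s / q s) * (1 - \<i> * p s)"
    by (simp add: P_def algebra_simps diff_divide_distrib)
  moreover have "- cnj (vel s) * pos s = of_real (G s / q s) * (1 - \<i> * p s)"
  proof -
    have "cis (- \<theta> s) * cis (\<theta> s) = 1" by (simp add: cis_mult)
    then have "- cnj (vel s) * pos s =
        of_real (sqrt (2 * Fs s) * rr s powr (- \<alpha> / 2) / q s) * of_real (rr s) * (1 - \<i> * p s)"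
      by (simp add: vel_def pos_def cis_cnj mult_ac del: of_real_mult of_real_divide)
    also have "of_real (sqrt (2 * Fs s) * rr s powr (- \<alpha> / 2) / q s) * complex_of_real (rr s) = of_real (G s / q s)"
      unfolding G_def r[symmetric] of_real_mult[symmetric] by (simp add: mult_ac)
    finally show ?thesis .
  qed
  ultimately have "A (pos s) * pos s = - cnj (vel s) * pos s" by simp
  then have "A (pos s) = - cnj (vel s)" using pos_nonzero[of s] mult_right_cancel by blast
  then show ?thesis by simp
qed

text \<open>A bound of \<open>W\<close> divided by \<open>r powr \<beta>\<close> on the closed
  sector of opening \<open>\<delta>\<close>: the first summand bounds \<open>S\<close>, the second
  the product of \<open>P\<close> and \<open>\<Delta>\<close>, where \<open>\<Delta>\<close> is at
  most \<open>2 * \<delta>\<close>.\<close>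

definition W_bound :: real where
  "W_bound = sqrt (2 * Ub) * sqrt (1 + pb\<^sup>2) / \<beta> + sqrt (2 * Ub) * pb * (2 * \<delta>)"

lemma W_upper:
  assumes x: "x \<in> sector" and near_x: "\<bar>arg_near \<theta>s x - \<theta>s\<bar> \<le> \<delta>"
  shows "\<bar>W x\<bar> \<le> cmod x powr \<beta> * W_bound"
proof -
  let ?s = "sx x"
  have s: "?s > - d" by (rule sx_greater[OF x])
  have r: "rr ?s = cmod x" by (rule rr_sx[OF sector_nonzero[OF x]])
  have "\<bar>S ?s\<bar> \<le> cmod x powr \<beta> * (sqrt (2 * Ub) * sqrt (1 + pb\<^sup>2) / \<beta>)"
    using S_tail(2)[of ?s] s by (simp add: S_def flip: r) (simp add: rr_powr mult_ac)
  moreover have "\<bar>P ?s\<bar> \<le> cmod x powr \<beta> * (sqrt (2 * Ub) * pb)"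
  proof -
    have "\<bar>P ?s\<bar> = G ?s * \<bar>p ?s\<bar> / q ?s" using G_pos[OF s] q_pos[of ?s] by (simp add: P_def abs_mult)
    also have "\<dots> \<le> G ?s * pb / 1"
      using G_pos[OF s] q_ge_1[of ?s] near(2)[OF s] pb_nonneg by (intro frac_le mult_left_mono mult_nonneg_nonneg) auto
    also have "\<dots> \<le> (cmod x powr \<beta> * sqrt (2 * Ub)) * pb"
      unfolding G_def r using Fs_upper[OF s] pb_nonneg by (auto intro!: mult_right_mono mult_left_mono)
    finally show ?thesis by (simp add: mult_ac)
  qed
  moreover have "\<bar>\<Delta> x\<bar> \<le> 2 * \<delta>" using near(1)[OF s] near_x by (simp add: \<Delta>_def)
  ultimately have "\<bar>S ?s\<bar> + \<bar>P ?s\<bar> * \<bar>\<Delta> x\<bar> \<le> cmod x powr \<beta> * (sqrt (2 * Ub) * sqrt (1 + pb\<^sup>2) / \<beta>) +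
      (cmod x powr \<beta> * (sqrt (2 * Ub) * pb)) * (2 * \<delta>)"
    by (intro add_mono mult_mono) auto
  moreover have "\<bar>W x\<bar> \<le> \<bar>S ?s\<bar> + \<bar>P ?s\<bar> * \<bar>\<Delta> x\<bar>"
    unfolding W_def abs_mult[symmetric] by (rule abs_triangle_ineq)
  ultimately show ?thesis by (simp add: W_bound_def algebra_simps)
qed

end

text \<open>
  Paths leaving the sector \<open>\<bar>\<theta> - \<theta>s\<bar> < \<delta>\<close> are estimated from the exit on by a second subsolution,
  of the form \<open>r powr \<beta> * (B + \<kappa> (cos (\<theta> - \<theta>s)))\<close>. It is defined for all angles and exceeds the
  calibration on the sides of the sector.
\<close>

locale calibrated_ray = collision_ray +
  fixes \<kappa> \<kappa>' :: "real \<Rightarrow> real"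
  assumes \<kappa>_deriv: "\<And>c. (\<kappa> has_real_derivative \<kappa>' c) (at c)"
    and \<kappa>'_continuous: "continuous_on UNIV \<kappa>'" and \<kappa>_nonneg: "\<And>c. \<kappa> c \<ge> 0"
    and hump: "\<And>t. 2 * \<beta> * sqrt (2 * Ua \<theta>s) * \<kappa> (cos (t - \<theta>s)) + (\<beta> * \<kappa> (cos (t - \<theta>s)))\<^sup>2 +
      (\<kappa>' (cos (t - \<theta>s)) * sin (t - \<theta>s))\<^sup>2 \<le> 2 * (Ua t - Ua \<theta>s)"
    and side: "W_bound < sqrt (2 * F (r0 * exp d) \<theta>s) / \<beta> + \<kappa> (cos \<delta>)"
begin

text \<open>The function \<open>B * r powr \<beta>\<close> has a gradient of norm
  \<open>r powr (- \<alpha> / 2)\<close> times the square root of the least value of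
  \<open>2 * F\<close> on the disc of radius \<open>r0 * exp d\<close>: since \<open>h < 0\<close>,
  \<open>F\<close> is smallest at the outer radius and at the minimum of \<open>U\<close>.\<close>

definition B :: real where "B = sqrt (2 * F (r0 * exp d) \<theta>s) / \<beta>"
text \<open>The cosine of the angle to the direction \<open>\<theta>s\<close>, written without a
  branch of the angle. Hence \<open>W3\<close> is differentiable on the whole punctured plane, and
  paths winding round the origin need no special treatment.\<close>

definition cx :: "complex \<Rightarrow> real" where "cx x = Re (x * cis (- \<theta>s)) / cmod x"
definition W3 :: "complex \<Rightarrow> real" where "W3 x = cmod x powr \<beta> * (B + \<kappa> (cx x))"
definition A3 :: "complex \<Rightarrow> complex" where
  "A3 x = cmod x powr \<beta> * (\<beta> * (B + \<kappa> (cx x)) + \<i> * (\<kappa>' (cx x) * (Im (x * cis (- \<theta>s)) / cmod x))) / x"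

lemma r0_le: "r0 \<le> r0 * exp d" using r0 d by simp

lemma B_pos: "B > 0"
  unfolding B_def using F_pos[of "r0 * exp d" \<theta>s] r0 \<beta> by simp

lemma polar_quotients:
  assumes "r > 0"
  shows "cx (complex_of_real r * cis t) = cos (t - \<theta>s)"
    and "Im (complex_of_real r * cis t * cis (- \<theta>s)) / cmod (complex_of_real r * cis t) = sin (t - \<theta>s)"
proof -
  have "complex_of_real r * cis t * cis (- \<theta>s) = r * cis (t - \<theta>s)" by (simp add: mult.assoc cis_mult)
  then have *: "Re (complex_of_real r * cis t * cis (- \<theta>s)) = r * cos (t - \<theta>s)"
    "Im (complex_of_real r * cis t * cis (- \<theta>s)) = r * sin (t - \<theta>s)"
    by (simp_all only:) simp_all
  show "cx (complex_of_real r * cis t) = cos (t - \<theta>s)"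
    unfolding cx_def *(1) using assms by (simp add: norm_mult)
  show "Im (complex_of_real r * cis t * cis (- \<theta>s)) / cmod (complex_of_real r * cis t) = sin (t - \<theta>s)"
    unfolding *(2) using assms by (simp add: norm_mult)
qed

lemma A3_continuous: "continuous_on (- {0}) A3"
proof -
  have cx: "continuous_on (- {0}) cx" unfolding cx_def[abs_def] by (intro continuous_intros) auto
  have "continuous_on UNIV \<kappa>" using \<kappa>_deriv DERIV_isCont by (intro continuous_at_imp_continuous_on) blast
  then have "continuous_on (- {0}) (\<lambda>x. \<kappa> (cx x))" by (rule continuous_on_compose2[OF _ cx]) auto
  moreover have "continuous_on (- {0}) (\<lambda>x. \<kappa>' (cx x))"
    by (rule continuous_on_compose2[OF \<kappa>'_continuous cx]) auto
  ultimately show ?thesis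
    unfolding A3_def[abs_def] by (intro continuous_intros) auto
qed

lemma W3_derivative:
  assumes x: "x \<noteq> 0"
  shows "(W3 has_derivative (\<lambda>y. Re (A3 x * y))) (at x)"
proof -
  define t where "t = arg_near 0 x"
  have xt: "x = complex_of_real (cmod x) * cis t" unfolding t_def by (rule arg_near_polar[OF x])
  have r: "cmod x > 0" using x by simp
  have c: "cx x = cos (t - \<theta>s)" "Im (x * cis (- \<theta>s)) / cmod x = sin (t - \<theta>s)"
    using polar_quotients[OF r, of t] xt by auto
  have "(W3 has_derivative (\<lambda>y. (\<beta> * exp (\<beta> * ln (cmod x))) * (B + \<kappa> (cos (t - \<theta>s))) * Re (y / x) +
      exp (\<beta> * ln (cmod x)) * (\<kappa>' (cos (t - \<theta>s)) * - sin (t - \<theta>s)) * Im (y / x))) (at x)"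
  proof (rule has_derivative_polar[OF x, where t = t and ?d1.0 = "\<beta> * exp (\<beta> * ln (cmod x))"
        and ?d2.0 = "\<kappa>' (cos (t - \<theta>s)) * - sin (t - \<theta>s)"])
    show "W3 (complex_of_real (exp \<rho>) * cis \<theta>) = exp (\<beta> * \<rho>) * (B + \<kappa> (cos (\<theta> - \<theta>s)))" for \<rho> \<theta>
      unfolding W3_def polar_quotients(1)[OF exp_gt_zero] by (simp add: norm_mult exp_powr_real mult.commute)
    show "((\<lambda>\<rho>. exp (\<beta> * \<rho>)) has_real_derivative \<beta> * exp (\<beta> * ln (cmod x))) (at (ln (cmod x)))"
      by (auto intro!: derivative_eq_intros)
    have "((\<lambda>\<theta>. cos (\<theta> - \<theta>s)) has_real_derivative - sin (t - \<theta>s)) (at t)"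
      by (auto intro!: derivative_eq_intros)
    from DERIV_chain2[OF \<kappa>_deriv this]
    show "((\<lambda>\<theta>. B + \<kappa> (cos (\<theta> - \<theta>s))) has_real_derivative \<kappa>' (cos (t - \<theta>s)) * - sin (t - \<theta>s)) (at t)"
      by (auto intro!: derivative_eq_intros)
  qed (rule xt)
  moreover have "(\<beta> * exp (\<beta> * ln (cmod x))) * (B + \<kappa> (cos (t - \<theta>s))) * Re (y / x) +
      exp (\<beta> * ln (cmod x)) * (\<kappa>' (cos (t - \<theta>s)) * - sin (t - \<theta>s)) * Im (y / x) = Re (A3 x * y)" for y
  proof -
    have "A3 x * y = complex_of_real (cmod x powr \<beta>) *
        ((\<beta> * (B + \<kappa> (cx x)) + \<i> * (\<kappa>' (cx x) * (Im (x * cis (- \<theta>s)) / cmod x))) * (y / x))"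
      by (simp add: A3_def)
    also have "\<dots> = complex_of_real (cmod x powr \<beta>) *
        ((of_real (\<beta> * (B + \<kappa> (cos (t - \<theta>s)))) + \<i> * of_real (\<kappa>' (cos (t - \<theta>s)) * sin (t - \<theta>s))) * (y / x))"
      unfolding c by simp
    finally have "A3 x * y = complex_of_real (cmod x powr \<beta>) *
        ((of_real (\<beta> * (B + \<kappa> (cos (t - \<theta>s)))) + \<i> * of_real (\<kappa>' (cos (t - \<theta>s)) * sin (t - \<theta>s))) * (y / x))" .
    moreover have "Re (complex_of_real l * ((of_real m + \<i> * of_real n) * z)) = l * (m * Re z - n * Im z)" for l m n z
      by (simp add: algebra_simps)
    ultimately have "Re (A3 x * y) = cmod x powr \<beta> *
        (\<beta> * (B + \<kappa> (cos (t - \<theta>s))) * Re (y / x) - \<kappa>' (cos (t - \<theta>s)) * sin (t - \<theta>s) * Im (y / x))"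
      by (simp only:)
    also have "cmod x powr \<beta> = exp (\<beta> * ln (cmod x))" using r by (simp add: powr_def)
    finally show ?thesis by (simp add: algebra_simps)
  qed
  ultimately show ?thesis by (simp only:)
qed

text \<open>The radial part alone satisfies the inequality with room
  \<open>2 * (Ua t - Ua \<theta>s)\<close>. Squaring the sum adds a cross term, controlled by
  \<open>\<beta> * B \<le> sqrt (2 * Ua \<theta>s)\<close>, and the squares of the hump terms;
  \<open>hump\<close> states that all of them fit into this room.\<close>

lemma W3_subsolution:
  assumes x: "x \<noteq> 0" "cmod x \<le> r0 * exp d"
  shows "(cmod (A3 x))\<^sup>2 \<le> 2 * (h + potential \<alpha> U x)"
proof -
  define t where "t = arg_near 0 x"
  define r where "r = cmod x"
  define X where "X = \<kappa> (cos (t - \<theta>s))"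
  define Y where "Y = \<kappa>' (cos (t - \<theta>s)) * sin (t - \<theta>s)"
  have xt: "x = complex_of_real r * cis t" unfolding t_def r_def by (rule arg_near_polar[OF x(1)])
  have r: "r > 0" "r \<le> r0 * exp d" using x by (auto simp: r_def)
  have c: "cx x = cos (t - \<theta>s)" "Im (x * cis (- \<theta>s)) / cmod x = sin (t - \<theta>s)"
    using polar_quotients[OF r(1), of t] xt by auto
  have F0: "F (r0 * exp d) \<theta>s > 0" using F_pos[of "r0 * exp d" \<theta>s] r0 by simp
  have hr: "h * r powr \<alpha> \<ge> h * (r0 * exp d) powr \<alpha>" using r h \<alpha> by (intro mult_left_mono_neg powr_mono2) auto
  have B2: "(\<beta> * B)\<^sup>2 = 2 * F (r0 * exp d) \<theta>s" using \<beta> F0 by (simp add: B_def)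
  have "F (r0 * exp d) \<theta>s \<le> Ua \<theta>s" using h by (simp add: F_def mult_nonpos_nonneg)
  then have Bl: "\<beta> * B \<le> sqrt (2 * Ua \<theta>s)" using \<beta> by (simp add: B_def)
  have "cmod (A3 x) = r powr \<beta> * cmod (of_real (\<beta> * (B + X)) + \<i> * of_real Y) / r"
    unfolding A3_def c X_def Y_def norm_divide norm_mult[of "complex_of_real (cmod x powr \<beta>)"] r_def by simp
  then have "(cmod (A3 x))\<^sup>2 = (r powr \<beta>)\<^sup>2 / r\<^sup>2 * ((\<beta> * (B + X))\<^sup>2 + Y\<^sup>2)"
    by (simp add: power_mult_distrib power_divide cmod_power2)
  also have "(r powr \<beta>)\<^sup>2 / r\<^sup>2 = r powr (- \<alpha>)"
  proof -
    have "r powr (- \<alpha>) * r powr 2 = (r powr \<beta>)\<^sup>2"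
      by (simp add: \<beta>_def power2_eq_square flip: powr_add)
    then have "r powr (- \<alpha>) * r\<^sup>2 = (r powr \<beta>)\<^sup>2" using r by (simp add: powr_numeral)
    then show ?thesis using r by (simp add: divide_eq_eq)
  qed
  also have "r powr (- \<alpha>) * ((\<beta> * (B + X))\<^sup>2 + Y\<^sup>2) \<le> r powr (- \<alpha>) * (2 * F r t)"
  proof (rule mult_left_mono)
    have "X \<ge> 0" unfolding X_def by (rule \<kappa>_nonneg)
    have "(\<beta> * (B + X))\<^sup>2 = (\<beta> * B)\<^sup>2 + 2 * \<beta> * (\<beta> * B) * X + (\<beta> * X)\<^sup>2"
      by (simp add: power2_eq_square algebra_simps)
    also have "2 * \<beta> * (\<beta> * B) * X \<le> 2 * \<beta> * sqrt (2 * Ua \<theta>s) * X"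
      using Bl \<open>X \<ge> 0\<close> \<beta> by (intro mult_right_mono mult_left_mono) auto
    finally have "(\<beta> * (B + X))\<^sup>2 + Y\<^sup>2 \<le> 2 * F (r0 * exp d) \<theta>s + (2 * \<beta> * sqrt (2 * Ua \<theta>s) * X + (\<beta> * X)\<^sup>2 + Y\<^sup>2)"
      unfolding B2 by simp
    also have "\<dots> \<le> 2 * F (r0 * exp d) \<theta>s + 2 * (Ua t - Ua \<theta>s)"
      using hump[of t] by (simp add: X_def Y_def)
    also have "\<dots> \<le> 2 * F r t" using hr by (simp add: F_def)
    finally show "(\<beta> * (B + X))\<^sup>2 + Y\<^sup>2 \<le> 2 * F r t" .
  qed simp
  also have "\<dots> = 2 * (h + potential \<alpha> U x)"
    using shifted_potential_polar[OF r(1), of t] xt by simp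
  finally show ?thesis .
qed

text \<open>The strict gain made by switching subsolutions where a path leaves through a side of the
  sector.\<close>

lemma W_less_W3:
  assumes x: "x \<in> sector" and t: "\<bar>arg_near \<theta>s x - \<theta>s\<bar> = \<delta>"
  shows "W x < W3 x"
proof -
  have r: "cmod x > 0" using sector_nonzero[OF x] by simp
  have "cx x = cos (arg_near \<theta>s x - \<theta>s)"
    using polar_quotients(1)[OF r, of "arg_near \<theta>s x"] arg_near_polar[of x \<theta>s] sector_nonzero[OF x] by simp
  also have "\<dots> = cos \<delta>" using t by (metis cos_abs_real)
  finally have "W3 x = cmod x powr \<beta> * (B + \<kappa> (cos \<delta>))" by (simp add: W3_def)
  moreover have "cmod x powr \<beta> * W_bound < cmod x powr \<beta> * (B + \<kappa> (cos \<delta>))"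
    using side r by (intro mult_strict_left_mono) (auto simp: B_def)
  ultimately show ?thesis using W_upper[OF x] t by linarith
qed

lemma shifted_potential_pos:
  assumes "x \<noteq> 0" "cmod x \<le> r0"
  shows "h + potential \<alpha> U x > 0"
proof -
  have "h + potential \<alpha> U x = cmod x powr (- \<alpha>) * F (cmod x) (arg_near 0 x)"
    using shifted_potential_polar[of "cmod x" "arg_near 0 x"] arg_near_polar[OF assms(1), of 0] assms by simp
  moreover have "F (cmod x) (arg_near 0 x) > 0" using assms r0_le by (intro F_pos) auto
  ultimately show ?thesis using assms by simp
qed

end

text \<open>An admissible path of finite potential integral together with a free weight
  \<open>c\<close>. The integral of \<open>E\<close> will be \<open>c * kinetic u + Pt / c\<close>,
  where \<open>Pt\<close> is the integral of \<open>h + V\<close>; its minimum over \<open>c\<close>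
  is twice the square root of the functional.\<close>

locale competitor = calibrated_ray +
  fixes u v :: "real \<Rightarrow> complex" and c :: real
  assumes uv: "is_weak_deriv u v" and u_start: "u 0 = pos 0" and u_end: "u 1 = 0"
    and u_bound: "\<And>s. s \<in> {0..1} \<Longrightarrow> cmod (u s) \<le> r0" and c: "c > 0"
    and u_nonzero: "AE s in lborel. s \<in> {0..1} \<longrightarrow> u s \<noteq> 0"
    and V: "set_integrable lborel {0..1} (\<lambda>s. potential \<alpha> U (u s))"
begin

definition Q :: "real \<Rightarrow> real" where "Q s = h + potential \<alpha> U (u s)"
definition E :: "real \<Rightarrow> real" where "E s = c / 2 * (cmod (v s))\<^sup>2 + Q s / c"

lemma Q_integrable: "0 \<le> a \<Longrightarrow> b \<le> 1 \<Longrightarrow> set_integrable lborel {a..b} Q"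
  unfolding Q_def using V
  by (intro set_integral_add set_integrable_subset[OF V] borel_integrable_atLeastAtMost') auto

lemma E_integrable: "0 \<le> a \<Longrightarrow> b \<le> 1 \<Longrightarrow> set_integrable lborel {a..b} E"
  unfolding E_def
  using weak_deriv_set_integrable(3)[OF uv, of a b] Q_integrable[of a b]
  by (intro set_integral_add set_integrable_mult_right set_integrable_divide) auto

lemma E_split:
  assumes "0 \<le> a" "a \<le> b" "b \<le> e" "e \<le> 1"
  shows "(LINT s:{a..e}|lborel. E s) = (LINT s:{a..b}|lborel. E s) + (LINT s:{b..e}|lborel. E s)"
proof -
  have "integral {a..e} E = integral {a..b} E + integral {b..e} E"
    using Henstock_Kurzweil_Integration.integral_combine[of a b e E] assms
      set_borel_integral_eq_integral(1)[OF E_integrable[of a e]] by simp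
  then show ?thesis
    using assms set_borel_integral_eq_integral(2)[OF E_integrable] by simp
qed

lemma E_pos: "AE s in lborel. s \<in> {0..1} \<longrightarrow> E s > 0"
  using u_nonzero
proof eventually_elim
  case (elim s)
  show ?case
  proof
    assume s: "s \<in> {0..1}"
    then have "Q s > 0" using elim shifted_potential_pos u_bound by (simp add: Q_def)
    then show "E s > 0" using c by (simp add: E_def add_nonneg_pos)
  qed
qed

lemma E_integral_pos:
  assumes "0 \<le> a" "b \<le> 1"
  shows "0 \<le> (LINT s:{a..b}|lborel. E s)" and "a < b \<Longrightarrow> 0 < (LINT s:{a..b}|lborel. E s)"
proof -
  have AE: "AE s in lborel. 0 \<le> indicat_real {a..b} s *\<^sub>R E s"
    using E_pos by eventually_elim (use assms in \<open>auto simp: indicator_def\<close>)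
  then show nonneg: "0 \<le> (LINT s:{a..b}|lborel. E s)"
    unfolding set_lebesgue_integral_def by (rule integral_nonneg_AE)
  assume "a < b"
  show "0 < (LINT s:{a..b}|lborel. E s)"
  proof (rule ccontr)
    assume "\<not> ?thesis"
    then have "(LINT s:{a..b}|lborel. E s) = 0" using nonneg by simp
    then have "AE s in lborel. indicat_real {a..b} s *\<^sub>R E s = 0"
      using integral_nonneg_eq_0_iff_AE[OF _ AE] E_integrable[OF assms]
      by (simp add: set_lebesgue_integral_def set_integrable_def)
    with E_pos have "AE s in lborel. s \<notin> {a..b}"
      by eventually_elim (use assms in \<open>auto simp: indicator_def\<close>)
    then have "{a..b} \<in> null_sets lborel" using AE_iff_null_sets[of "{a..b}" lborel] by simp
    then show False using \<open>a < b\<close> by (simp add: null_sets_def)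
  qed
qed

lemma u_continuous: "continuous_on {0..1} u" by (rule path_continuous[OF uv])

definition wedge :: "complex set" where "wedge = {x \<in> sector. \<bar>arg_near \<theta>s x - \<theta>s\<bar> < \<delta>}"

lemma arg_continuous: "continuous_on sector (arg_near \<theta>s)"
  using has_derivative_arg_near has_derivative_continuous
  by (intro continuous_at_imp_continuous_on ballI) (fastforce simp: sector_def)

lemma open_wedge: "open wedge"
proof -
  have "open (sector \<inter> (\<lambda>x. \<bar>arg_near \<theta>s x - \<theta>s\<bar>) -` {..<\<delta>})"
    by (intro continuous_open_preimage open_sector open_lessThan continuous_intros arg_continuous)
  also have "sector \<inter> (\<lambda>x. \<bar>arg_near \<theta>s x - \<theta>s\<bar>) -` {..<\<delta>} = wedge"
    by (auto simp: wedge_def)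
  finally show ?thesis .
qed

lemma first_time_outside:
  fixes D :: "complex set"
  assumes D: "open D" "0 \<notin> D" and a: "0 \<le> a" "a < 1" "u a \<in> D"
  obtains b where "a < b" "b \<le> 1" "u b \<notin> D" "\<And>s. s \<in> {a..<b} \<Longrightarrow> u s \<in> D"
proof -
  have cont: "continuous_on {a..1} u" by (rule continuous_on_subset[OF u_continuous]) (use a in auto)
  have "closed ({a..1} \<inter> u -` (- D))"
    by (rule continuous_closed_preimage[OF cont]) (use D in auto)
  then have "compact ({a..1} \<inter> u -` (- D))"
    by (metis compact_Icc compact_Int_closed inf.left_idem inf_le1 closed_Int_compact)
  moreover have "1 \<in> {a..1} \<inter> u -` (- D)" using a u_end D by auto
  then have "{a..1} \<inter> u -` (- D) \<noteq> {}" by blast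
  ultimately obtain b where b: "b \<in> {a..1} \<inter> u -` (- D)" "\<forall>s\<in>{a..1} \<inter> u -` (- D). b \<le> s"
    using compact_attains_inf by blast
  show ?thesis
  proof (rule that[of b])
    show "a < b" using b(1) a by (cases "a = b") auto
    show "u s \<in> D" if "s \<in> {a..<b}" for s using b that by force
  qed (use b in auto)
qed

text \<open>The subsolution inequality is asked for in the disc of radius \<open>r0\<close> only,
  because admissible paths never leave it.\<close>

lemma leg:
  assumes ab: "0 \<le> a" "a < b" "b \<le> 1" and D: "open D" "\<And>s. s \<in> {a..<b} \<Longrightarrow> u s \<in> D"
    and f: "\<And>x. x \<in> D \<Longrightarrow> (f has_derivative (\<lambda>y. Re (a' x * y))) (at x)" "continuous_on D a'"
    and sub: "\<And>x. x \<in> D \<Longrightarrow> cmod x \<le> r0 \<Longrightarrow> (cmod (a' x))\<^sup>2 \<le> 2 * (h + potential \<alpha> U x)"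
    and lim: "((\<lambda>s. f (u s)) \<longlongrightarrow> fb) (at_left b)"
  shows "calibrated_path u v a b c fb D f a' Q"
  by unfold_locales (use assms uv c u_bound Q_integrable in \<open>auto simp: Q_def\<close>)

lemma leg_estimate:
  assumes "calibrated_path u v a b c fb D f a' Q"
  shows "f (u a) - fb \<le> (LINT s:{a..b}|lborel. E s)"
  using calibrated_path.calibration[OF assms] unfolding calibrated_path.density_def[OF assms] E_def .

lemma u_tendsto: "0 < b \<Longrightarrow> b \<le> 1 \<Longrightarrow> (u \<longlongrightarrow> u b) (at_left b)"
proof -
  assume b: "0 < b" "b \<le> 1"
  then have "(u \<longlongrightarrow> u b) (at b within {0..1})" using u_continuous by (auto simp: continuous_on)
  then have "(u \<longlongrightarrow> u b) (at b within {0..b})" by (rule tendsto_within_subset) (use b in auto)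
  then show ?thesis using at_within_Icc_at_left[OF b(1)] by simp
qed

lemma powr_norm_tendsto:
  assumes "0 < b" "b \<le> 1" "u b = 0"
  shows "((\<lambda>s. cmod (u s) powr \<beta> * M) \<longlongrightarrow> 0) (at_left b)"
proof -
  have "((\<lambda>s. cmod (u s)) \<longlongrightarrow> 0) (at_left b)"
    using tendsto_norm[OF u_tendsto[OF assms(1,2)]] assms(3) by simp
  then have "((\<lambda>s. cmod (u s) powr \<beta>) \<longlongrightarrow> 0 powr \<beta>) (at_left b)"
    using \<beta> by (intro tendsto_powr' tendsto_const) auto
  from tendsto_mult_right[OF this, of M] show ?thesis by simp
qed

text \<open>The wedge can be left only through the origin or through a side: its outer arc has
  radius \<open>r0 * exp d > r0\<close>, out of reach of the path. At the origin the estimate by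
  \<open>W\<close> is complete, since \<open>W\<close> tends to 0 there. At a side,
  \<open>W3\<close> estimates the remaining path up to its first collision, and the jump from
  \<open>W\<close> to \<open>W3\<close> makes the total strictly larger than
  \<open>S 0\<close>.\<close>

lemma first_leg:
  obtains b where "0 < b" "b \<le> 1" "\<And>s. s \<in> {0..<b} \<Longrightarrow> u s \<in> wedge"
    and "u b = 0 \<and> calibrated_path u v 0 b c 0 wedge W A Q \<or> S 0 < (LINT s:{0..1}|lborel. E s)"
proof -
  have zero_wedge: "0 \<notin> wedge" by (simp add: wedge_def sector_def)
  have start: "u 0 \<in> wedge"
    using pos_sector[of 0] \<Delta>_pos[of 0] near(1)[of 0] d by (simp add: u_start wedge_def \<Delta>_def sx_pos)
  obtain b where b: "0 < b" "b \<le> 1" "u b \<notin> wedge" "\<And>s. s \<in> {0..<b} \<Longrightarrow> u s \<in> wedge"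
    using first_time_outside[OF open_wedge zero_wedge _ _ start] by auto
  have leg_W: "calibrated_path u v 0 b c fb wedge W A Q" if "((\<lambda>s. W (u s)) \<longlongrightarrow> fb) (at_left b)" for fb
    using b that W_derivative W_subsolution(1) A_continuous open_wedge
    by (intro leg) (auto simp: wedge_def intro: continuous_on_subset)
  have ev: "\<forall>\<^sub>F s in at_left b. s \<in> {0<..<b}" using b by (intro eventually_at_left_real)
  note lim = u_tendsto[OF b(1,2)]
  show ?thesis
  proof (rule that[OF b(1,2,4)])
    show "u b = 0 \<and> calibrated_path u v 0 b c 0 wedge W A Q \<or> S 0 < (LINT s:{0..1}|lborel. E s)"
    proof (cases "u b = 0")
      case True
      have "norm (W (u s)) \<le> cmod (u s) powr \<beta> * W_bound" if "s \<in> {0<..<b}" for s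
        using b(4)[of s] that W_upper[of "u s"] by (simp add: wedge_def)
      from Lim_null_comparison[OF eventually_mono[OF ev this] powr_norm_tendsto[OF b(1,2) True]]
      have "((\<lambda>s. W (u s)) \<longlongrightarrow> 0) (at_left b)" .
      then show ?thesis using leg_W True by blast
    next
      case False
      let ?x = "u b"
      \<comment> \<open>The cone condition is closed, hence survives in the limit; as
        \<open>\<delta> < pi / 2\<close>, it keeps the exit point inside the open half-plane, where
        the angle is continuous.\<close>
      have near_s: "Re (u s * cis (- \<theta>s)) \<ge> cmod (u s) * cos \<delta>" if "s \<in> {0<..<b}" for s
      proof -
        have us: "u s \<in> wedge" using b that by auto
        define t where "t = arg_near \<theta>s (u s)"
        have "u s = complex_of_real (cmod (u s)) * cis t"
          unfolding t_def using us zero_wedge by (intro arg_near_polar) auto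
        then have "u s * cis (- \<theta>s) = complex_of_real (cmod (u s)) * cis (t - \<theta>s)"
          by (metis cis_mult diff_conv_add_uminus mult.assoc)
        then have "Re (u s * cis (- \<theta>s)) = cmod (u s) * cos \<bar>t - \<theta>s\<bar>" by (simp only:) simp
        also have "\<dots> \<ge> cmod (u s) * cos \<delta>"
          using us \<delta> pi_gt_zero by (intro mult_left_mono cos_monotone_0_pi_le) (auto simp: t_def wedge_def)
        finally show ?thesis .
      qed
      have "cmod ?x * cos \<delta> \<le> Re (?x * cis (- \<theta>s))"
        by (rule tendsto_le[OF _ tendsto_Re[OF tendsto_mult_right[OF lim]] tendsto_mult_right[OF tendsto_norm[OF lim]]])
          (use near_s eventually_mono[OF ev] in auto)
      moreover have "cmod ?x * cos \<delta> > 0" using False \<delta> by (simp add: cos_gt_zero_pi)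
      ultimately have x: "?x \<in> sector"
        using u_bound[of b] b r0_le r0 d by (auto simp: sector_def intro: le_less_trans)
      have "isCont (arg_near \<theta>s) ?x"
        using arg_continuous open_sector x continuous_on_eq_continuous_at by blast
      from isCont_tendsto_compose[OF this lim]
      have "((\<lambda>s. \<bar>arg_near \<theta>s (u s) - \<theta>s\<bar>) \<longlongrightarrow> \<bar>arg_near \<theta>s ?x - \<theta>s\<bar>) (at_left b)"
        by (intro tendsto_intros)
      then have "\<bar>arg_near \<theta>s ?x - \<theta>s\<bar> \<le> \<delta>"
        by (rule tendsto_upperbound) (use b in \<open>auto intro!: eventually_mono[OF ev] simp: wedge_def less_imp_le\<close>)
      then have side_x: "\<bar>arg_near \<theta>s ?x - \<theta>s\<bar> = \<delta>" using b(3) x by (auto simp: wedge_def)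
      have "((\<lambda>s. W (u s)) \<longlongrightarrow> W ?x) (at_left b)"
        using isCont_tendsto_compose[OF has_derivative_continuous[OF W_derivative[OF x]] lim] .
      from leg_estimate[OF leg_W[OF this]] have leg1: "W (u 0) - W ?x \<le> (LINT s:{0..b}|lborel. E s)" .
      have "b < 1" using b False u_end by (cases "b = 1") auto
      \<comment> \<open>The path may collide before time 1. The second estimate stops at the first
        collision \<open>e\<close>, and the density on \<open>{e..1}\<close> contributes a
        nonnegative amount.\<close>
      obtain e where e: "b < e" "e \<le> 1" "u e \<notin> - {0}" "\<And>s. s \<in> {b..<e} \<Longrightarrow> u s \<in> - {0}"
        using first_time_outside[of "- {0}" b] b \<open>b < 1\<close> False by auto
      have "continuous_on UNIV \<kappa>" using \<kappa>_deriv DERIV_isCont by (intro continuous_at_imp_continuous_on) blast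
      then have "continuous_on {-1..1} \<kappa>" by (rule continuous_on_subset) auto
      then obtain M where M: "\<And>y. y \<in> {-1..1} \<Longrightarrow> \<bar>\<kappa> y\<bar> \<le> M"
        using compact_continuous_image[of "{-1..1}" \<kappa>] compact_imp_bounded bounded_iff
        by (metis compact_Icc imageI real_norm_def)
      have W3_le: "norm (W3 y) \<le> cmod y powr \<beta> * (B + M)" if "y \<noteq> 0" for y
      proof -
        have "cx y = cos (arg_near 0 y - \<theta>s)"
          using polar_quotients(1)[of "cmod y" "arg_near 0 y"] arg_near_polar[OF that, of 0] that by simp
        then have "\<bar>\<kappa> (cx y)\<bar> \<le> M" by (intro M) auto
        then show ?thesis using B_pos by (auto simp: W3_def abs_mult intro!: mult_left_mono)
      qed
      have W3_u: "norm (W3 (u s)) \<le> cmod (u s) powr \<beta> * (B + M)" if "s \<in> {b<..<e}" for s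
        using e(4)[of s] that W3_le by simp
      have "((\<lambda>s. cmod (u s) powr \<beta> * (B + M)) \<longlongrightarrow> 0) (at_left e)"
        by (rule powr_norm_tendsto) (use e b in auto)
      from Lim_null_comparison[OF eventually_mono[OF eventually_at_left_real[OF e(1)] W3_u] this]
      have "((\<lambda>s. W3 (u s)) \<longlongrightarrow> 0) (at_left e)" .
      then have "calibrated_path u v b e c 0 (- {0}) W3 A3 Q"
        using e b W3_derivative W3_subsolution[OF _ order_trans[OF _ r0_le]] A3_continuous by (intro leg) auto
      from leg_estimate[OF this] have leg2: "W3 ?x \<le> (LINT s:{b..e}|lborel. E s)" by simp
      have "(LINT s:{0..1}|lborel. E s) =
          (LINT s:{0..b}|lborel. E s) + (LINT s:{b..e}|lborel. E s) + (LINT s:{e..1}|lborel. E s)"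
        using E_split[of 0 b 1] E_split[of b e 1] b e by simp
      then have "S 0 < (LINT s:{0..1}|lborel. E s)"
        using leg1 leg2 W_less_W3[OF x side_x] E_integral_pos(1)[of e 1] W_pos[of 0] b e d u_start by simp
      then show ?thesis ..
    qed
  qed
qed

theorem calibrated_lower_bound: "S 0 \<le> (LINT s:{0..1}|lborel. E s)"
proof -
  obtain b where b: "0 < b" "b \<le> 1"
    and *: "u b = 0 \<and> calibrated_path u v 0 b c 0 wedge W A Q \<or> S 0 < (LINT s:{0..1}|lborel. E s)"
    using first_leg by metis
  from * show ?thesis
  proof
    assume "u b = 0 \<and> calibrated_path u v 0 b c 0 wedge W A Q"
    from leg_estimate[OF conjunct2[OF this]] have "W (u 0) \<le> (LINT s:{0..b}|lborel. E s)" by simp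
    then show ?thesis
      using E_split[of 0 b 1] E_integral_pos(1)[of b 1] b W_pos[of 0] d by (simp add: u_start)
  qed simp
qed

text \<open>Equality excludes the side exit. It also excludes a collision before time 1, since the
  density has a positive integral over every interval of positive length; so the whole path is a
  calibrated leg and the equality case applies on \<open>{0..<1}\<close>.\<close>

theorem calibrated_equality:
  assumes eq: "(LINT s:{0..1}|lborel. E s) \<le> S 0" and s: "s \<in> {0..<1}"
  shows "u s \<in> sector" and "\<Delta> (u s) = 0"
    and "(u has_vector_derivative - cnj (A (u s)) / c) (at s within {0..<1})"
proof -
  obtain b where b: "0 < b" "b \<le> 1" "\<And>s. s \<in> {0..<b} \<Longrightarrow> u s \<in> wedge"
    and *: "u b = 0 \<and> calibrated_path u v 0 b c 0 wedge W A Q \<or> S 0 < (LINT s:{0..1}|lborel. E s)"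
    using first_leg by blast
  from * eq have path: "calibrated_path u v 0 b c 0 wedge W A Q" by linarith
  have W0: "W (u 0) = S 0" using W_pos[of 0] d by (simp add: u_start)
  have "(LINT s:{0..b}|lborel. E s) \<ge> S 0" using leg_estimate[OF path] W0 by simp
  moreover have "(LINT s:{0..1}|lborel. E s) = (LINT s:{0..b}|lborel. E s) + (LINT s:{b..1}|lborel. E s)"
    by (rule E_split) (use b(1,2) in simp_all)
  moreover have "b < 1 \<Longrightarrow> 0 < (LINT s:{b..1}|lborel. E s)"
    by (rule E_integral_pos(2)) (use b(1) in simp_all)
  ultimately have "b = 1" using eq b(2) by linarith
  note path = path[unfolded this] and b = b[unfolded this]
  have us: "u s \<in> wedge" using b s by auto
  then show "u s \<in> sector" by (simp add: wedge_def)
  have "(LINT s:{0..1}|lborel. calibrated_path.density v c Q s) \<le> W (u 0) - 0"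
    using eq W0 unfolding calibrated_path.density_def[OF path] E_def by simp
  moreover have "continuous_on {0..<1} Q"
  proof -
    have nz: "u r \<noteq> 0" if "r \<in> {0..<1}" for r
      using b(3)[OF that] sector_nonzero[of "u r"] by (simp add: wedge_def)
    have "continuous_on {0..<1} (\<lambda>s. potential \<alpha> U (u s))"
    proof (rule continuous_on_compose2[OF potential_continuous continuous_on_subset[OF u_continuous]])
      show "u ` {0..<1} \<subseteq> - {0}" using nz by fastforce
    qed auto
    then show ?thesis unfolding Q_def[abs_def] by (intro continuous_intros)
  qed
  ultimately have *: "(cmod (A (u s)))\<^sup>2 = 2 * Q s"
    "(u has_vector_derivative - cnj (A (u s)) / c) (at s within {0..<1})"
    using calibrated_path.calibration_equality[OF path _ _ s] by auto
  show "(u has_vector_derivative - cnj (A (u s)) / c) (at s within {0..<1})" by (rule *(2))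
  show "\<Delta> (u s) = 0"
    using W_subsolution(2)[of "u s"] us *(1) by (simp add: wedge_def Q_def)
qed

end

section \<open>Time changes\<close>

context collision_ray
begin

definition T :: real where "T = remaining 0"
definition elapsed :: "real \<Rightarrow> real" where "elapsed s = T - remaining s"

lemma elapsed_deriv: "s > - d \<Longrightarrow> (elapsed has_real_derivative dt s) (at s)"
  unfolding elapsed_def[abs_def] by (rule derivative_eq_intros remaining_deriv refl | simp)+

lemma elapsed_0: "elapsed 0 = 0" by (simp add: elapsed_def T_def)

lemma elapsed_strict_mono:
  assumes "- d < a" "a < b"
  shows "elapsed a < elapsed b"
proof (rule DERIV_pos_imp_increasing[OF assms(2)])
  fix x assume "a \<le> x" "x \<le> b"
  with assms have "x > - d" by simp
  from elapsed_deriv[OF this] dt_pos[OF this]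
  show "\<exists>y. (elapsed has_real_derivative y) (at x) \<and> y > 0" by blast
qed

lemma elapsed_limit: "(elapsed \<longlongrightarrow> T) at_top"
  unfolding elapsed_def[abs_def] using tendsto_diff[OF tendsto_const tail_limits(2), of T] by simp

lemma elapsed_less: "s > - d \<Longrightarrow> elapsed s < T"
proof -
  assume s: "s > - d"
  have "elapsed (s + 1) \<le> T"
    by (rule tendsto_lowerbound[OF elapsed_limit])
      (use s elapsed_strict_mono in \<open>auto intro!: eventually_mono[OF eventually_gt_at_top[of "s + 1"]] less_imp_le\<close>)
  then show ?thesis using elapsed_strict_mono[of s "s + 1"] s by simp
qed

lemma T_pos: "T > 0" using elapsed_less[of 0] d elapsed_0 by simp

lemma elapsed_range: "s \<ge> 0 \<Longrightarrow> elapsed s \<in> {0..<T}"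
  using elapsed_less[of s] elapsed_strict_mono[of 0 s] d elapsed_0 by (cases "s = 0") auto

lemma elapsed_surj:
  assumes "t \<in> {0..<T}"
  shows "\<exists>s\<ge>0. elapsed s = t"
proof -
  obtain M where M: "\<And>s. s \<ge> M \<Longrightarrow> elapsed s > t"
    using order_tendstoD(1)[OF elapsed_limit, of t] assms by (auto simp: eventually_at_top_linorder)
  define b where "b = max M 0"
  have "\<exists>s. 0 \<le> s \<and> s \<le> b \<and> elapsed s = t"
  proof (rule IVT)
    show "elapsed 0 \<le> t" "t \<le> elapsed b" using assms M[of b] by (auto simp: elapsed_0 b_def)
    show "\<forall>x. 0 \<le> x \<and> x \<le> b \<longrightarrow> isCont elapsed x"
      using elapsed_deriv DERIV_isCont d by (metis less_le_trans neg_less_0_iff_less)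
  qed (simp add: b_def)
  then show ?thesis by blast
qed

text \<open>The inverse of \<open>elapsed\<close>, specified on all \<open>s > - d\<close>: the
  margin before \<open>s = 0\<close> makes its derivative two-sided at time 0.\<close>

definition clock :: "real \<Rightarrow> real" where
  "clock = (SOME g. \<forall>s>-d. g (elapsed s) = s \<and> (g has_real_derivative inverse (dt s)) (at (elapsed s)))"

lemma clock: "s > - d \<Longrightarrow> clock (elapsed s) = s"
  "s > - d \<Longrightarrow> (clock has_real_derivative inverse (dt s)) (at (elapsed s))"
proof -
  have "\<exists>g. \<forall>s>-d. g (elapsed s) = s \<and> (g has_real_derivative inverse (dt s)) (at (elapsed s))"
    using increasing_inverse[of "- d" elapsed dt] elapsed_deriv dt_pos by metis
  from someI_ex[OF this]
  show "s > - d \<Longrightarrow> clock (elapsed s) = s"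
    "s > - d \<Longrightarrow> (clock has_real_derivative inverse (dt s)) (at (elapsed s))"
    unfolding clock_def by blast+
qed

lemma clock_range:
  assumes "t \<in> {0..<T}"
  shows "clock t \<ge> 0" "clock t > - d" "elapsed (clock t) = t"
    "(clock has_real_derivative inverse (dt (clock t))) (at t)"
proof -
  obtain s where s: "s \<ge> 0" "elapsed s = t" using elapsed_surj[OF assms] by blast
  then have "s > - d" using d by simp
  from clock[OF this] s this show "clock t \<ge> 0" "clock t > - d" "elapsed (clock t) = t"
    "(clock has_real_derivative inverse (dt (clock t))) (at t)" by auto
qed

lemma clock_limit: "filterlim clock at_top (at_left T)"
  unfolding filterlim_at_top
proof
  fix Z :: real
  define m where "m = max Z 0"
  have m: "m > - d" "Z \<le> m" using d by (auto simp: m_def)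
  have "\<forall>\<^sub>F t in at_left T. t \<in> {elapsed m<..<T}"
    by (rule eventually_at_left_real[OF elapsed_less[OF m(1)]])
  then show "\<forall>\<^sub>F t in at_left T. Z \<le> clock t"
  proof eventually_elim
    case (elim t)
    have t: "t \<in> {0..<T}" using elim elapsed_range[of m] by (auto simp: m_def)
    have "m \<le> clock t"
      using elapsed_strict_mono[of "clock t" m] clock_range[OF t] elim by force
    then show ?case using m by simp
  qed
qed

lemma clock_chain:
  assumes t: "t \<in> {0..<T}" and f: "(f has_vector_derivative dt (clock t) *\<^sub>R f') (at (clock t))"
  shows "((\<lambda>t. f (clock t)) has_vector_derivative f') (at t)"
  using vector_diff_chain_at[OF clock_range(4)[OF t, unfolded has_real_derivative_iff_has_vector_derivative] f]
    dt_pos[OF clock_range(2)[OF t]] by (simp add: o_def)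

lemma pos_limit: "(pos \<longlongrightarrow> 0) at_top"
proof -
  have "(rr \<longlongrightarrow> 0) at_top"
    unfolding rr_def[abs_def]
    using tendsto_mult_left[OF filterlim_compose[OF exp_at_bot filterlim_uminus_at_bot_at_top], of r0] by simp
  then have "((\<lambda>s. cmod (pos s)) \<longlongrightarrow> 0) at_top" by (simp add: pos_norm)
  then show ?thesis by (rule tendsto_norm_zero_cancel)
qed

text \<open>Stated for every \<open>x\<close> that agrees with the ray on \<open>{0..<T}\<close>,
  because minimizers are determined on the unit interval only.\<close>

lemma ray_collision_solution:
  assumes x: "\<And>t. t \<in> {0..<T} \<Longrightarrow> x t = pos (clock t)"
  shows "collision_solution \<alpha> U h T x (\<lambda>t. vel (clock t))"
  unfolding collision_solution_def
proof (intro conjI ballI, rule T_pos)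
  fix t assume t: "t \<in> {0..<T}"
  note s = clock_range[OF t]
  show "x t \<noteq> 0" using x[OF t] pos_nonzero by simp
  have "((\<lambda>t. pos (clock t)) has_vector_derivative vel (clock t)) (at t within {0..<T})"
    by (rule has_vector_derivative_at_within[OF clock_chain[OF t pos_deriv[OF s(2)]]])
  then show "(x has_vector_derivative vel (clock t)) (at t within {0..<T})"
    by (rule has_vector_derivative_transform[OF t x, rotated])
  have "((\<lambda>t. vel (clock t)) has_vector_derivative force (clock t)) (at t within {0..<T})"
    by (rule has_vector_derivative_at_within[OF clock_chain[OF t vel_deriv[OF s(2)]]])
  then show "\<exists>g. GDERIV (potential \<alpha> U) (x t) :> g \<and> ((\<lambda>t. vel (clock t)) has_vector_derivative g) (at t within {0..<T})"
    using force_gradient x[OF t] by metis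
  show "1 / 2 * (cmod (vel (clock t)))\<^sup>2 - potential \<alpha> U (x t) = h"
    unfolding x[OF t] by (rule energy[OF s(2)])
next
  have "((\<lambda>t. pos (clock t)) \<longlongrightarrow> 0) (at_left T)"
    by (rule filterlim_compose[OF pos_limit clock_limit])
  then show "(x \<longlongrightarrow> 0) (at_left T)"
  proof (rule Lim_transform_eventually)
    show "\<forall>\<^sub>F t in at_left T. pos (clock t) = x t"
      by (rule eventually_mono[OF eventually_at_left_real[OF T_pos]]) (simp add: x)
  qed
qed

definition dtau :: "real \<Rightarrow> real" where "dtau s = q s / (2 * Fs s)"
definition tau :: "real \<Rightarrow> real" where
  "tau s = integral {- d / 2..s} dtau - integral {- d / 2..0} dtau"

lemma dtau_pos: "s > - d \<Longrightarrow> dtau s > 0"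
  using q_pos[of s] Fs_pos[of s] by (simp add: dtau_def)

lemma tau_deriv: "s > - d / 2 \<Longrightarrow> (tau has_real_derivative dtau s) (at s)"
proof -
  assume s: "s > - d / 2"
  have "continuous_on {- d<..} dtau"
    unfolding dtau_def[abs_def] using Fs_pos by (intro continuous_intros continuous_along_ray) force
  then have "continuous_on {- d / 2..s + 1} dtau" by (rule continuous_on_subset) (use d in auto)
  from integral_has_real_derivative[OF this, of s] s
  have "((\<lambda>s. integral {- d / 2..s} dtau) has_real_derivative dtau s) (at s)"
    by (simp add: at_within_Icc_at)
  then show ?thesis unfolding tau_def[abs_def] by (auto intro!: derivative_eq_intros)
qed

lemma tau_0: "tau 0 = 0" by (simp add: tau_def)

text \<open>\<open>dtau\<close> is bounded below by \<open>1 / (2 * Ub)\<close>, so the collision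
  takes infinite McGehee time and \<open>tau\<close> maps the nonnegative parameters onto all
  nonnegative times.\<close>

lemma tau_lower:
  assumes "- d / 2 < a" "a < b"
  shows "(b - a) / (2 * Ub) \<le> tau b - tau a"
proof -
  have "\<exists>z>a. z < b \<and> tau b - tau a = (b - a) * dtau z"
    by (rule MVT2[OF assms(2)]) (use assms tau_deriv in auto)
  then obtain z where z: "z > a" "z < b" "tau b - tau a = (b - a) * dtau z" by blast
  have "z > - d" using z assms d by auto
  then have "1 / (2 * Ub) \<le> dtau z"
    unfolding dtau_def using Fs_upper[of z] Fs_pos[of z] q_ge_1[of z] Ub_pos by (intro frac_le) auto
  then have "(b - a) * (1 / (2 * Ub)) \<le> (b - a) * dtau z" using assms by (intro mult_left_mono) auto
  then show ?thesis using z(3) by simp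
qed

lemma tau_strict_mono: "- d / 2 < a \<Longrightarrow> a < b \<Longrightarrow> tau a < tau b"
  using tau_lower[of a b] Ub_pos by (smt (verit) divide_pos_pos)

lemma tau_surj:
  assumes "t \<ge> 0"
  shows "\<exists>s\<ge>0. tau s = t"
proof -
  define b where "b = 2 * Ub * t"
  have b: "b \<ge> 0" using assms Ub_pos by (simp add: b_def)
  have "\<exists>s. 0 \<le> s \<and> s \<le> b \<and> tau s = t"
  proof (rule IVT)
    show "t \<le> tau b"
    proof (cases "b = 0")
      case True
      then show ?thesis using Ub_pos by (simp add: b_def tau_0)
    next
      case False
      then have "(b - 0) / (2 * Ub) \<le> tau b - tau 0" using b d by (intro tau_lower) auto
      then show ?thesis using Ub_pos by (simp add: b_def tau_0)
    qed
    show "\<forall>x. 0 \<le> x \<and> x \<le> b \<longrightarrow> isCont tau x"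
      using tau_deriv DERIV_isCont d by (metis divide_neg_pos less_le_trans neg_less_0_iff_less zero_less_numeral)
  qed (use assms b in \<open>auto simp: tau_0\<close>)
  then show ?thesis by blast
qed

definition tclock :: "real \<Rightarrow> real" where
  "tclock = (SOME g. \<forall>s>-d/2. g (tau s) = s \<and> (g has_real_derivative inverse (dtau s)) (at (tau s)))"

lemma tclock: "s > - d / 2 \<Longrightarrow> tclock (tau s) = s"
  "s > - d / 2 \<Longrightarrow> (tclock has_real_derivative inverse (dtau s)) (at (tau s))"
proof -
  have "dtau s > 0" if "s > - d / 2" for s using dtau_pos[of s] that d by auto
  then have "\<exists>g. \<forall>s>-d/2. g (tau s) = s \<and> (g has_real_derivative inverse (dtau s)) (at (tau s))"
    using increasing_inverse[of "- d / 2" tau dtau] tau_deriv by metis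
  from someI_ex[OF this]
  show "s > - d / 2 \<Longrightarrow> tclock (tau s) = s"
    "s > - d / 2 \<Longrightarrow> (tclock has_real_derivative inverse (dtau s)) (at (tau s))"
    unfolding tclock_def by blast+
qed

lemma tclock_range:
  assumes "t \<ge> 0"
  shows "tclock t \<ge> 0" "tclock t > - d" "tau (tclock t) = t"
    "(tclock has_real_derivative inverse (dtau (tclock t))) (at t)"
proof -
  obtain s where s: "s \<ge> 0" "tau s = t" using tau_surj[OF assms] by blast
  then have "s > - d / 2" "s > - d" using d by auto
  from tclock[OF this(1)] s this show "tclock t \<ge> 0" "tclock t > - d" "tau (tclock t) = t"
    "(tclock has_real_derivative inverse (dtau (tclock t))) (at t)" by auto
qed

lemma tclock_0: "tclock 0 = 0" using tclock(1)[of 0] d by (simp add: tau_0)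

lemma tclock_limit: "filterlim tclock at_top at_top"
  unfolding filterlim_at_top eventually_at_top_linorder
proof
  fix Z :: real
  define m where "m = max Z 0"
  have m: "m > - d / 2" "Z \<le> m" "m \<ge> 0" using d by (auto simp: m_def)
  show "\<exists>N. \<forall>t\<ge>N. Z \<le> tclock t"
  proof (intro exI[of _ "tau m"] allI impI)
    fix t assume t: "tau m \<le> t"
    have "tau m \<ge> 0" using tau_strict_mono[of 0 m] m d by (cases "m = 0") (auto simp: tau_0)
    then have t0: "t \<ge> 0" using t by simp
    have "m \<le> tclock t"
      using tau_strict_mono[of "tclock t" m] tclock_range[OF t0] t d by fastforce
    then show "Z \<le> tclock t" using m by simp
  qed
qed

text \<open>A continuous lift of the direction of \<open>vel\<close>: the inward radial direction
  \<open>\<theta> s + pi\<close>, turned by the angle whose tangent is \<open>p s\<close>.\<close>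

definition phi :: "real \<Rightarrow> real" where "phi s = \<theta> s + pi + arctan (p s)"

lemma cos_sin_phi: "cos (phi s - \<theta> s) = - 1 / q s" "sin (phi s - \<theta> s) = - p s / q s"
proof -
  have *: "phi s - \<theta> s = arctan (p s) + pi" by (simp add: phi_def)
  show "cos (phi s - \<theta> s) = - 1 / q s" "sin (phi s - \<theta> s) = - p s / q s"
    unfolding * by (simp_all add: cos_arctan sin_arctan q_def)
qed

lemma sgn_vel: "s > - d \<Longrightarrow> sgn (vel s) = cis (phi s)"
proof -
  assume s: "s > - d"
  define w where "w = sqrt (2 * Fs s) * rr s powr (- \<alpha> / 2)"
  have w: "w > 0" using Fs_pos[OF s] rr_pos[of s] by (simp add: w_def)
  have "cis (phi s) = cis (\<theta> s) * cis (phi s - \<theta> s)" by (simp add: cis_mult)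
  also have "cis (phi s - \<theta> s) = - ((1 + \<i> * p s) / q s)"
    by (simp add: complex_eq_iff cos_sin_phi)
  finally have "vel s = complex_of_real w * cis (phi s)" by (simp add: vel_def w_def)
  then show ?thesis using sgn_cis_polar[OF w] by simp
qed

lemma sgn_pos: "sgn (pos s) = cis (\<theta> s)"
  unfolding pos_def by (rule sgn_cis_polar[OF rr_pos])

definition state :: "real \<Rightarrow> real \<times> complex \<times> complex" where
  "state s = (rr s, cis (\<theta> s), cis (phi s))"

lemma state_eq: "s > - d \<Longrightarrow> (cmod (pos s), sgn (pos s), sgn (vel s)) = state s"
  by (simp add: state_def pos_norm sgn_pos sgn_vel)

lemma state_limit: "(state \<longlongrightarrow> (0, cis \<theta>s, cis (\<theta>s + pi))) at_top"
proof -
  have "((\<lambda>s. phi s) \<longlongrightarrow> \<theta>s + pi + arctan 0) at_top"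
    unfolding phi_def by (intro tendsto_intros limits)
  moreover have "(rr \<longlongrightarrow> 0) at_top"
    using tendsto_norm[OF pos_limit] by (simp add: pos_norm)
  moreover have "((\<lambda>s. cis (f s)) \<longlongrightarrow> cis l) at_top" if "(f \<longlongrightarrow> l) at_top" for f :: "real \<Rightarrow> real" and l
    unfolding cis_conv_exp by (intro tendsto_intros that)
  ultimately show ?thesis
    unfolding state_def[abs_def] using limits(1) by (intro tendsto_Pair) auto
qed

lemma mcgehee_system_ray: "mcgehee_system \<alpha> U h (\<lambda>t. rr (tclock t)) (\<lambda>t. \<theta> (tclock t)) (\<lambda>t. phi (tclock t))"
  unfolding mcgehee_system_def
proof (intro allI impI conjI)
  fix t :: real assume t: "t \<ge> 0"
  define s where "s = tclock t"
  note tc = tclock_range[OF t, folded s_def]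
  have f: "Fs s > 0" using Fs_pos[OF tc(2)] .
  have inv: "inverse (dtau s) = 2 * Fs s / q s" by (simp add: dtau_def)
  have Fs_eq: "U (cis (\<theta> s)) + h * rr s powr \<alpha> = Fs s" by (simp add: Fs_def F_def Ua_def)
  have chain: "((\<lambda>t. f (tclock t)) has_real_derivative f' * inverse (dtau s)) (at t within {0..})"
    if "(f has_real_derivative f') (at s)" for f f'
    using DERIV_chain2[OF that[unfolded s_def] tc(4)] by (rule has_field_derivative_at_within)
  show "rr (tclock t) \<ge> 0" using rr_pos less_imp_le by blast
  show "((\<lambda>t. rr (tclock t)) has_real_derivative
      2 * rr (tclock t) * (U (cis (\<theta> (tclock t))) + h * rr (tclock t) powr \<alpha>) * cos (phi (tclock t) - \<theta> (tclock t))) (at t within {0..})"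
    using chain[OF rr_deriv] unfolding inv s_def[symmetric] cos_sin_phi Fs_eq by (simp add: mult_ac)
  show "((\<lambda>t. \<theta> (tclock t)) has_real_derivative
      2 * (U (cis (\<theta> (tclock t))) + h * rr (tclock t) powr \<alpha>) * sin (phi (tclock t) - \<theta> (tclock t))) (at t within {0..})"
    using chain[OF \<theta>_deriv[OF tc(2)]] unfolding inv s_def[symmetric] cos_sin_phi Fs_eq by (simp add: mult_ac)
  define e where "e = (\<beta> + \<alpha> * h * rr s powr \<alpha> / (2 * Fs s)) * p s - U1 (\<theta> s) / (2 * Fs s)"
  have "((\<lambda>s. arctan (p s)) has_real_derivative inverse (1 + (p s)\<^sup>2) * ((q s)\<^sup>2 * e)) (at s)"
    using DERIV_chain2[OF DERIV_arctan p_deriv'[OF tc(2)]] unfolding e_def .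
  also have "inverse (1 + (p s)\<^sup>2) * ((q s)\<^sup>2 * e) = e"
    using q_pos[of s] by (simp flip: q_square)
  finally have "((\<lambda>s. arctan (p s)) has_real_derivative e) (at s)" .
  from DERIV_add[OF DERIV_add[OF \<theta>_deriv[OF tc(2)] DERIV_const[of pi]] this]
  have "(phi has_real_derivative - p s + e) (at s)"
    unfolding phi_def[abs_def] by simp
  from chain[OF this]
  have "((\<lambda>t. phi (tclock t)) has_real_derivative (- p s + e) * (2 * Fs s / q s)) (at t within {0..})"
    unfolding inv .
  \<comment> \<open>Since \<open>2 * \<beta> - 2 = - \<alpha>\<close>, the coefficient of
    \<open>p s\<close> becomes \<open>- \<alpha> * Fs s + \<alpha> * h * rr s powr \<alpha>\<close>,
    and the radial term cancels.\<close>
  also have "(- p s + e) * (2 * Fs s / q s) = U1 (\<theta> s) * cos (phi s - \<theta> s) + \<alpha> * Ua (\<theta> s) * sin (phi s - \<theta> s)"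
  proof -
    have "(- p s + e) * (2 * Fs s) = (\<alpha> * h * rr s powr \<alpha> - \<alpha> * Fs s) * p s - U1 (\<theta> s)"
      using f by (simp add: e_def \<beta>_def field_simps)
    also have "\<alpha> * h * rr s powr \<alpha> - \<alpha> * Fs s = - \<alpha> * Ua (\<theta> s)"
      by (simp add: Fs_def F_def algebra_simps)
    finally have "(- p s + e) * (2 * Fs s) / q s = (- \<alpha> * Ua (\<theta> s) * p s - U1 (\<theta> s)) / q s" by simp
    then show ?thesis unfolding cos_sin_phi by (simp add: diff_divide_distrib)
  qed
  finally show "((\<lambda>t. phi (tclock t)) has_real_derivative
      deriv (\<lambda>s. U (cis s)) (\<theta> (tclock t)) * cos (phi (tclock t) - \<theta> (tclock t)) +
      \<alpha> * U (cis (\<theta> (tclock t))) * sin (phi (tclock t) - \<theta> (tclock t))) (at t within {0..})"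
    unfolding s_def U1_def Ua_eq .
qed

lemma state_in_stable_manifold:
  assumes "\<And>s. s \<ge> 0 \<Longrightarrow> state s \<in> N"
  shows "state 0 \<in> stable_manifold \<alpha> U h \<theta>s N"
  unfolding stable_manifold_def
proof (intro CollectI exI conjI allI impI)
  show "state 0 = (rr (tclock 0), cis (\<theta> (tclock 0)), cis (phi (tclock 0)))"
    by (simp add: tclock_0 state_def)
  show "mcgehee_system \<alpha> U h (\<lambda>t. rr (tclock t)) (\<lambda>t. \<theta> (tclock t)) (\<lambda>t. phi (tclock t))"
    by (rule mcgehee_system_ray)
  show "(rr (tclock t), cis (\<theta> (tclock t)), cis (phi (tclock t))) \<in> N" if "t \<ge> 0" for t
    using assms[OF tclock_range(1)[OF that]] by (simp add: state_def)
  show "((\<lambda>t. (rr (tclock t), cis (\<theta> (tclock t)), cis (phi (tclock t)))) \<longlongrightarrow> (0, cis \<theta>s, cis (\<theta>s + pi))) at_top"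
    using filterlim_compose[OF state_limit tclock_limit] by (simp add: state_def)
qed

lemma ray_mcgehee_orbit:
  assumes x: "\<And>t. t \<in> {0..<T} \<Longrightarrow> x t = pos (clock t)"
  shows "mcgehee_orbit \<alpha> U h T x (\<lambda>t. vel (clock t)) (\<lambda>t. state (tclock t))"
  unfolding mcgehee_orbit_def
proof (intro exI[of _ "\<lambda>t. elapsed (tclock t)"] conjI allI impI)
  show "elapsed (tclock 0) = 0" by (simp add: tclock_0 elapsed_0)
  fix t :: real assume t: "t \<ge> 0"
  define s where "s = tclock t"
  note tc = tclock_range[OF t, folded s_def]
  have e: "elapsed s \<in> {0..<T}" by (rule elapsed_range[OF tc(1)])
  then show "elapsed (tclock t) \<in> {0..<T}" by (simp add: s_def)
  have c: "clock (elapsed s) = s" by (rule clock(1)[OF tc(2)])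
  have xs: "x (elapsed s) = pos s" using x[OF e] c by simp
  show "vel (clock (elapsed (tclock t))) \<noteq> 0"
    using vel_nonzero[OF tc(2)] c by (simp add: s_def)
  show "state (tclock t) = (cmod (x (elapsed (tclock t))), sgn (x (elapsed (tclock t))), sgn (vel (clock (elapsed (tclock t)))))"
    unfolding s_def[symmetric] xs c by (rule state_eq[OF tc(2), symmetric])
  have "((\<lambda>t. elapsed (tclock t)) has_real_derivative dt s * inverse (dtau s)) (at t within {0..})"
    using DERIV_chain2[OF elapsed_deriv[OF tc(2), unfolded s_def] tc(4)]
    unfolding s_def by (rule has_field_derivative_at_within)
  also have "dt s * inverse (dtau s) = sqrt (2 * Fs s) * rr s powr (1 + \<alpha> / 2)"
  proof -
    have "dt s * inverse (dtau s) = rr s powr (1 + \<alpha> / 2) * (2 * Fs s / sqrt (2 * Fs s))"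
      using q_pos[of s] by (simp add: dt_def dtau_def)
    then show ?thesis using Fs_pos[OF tc(2)] by (simp add: real_div_sqrt)
  qed
  also have "2 * Fs s = 2 * U (sgn (x (elapsed s))) + 2 * h * cmod (x (elapsed s)) powr \<alpha>"
    unfolding xs sgn_pos pos_norm by (simp add: Fs_def F_def Ua_def)
  also have "rr s = cmod (x (elapsed s))" by (simp add: xs pos_norm)
  finally show "((\<lambda>t. elapsed (tclock t)) has_real_derivative
      sqrt (2 * U (sgn (x (elapsed (tclock t)))) + 2 * h * cmod (x (elapsed (tclock t))) powr \<alpha>) *
        cmod (x (elapsed (tclock t))) powr (1 + \<alpha> / 2)) (at t within {0..})"
    unfolding s_def .
qed

end

section \<open>Minimizers are rays\<close>

context collision_ray
begin

definition ustar :: "real \<Rightarrow> complex" where "ustar j = (if j < 1 then pos (clock (T * j)) else 0)"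
definition vstar :: "real \<Rightarrow> complex" where "vstar j = (if j < 1 then T *\<^sub>R vel (clock (T * j)) else 0)"

lemma T_mult: "j \<in> {0..<1} \<Longrightarrow> T * j \<in> {0..<T}"
  using T_pos by auto

lemma clock_continuous: "continuous_on {0..<1} (\<lambda>j. clock (T * j))"
proof -
  have "continuous_on {0..<T} clock"
    using clock_range(4) DERIV_isCont by (intro continuous_at_imp_continuous_on) blast
  then show ?thesis by (rule continuous_on_compose2) (use T_mult in \<open>auto intro!: continuous_intros\<close>)
qed

lemma clock_compose_continuous:
  assumes "continuous_on {- d<..} f"
  shows "continuous_on {0..<1} (\<lambda>j. f (clock (T * j)))"
  by (rule continuous_on_compose2[OF assms clock_continuous]) (use clock_range(2)[OF T_mult] in auto)

lemma extended_continuous: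
  fixes f :: "real \<Rightarrow> 'b::real_normed_vector"
  assumes f: "continuous_on {- d<..} f" and lim: "(f \<longlongrightarrow> 0) at_top"
  shows "continuous_on {0..1} (\<lambda>j. if j < 1 then f (clock (T * j)) else 0)"
    (is "continuous_on _ ?g")
  unfolding continuous_on_def
proof
  fix j :: real assume j: "j \<in> {0..1}"
  show "(?g \<longlongrightarrow> ?g j) (at j within {0..1})"
  proof (cases "j < 1")
    case True
    have "((\<lambda>j. f (clock (T * j))) \<longlongrightarrow> f (clock (T * j))) (at j within {0..<1})"
      using clock_compose_continuous[OF f] j True by (auto simp: continuous_on_def)
    then have "(?g \<longlongrightarrow> ?g j) (at j within {0..<1})"
      using True by (subst Lim_cong_within[where g = "\<lambda>j. f (clock (T * j))"]) auto
    moreover have "at j within {0..1} = at j within {0..<1}"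
      by (rule at_within_nhd[where S = "{..<1}"]) (use True in auto)
    ultimately show ?thesis by (simp only:)
  next
    case False
    then have k1: "j = 1" using j by simp
    have "((\<lambda>j. T * j) \<longlongrightarrow> T * 1) (at_left 1)" by (intro tendsto_intros)
    moreover have "\<forall>\<^sub>F j in at_left 1. T * j < T"
      by (rule eventually_mono[OF eventually_at_left_real[OF zero_less_one]]) (use T_pos in auto)
    ultimately have "filterlim (\<lambda>j. T * j) (at_left T) (at_left 1)"
      by (auto simp: filterlim_at elim: eventually_mono)
    from filterlim_compose[OF lim filterlim_compose[OF clock_limit this]]
    have "((\<lambda>j. f (clock (T * j))) \<longlongrightarrow> 0) (at_left 1)" .
    then have "(?g \<longlongrightarrow> 0) (at_left 1)"
    proof (rule Lim_transform_eventually)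
      show "\<forall>\<^sub>F j in at_left 1. f (clock (T * j)) = ?g j"
        by (rule eventually_mono[OF eventually_at_left_real[OF zero_less_one]]) simp
    qed
    then show ?thesis unfolding k1 using at_within_Icc_at_left[of 0 "1::real"] by simp
  qed
qed

lemma pos_continuous: "continuous_on {- d<..} pos" and vel_continuous: "continuous_on {- d<..} vel"
  and S_continuous: "continuous_on {- d<..} S"
proof -
  show "continuous_on {- d<..} pos"
    using pos_deriv has_vector_derivative_continuous by (intro continuous_at_imp_continuous_on) blast
  show "continuous_on {- d<..} vel"
    using vel_deriv has_vector_derivative_continuous by (intro continuous_at_imp_continuous_on) blast
  show "continuous_on {- d<..} S"
    using S_deriv DERIV_isCont by (intro continuous_at_imp_continuous_on) blast
qed

lemma clock_scaled_deriv:
  assumes j: "j \<in> {0..<1}" and f: "(f has_vector_derivative dt (clock (T * j)) *\<^sub>R f') (at (clock (T * j)))"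
  shows "((\<lambda>j. if j < 1 then f (clock (T * j)) else 0) has_vector_derivative T *\<^sub>R f') (at j)"
proof -
  have "((\<lambda>j. T * j) has_vector_derivative T) (at j)"
    by (auto intro!: derivative_eq_intros simp: has_real_derivative_iff_has_vector_derivative[symmetric])
  from vector_diff_chain_at[OF this clock_chain[OF T_mult[OF j] f]]
  have "((\<lambda>j. f (clock (T * j))) has_vector_derivative T *\<^sub>R f') (at j)" by (simp add: o_def)
  then show ?thesis
    by (rule has_vector_derivative_transform_within_open[where S = "{..<1}"]) (use j in auto)
qed

lemma ustar_deriv: "j \<in> {0..<1} \<Longrightarrow> (ustar has_vector_derivative vstar j) (at j)"
  using clock_scaled_deriv[OF _ pos_deriv[OF clock_range(2)[OF T_mult]]]
  unfolding ustar_def[abs_def] vstar_def by simp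

lemma ustar_continuous: "continuous_on {0..1} ustar"
  unfolding ustar_def[abs_def] by (rule extended_continuous[OF pos_continuous pos_limit])

lemma vstar_measurable: "(\<lambda>j. indicat_real {0..1} j *\<^sub>R vstar j) \<in> borel_measurable borel"
proof -
  have "(\<lambda>j. indicat_real {0..<1} j *\<^sub>R (T *\<^sub>R vel (clock (T * j)))) \<in> borel_measurable borel"
    by (rule borel_measurable_continuous_on_indicator)
      (auto intro!: continuous_intros clock_compose_continuous[OF vel_continuous])
  also have "(\<lambda>j. indicat_real {0..<1} j *\<^sub>R (T *\<^sub>R vel (clock (T * j)))) = (\<lambda>j. indicat_real {0..1} j *\<^sub>R vstar j)"
    by (auto simp: fun_eq_iff vstar_def indicator_def)
  finally show ?thesis .
qed

text \<open>The velocity blows up at the collision, so integrability is read off from a primitive: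
  by \<open>action_rate\<close> it is \<open>- T\<close> times the remaining action, which extends
  continuously to the final time by 0.\<close>

lemma vstar_square_integral:
  shows "set_integrable lborel {0..1} (\<lambda>j. (cmod (vstar j))\<^sup>2)"
    and "(LINT j:{0..1}|lborel. (cmod (vstar j))\<^sup>2) = T * S 0"
proof -
  define f where "f j = - T * (if j < 1 then S (clock (T * j)) else 0)" for j
  have "((\<lambda>j. (cmod (vstar j))\<^sup>2) has_integral f 1 - f 0) {0..1}"
  proof (rule fundamental_theorem_of_calculus_interior)
    show "continuous_on {0..1} f"
      unfolding f_def by (intro continuous_intros extended_continuous S_continuous tail_limits)
    show "(f has_vector_derivative (cmod (vstar j))\<^sup>2) (at j)" if "j \<in> {0<..<1}" for j
    proof -
      have j: "j \<in> {0..<1}" using that by auto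
      note s = clock_range(2)[OF T_mult[OF j]]
      have "(S has_vector_derivative dt (clock (T * j)) *\<^sub>R (- (cmod (vel (clock (T * j))))\<^sup>2)) (at (clock (T * j)))"
        using S_deriv[OF s] by (simp add: action_rate[OF s] has_real_derivative_iff_has_vector_derivative)
      from clock_scaled_deriv[OF j this]
      have "(f has_vector_derivative - T * (T *\<^sub>R (- (cmod (vel (clock (T * j))))\<^sup>2))) (at j)"
        unfolding f_def[abs_def] by (rule has_vector_derivative_mult_right)
      then show ?thesis
        using T_pos that by (simp add: vstar_def power_mult_distrib power2_eq_square mult_ac)
    qed
  qed simp
  moreover have "f 1 - f 0 = T * S 0" using clock(1)[of 0] d by (simp add: f_def elapsed_0)
  ultimately have I: "((\<lambda>j. (cmod (vstar j))\<^sup>2) has_integral T * S 0) {0..1}" by simp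
  then have "(\<lambda>j. (cmod (vstar j))\<^sup>2) absolutely_integrable_on {0..1}"
    by (intro nonnegative_absolutely_integrable_1) auto
  moreover have "(\<lambda>j. indicat_real {0..1} j *\<^sub>R (cmod (vstar j))\<^sup>2) \<in> borel_measurable lborel"
  proof -
    have "(\<lambda>j. (cmod (indicat_real {0..1} j *\<^sub>R vstar j))\<^sup>2) \<in> borel_measurable borel"
      using vstar_measurable by measurable
    also have "(\<lambda>j. (cmod (indicat_real {0..1} j *\<^sub>R vstar j))\<^sup>2) = (\<lambda>j. indicat_real {0..1} j *\<^sub>R (cmod (vstar j))\<^sup>2)"
      by (auto simp: fun_eq_iff indicator_def)
    finally show ?thesis by simp
  qed
  ultimately show *: "set_integrable lborel {0..1} (\<lambda>j. (cmod (vstar j))\<^sup>2)"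
    unfolding set_integrable_def using integrable_completion by blast
  show "(LINT j:{0..1}|lborel. (cmod (vstar j))\<^sup>2) = T * S 0"
    using set_borel_integral_eq_integral(2)[OF *] I integral_unique by metis
qed

lemma vstar_integrable: "set_integrable lborel {0..1} vstar"
  unfolding set_integrable_def
proof (rule Bochner_Integration.integrable_bound)
  have "set_integrable lborel {0..1} (\<lambda>j. 1 + (cmod (vstar j))\<^sup>2)"
    by (intro set_integral_add vstar_square_integral borel_integrable_atLeastAtMost') auto
  then show "integrable lborel (\<lambda>j. indicat_real {0..1} j *\<^sub>R (1 + (cmod (vstar j))\<^sup>2))"
    by (simp add: set_integrable_def)
  have "t \<le> 1 + t\<^sup>2" for t :: real
    using zero_le_power2[of "t - 1 / 2"] by (simp add: power2_eq_square algebra_simps)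
  then show "AE j in lborel. norm (indicat_real {0..1} j *\<^sub>R vstar j) \<le>
      norm (indicat_real {0..1} j *\<^sub>R (1 + (cmod (vstar j))\<^sup>2))"
    by (auto simp: indicator_def)
qed (use vstar_measurable in simp)

lemma ustar_weak_deriv: "is_weak_deriv ustar vstar"
  unfolding is_weak_deriv_def
proof (intro conjI ballI vstar_integrable vstar_square_integral(1))
  fix t :: real assume t: "t \<in> {0..1}"
  have "(vstar has_integral ustar t - ustar 0) {0..t}"
  proof (rule fundamental_theorem_of_calculus_interior)
    show "continuous_on {0..t} ustar" by (rule continuous_on_subset[OF ustar_continuous]) (use t in auto)
  qed (use t ustar_deriv in auto)
  moreover have "set_integrable lborel {0..t} vstar"
    by (rule set_integrable_subset[OF vstar_integrable]) (use t in auto)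
  ultimately have "(LINT s:{0..t}|lborel. vstar s) = ustar t - ustar 0"
    using set_borel_integral_eq_integral(2) integral_unique by metis
  then show "ustar t = ustar 0 + (LINT s:{0..t}|lborel. vstar s)" by simp
qed

lemma ustar_kinetic: "kinetic ustar = T * S 0 / 2"
  unfolding kinetic_eq[OF ustar_weak_deriv] vstar_square_integral(2) by simp

lemma ustar_0: "ustar 0 = pos 0"
  using clock(1)[of 0] d by (simp add: ustar_def elapsed_0)

lemma ustar_H_coll: "ustar \<in> H_coll (pos 0)"
proof -
  have "cmod (ustar j) \<le> cmod (pos 0)" if "j \<in> {0..1}" for j
  proof (cases "j < 1")
    case True
    then have "clock (T * j) \<ge> 0" using clock_range(1)[OF T_mult] that by simp
    then have "rr (clock (T * j)) \<le> rr 0" using r0 by (simp add: rr_def)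
    then show ?thesis using True by (simp add: ustar_def pos_norm)
  qed (simp add: ustar_def)
  then show ?thesis
    using ustar_weak_deriv by (auto simp: H_coll_def H1_def ustar_0) (auto simp: ustar_def)
qed

text \<open>By conservation of energy \<open>h + V\<close> is half the squared speed, so the second
  factor of the functional is again a multiple of \<open>S 0\<close>.\<close>

lemma ustar_shifted_potential: "shifted_potential \<alpha> U h ustar = ereal (S 0 / (2 * T))"
proof -
  \<comment> \<open>The indicator repairs the identity at the collision time 1, where both
    \<open>potential\<close> and \<open>vstar\<close> are 0.\<close>
  have V: "potential \<alpha> U (ustar j) = (cmod (vstar j))\<^sup>2 / (2 * T\<^sup>2) + (h * indicat_real {1::real} j - h)" if "j \<in> {0..1}" for j
  proof (cases "j < 1")
    case True
    then have s: "clock (T * j) > - d" using clock_range(2)[OF T_mult] that by simp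
    have "potential \<alpha> U (ustar j) = (cmod (vel (clock (T * j))))\<^sup>2 / 2 - h"
      using energy[OF s] True by (simp add: ustar_def)
    then show ?thesis using True T_pos by (simp add: vstar_def power_mult_distrib)
  next
    case False
    then have "j = 1" using that by simp
    then show ?thesis by (simp add: ustar_def vstar_def potential_def)
  qed
  have ind: "set_integrable lborel {0..1} (\<lambda>j. h * indicat_real {1::real} j - h)"
    "(LINT j:{0..1}|lborel. h * indicat_real {1::real} j - h) = - h"
  proof -
    have "(\<lambda>j::real. indicat_real {0..1} j *\<^sub>R indicat_real {1::real} j) = indicat_real {1}"
      by (auto simp: indicator_def fun_eq_iff)
    moreover have "integrable lborel (indicat_real {1::real})"
      by (simp add: integrable_indicator_iff)
    ultimately have "set_integrable lborel {0..1} (\<lambda>j::real. indicat_real {1::real} j)"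
      unfolding set_integrable_def by (simp only:)
    then have 1: "set_integrable lborel {0..1} (\<lambda>j::real. h * indicat_real {1::real} j)"
      by (intro set_integrable_mult_right)
    have 2: "set_integrable lborel {0..1} (\<lambda>j::real. h)"
      by (intro borel_integrable_atLeastAtMost') auto
    show "set_integrable lborel {0..1} (\<lambda>j. h * indicat_real {1::real} j - h)"
      by (rule set_integral_diff(1)[OF 1 2])
    have "(LINT j:{0..1}|lborel. h * indicat_real {1::real} j) = 0"
      unfolding set_lebesgue_integral_def
      by (rule integral_eq_zero_AE) (use AE_lborel_singleton[of "1::real"] in \<open>auto elim!: eventually_mono\<close>)
    moreover have "(LINT j:{0..1::real}|lborel. h) = h"
      by (simp add: set_lebesgue_integral_def)
    ultimately show "(LINT j:{0..1}|lborel. h * indicat_real {1::real} j - h) = - h"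
      using set_integral_diff(2)[OF 1 2] by simp
  qed
  note v2 = set_integrable_divide[OF vstar_square_integral(1), of "2 * T\<^sup>2"]
  have VI: "set_integrable lborel {0..1} (\<lambda>j. potential \<alpha> U (ustar j))"
    using set_integral_add(1)[OF v2 ind(1)] V by (subst set_integrable_cong) auto
  have "(LINT j:{0..1}|lborel. potential \<alpha> U (ustar j)) =
      (LINT j:{0..1}|lborel. (cmod (vstar j))\<^sup>2 / (2 * T\<^sup>2) + (h * indicat_real {1::real} j - h))"
    by (rule set_lebesgue_integral_cong) (auto simp: V)
  also have "\<dots> = T * S 0 / (2 * T\<^sup>2) - h"
    using set_integral_add(2)[OF v2 ind(1)] vstar_square_integral(2) ind(2) by simp
  also have "T * S 0 / (2 * T\<^sup>2) = S 0 / (2 * T)" using T_pos by (simp add: power2_eq_square)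
  finally have VL: "(LINT j:{0..1}|lborel. potential \<alpha> U (ustar j)) = S 0 / (2 * T) - h" .
  have "ustar j \<noteq> 0" if "j \<noteq> 1" "j \<in> {0..1}" for j
    using that pos_nonzero by (simp add: ustar_def)
  then have "AE j in lborel. j \<in> {0..1} \<longrightarrow> ustar j \<noteq> 0"
    using AE_lborel_singleton[of "1::real"] by (auto elim!: eventually_mono)
  from finite_potential_integral(3)[OF ustar_continuous potential_measurable potential_nonneg this VI]
  have "shifted_potential \<alpha> U h ustar = ereal h + enn2ereal (ennreal (S 0 / (2 * T) - h))"
    by (simp add: shifted_potential_def VL)
  moreover have "0 \<le> S 0 / (2 * T) - h"
    unfolding VL[symmetric] set_lebesgue_integral_def by (simp add: potential_nonneg integral_nonneg)
  ultimately show ?thesis by (simp add: enn2ereal_ennreal)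
qed

lemma ustar_maupertuis: "maupertuis \<alpha> U h ustar = ereal ((S 0)\<^sup>2 / 4)"
  unfolding maupertuis_def ustar_kinetic ustar_shifted_potential using T_pos by (simp add: power2_eq_square)

lemma S_0_pos: "S 0 > 0"
proof -
  have "S 1 < S 0"
  proof (rule DERIV_neg_imp_decreasing[where f = S and a = 0 and b = 1])
    fix x :: real assume "0 \<le> x" "x \<le> 1"
    then have x: "x > - d" using d by simp
    from S_deriv[OF x] G_pos[OF x] q_pos[of x]
    show "\<exists>y. (S has_real_derivative y) (at x) \<and> y < 0" by (intro exI[of _ "- (G x * q x)"]) simp
  qed simp
  moreover have "0 \<le> S 1"
    unfolding S_def
  proof (rule integral_nonneg)
    show "(\<lambda>x. G x * q x) integrable_on {1..}" by (rule S_tail(1)) (use d in auto)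
    show "0 \<le> G x * q x" if "x \<in> {1..}" for x using G_pos[of x] q_pos[of x] that d by auto
  qed
  ultimately show ?thesis by simp
qed

end

section \<open>Comparison with all admissible paths\<close>

context calibrated_ray
begin

lemma pos_0_norm: "cmod (pos 0) = r0" by (simp add: pos_norm rr_def)

text \<open>A path without kinetic energy would be constant, but it has to join a nonzero point to
  the origin. Hence an infinite potential integral makes the functional infinite and is never
  multiplied by 0.\<close>

lemma H_coll_kinetic_pos:
  assumes w: "w \<in> H_coll (pos 0)"
  shows "kinetic w > 0"
proof -
  obtain v where v: "is_weak_deriv w v" using w by (auto simp: H_coll_def H1_def)
  have ge: "kinetic w \<ge> 0"
    unfolding kinetic_eq[OF v] set_lebesgue_integral_def by (simp add: integral_nonneg)
  moreover have "kinetic w \<noteq> 0"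
  proof
    assume "kinetic w = 0"
    then have "(LINT s|lborel. indicat_real {0..1} s *\<^sub>R (cmod (v s))\<^sup>2) = 0"
      unfolding kinetic_eq[OF v] set_lebesgue_integral_def by simp
    then have "AE s in lborel. indicat_real {0..1} s *\<^sub>R (cmod (v s))\<^sup>2 = 0"
      using weak_deriv_square_integrable[OF v]
      by (subst (asm) integral_nonneg_eq_0_iff_AE) (auto simp: set_integrable_def)
    then have "(LINT s:{0..1}|lborel. v s) = 0"
      unfolding set_lebesgue_integral_def
      by (intro integral_eq_zero_AE) (auto elim!: eventually_mono simp: indicator_def)
    then have "w 1 - w 0 = 0" using weak_deriv_increment[OF v, of 1] by simp
    moreover have "w 0 = pos 0" "w 1 = 0" using w by (auto simp: H_coll_def)
    ultimately show False using pos_nonzero[of 0] by simp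
  qed
  ultimately show ?thesis by simp
qed

text \<open>The number \<open>Pt\<close> is obtained before \<open>c\<close>, so that the weight can
  later be chosen in terms of it.\<close>

lemma H_coll_competitor:
  assumes w: "w \<in> H_coll (pos 0)" and fin: "shifted_potential \<alpha> U h w \<noteq> \<infinity>" and v: "is_weak_deriv w v"
  obtains Pt where "shifted_potential \<alpha> U h w = ereal Pt"
    and "\<And>c. c > 0 \<Longrightarrow> competitor \<alpha> h \<theta>s U r0 d \<theta> p k \<delta> Ub pb \<kappa> \<kappa>' w v c"
    and "\<And>c. c > 0 \<Longrightarrow> (LINT s:{0..1}|lborel. competitor.E \<alpha> h U w v c s) = c * kinetic w + Pt / c"
proof -
  define I where "I = (\<integral>\<^sup>+s\<in>{0..1}. (if w s = 0 then \<infinity> else ennreal (potential \<alpha> U (w s))) \<partial>lborel)"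
  have I: "I \<noteq> \<infinity>" using fin by (auto simp: shifted_potential_def I_def)
  note fp = finite_potential_integral[OF path_continuous[OF v] potential_measurable potential_nonneg, folded I_def]
  note nz = fp(1)[OF I] and VI = fp(2)[OF I]
  define L where "L = (LINT s:{0..1}|lborel. potential \<alpha> U (w s))"
  have "L \<ge> 0" unfolding L_def set_lebesgue_integral_def by (simp add: potential_nonneg integral_nonneg)
  then have sp: "shifted_potential \<alpha> U h w = ereal (h + L)"
    unfolding shifted_potential_def I_def[symmetric] fp(3)[OF nz VI] L_def[symmetric] by (simp add: enn2ereal_ennreal)
  have comp: "competitor \<alpha> h \<theta>s U r0 d \<theta> p k \<delta> Ub pb \<kappa> \<kappa>' w v c" if "c > 0" for c
    by unfold_locales (use w v nz VI that in \<open>auto simp: H_coll_def pos_0_norm\<close>)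
  show ?thesis
  proof (rule that[OF sp comp])
    fix c :: real assume c: "c > 0"
    interpret competitor \<alpha> h \<theta>s U r0 d \<theta> p k \<delta> Ub pb \<kappa> \<kappa>' w v c by (rule comp[OF c])
    have hI: "set_integrable lborel {0..1} (\<lambda>s::real. h)"
      by (intro borel_integrable_atLeastAtMost') auto
    have "(LINT s:{0..1}|lborel. Q s) = h + L"
      using set_integral_add(2)[OF hI VI] by (simp add: Q_def L_def set_lebesgue_integral_def)
    then have "(LINT s:{0..1}|lborel. E s) = c / 2 * (LINT s:{0..1}|lborel. (cmod (v s))\<^sup>2) + (h + L) / c"
      unfolding E_def
      using set_integral_add(2)[OF set_integrable_mult_right[OF weak_deriv_square_integrable[OF v], of "c / 2"]
          set_integrable_divide[OF Q_integrable[of 0 1], of c]]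
      by simp
    then show "(LINT s:{0..1}|lborel. E s) = c * kinetic w + (h + L) / c"
      by (simp add: kinetic_eq[OF v])
  qed auto
qed

text \<open>The optimal weight, at which the arithmetic and the geometric mean of
  \<open>c * K\<close> and \<open>Pt / c\<close> coincide.\<close>

lemma two_sqrt_bound:
  fixes K Pt :: real
  assumes "K > 0" "Pt > 0"
  shows "sqrt (Pt / K) > 0" and "sqrt (Pt / K) * K + Pt / sqrt (Pt / K) = 2 * sqrt (K * Pt)"
proof -
  define a b where "a = sqrt K" and "b = sqrt Pt"
  have ab: "a > 0" "b > 0" "K = a * a" "Pt = b * b" using assms by (auto simp: a_def b_def)
  show "sqrt (Pt / K) > 0" using assms by simp
  show "sqrt (Pt / K) * K + Pt / sqrt (Pt / K) = 2 * sqrt (K * Pt)"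
    unfolding real_sqrt_divide real_sqrt_mult a_def[symmetric] b_def[symmetric] ab(3,4)
    using ab(1,2) by (simp add: real_sqrt_mult)
qed

text \<open>With the weight \<open>S 0 / (2 * K)\<close> a nonpositive \<open>Pt\<close> would give
  \<open>S 0 \<le> S 0 / 2\<close>.\<close>

lemma potential_integral_pos:
  assumes K: "K > 0" and bound: "\<And>c. c > 0 \<Longrightarrow> S 0 \<le> c * K + Pt / c"
  shows "Pt > 0"
proof (rule ccontr)
  assume "\<not> Pt > 0"
  then have "Pt / (S 0 / (2 * K)) \<le> 0" using S_0_pos K by (intro divide_nonpos_pos) auto
  moreover have "S 0 / (2 * K) * K = S 0 / 2" using K by simp
  ultimately show False using bound[of "S 0 / (2 * K)"] S_0_pos K by simp
qed

lemma maupertuis_lower_bound: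
  assumes w: "w \<in> H_coll (pos 0)"
  shows "ereal ((S 0)\<^sup>2 / 4) \<le> maupertuis \<alpha> U h w"
proof (cases "shifted_potential \<alpha> U h w = \<infinity>")
  case True
  then show ?thesis using H_coll_kinetic_pos[OF w] by (simp add: maupertuis_def)
next
  case False
  obtain v where v: "is_weak_deriv w v" using w by (auto simp: H_coll_def H1_def)
  obtain Pt where Pt: "shifted_potential \<alpha> U h w = ereal Pt"
    and comp: "\<And>c. c > 0 \<Longrightarrow> competitor \<alpha> h \<theta>s U r0 d \<theta> p k \<delta> Ub pb \<kappa> \<kappa>' w v c"
    and E: "\<And>c. c > 0 \<Longrightarrow> (LINT s:{0..1}|lborel. competitor.E \<alpha> h U w v c s) = c * kinetic w + Pt / c"
    using H_coll_competitor[OF w False v] by metis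
  have bound: "S 0 \<le> c * kinetic w + Pt / c" if "c > 0" for c
    using competitor.calibrated_lower_bound[OF comp[OF that]] E[OF that] by simp
  note K = H_coll_kinetic_pos[OF w]
  note P = potential_integral_pos[OF K bound]
  have "S 0 \<le> 2 * sqrt (kinetic w * Pt)"
    using bound[OF two_sqrt_bound(1)[OF K P]] two_sqrt_bound(2)[OF K P] by simp
  then have "(S 0)\<^sup>2 \<le> (2 * sqrt (kinetic w * Pt))\<^sup>2" using S_0_pos by (intro power_mono) auto
  then have "(S 0)\<^sup>2 / 4 \<le> kinetic w * Pt" using K P by (simp add: power_mult_distrib)
  then show ?thesis by (simp add: maupertuis_def Pt)
qed

lemma ustar_minimizer: "is_minimizer \<alpha> U h (pos 0) ustar"
  unfolding is_minimizer_def ustar_maupertuis using ustar_H_coll maupertuis_lower_bound by blast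

text \<open>At the optimal weight a minimizer attains the calibration bound, hence moves on the ray
  with velocity \<open>vel / c\<close>. Its position therefore has the physical time
  \<open>s / c\<close>, and the collision at \<open>s = 1\<close> forces \<open>T = 1 / c\<close>.
  This settles the curve, its parametrization and the rescaling at once.\<close>

theorem minimizer_eq_ustar:
  assumes w: "is_minimizer \<alpha> U h (pos 0) w"
  shows "\<And>s. s \<in> {0..1} \<Longrightarrow> w s = ustar s" and "1 / rescaling \<alpha> U h w = T"
proof -
  have wH: "w \<in> H_coll (pos 0)" and le: "maupertuis \<alpha> U h w \<le> ereal ((S 0)\<^sup>2 / 4)"
    using w ustar_H_coll ustar_maupertuis by (auto simp: is_minimizer_def)
  note K = H_coll_kinetic_pos[OF wH]
  have fin: "shifted_potential \<alpha> U h w \<noteq> \<infinity>" using le K by (auto simp: maupertuis_def)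
  obtain v where v: "is_weak_deriv w v" using wH by (auto simp: H_coll_def H1_def)
  obtain Pt where Pt: "shifted_potential \<alpha> U h w = ereal Pt"
    and comp: "\<And>c. c > 0 \<Longrightarrow> competitor \<alpha> h \<theta>s U r0 d \<theta> p k \<delta> Ub pb \<kappa> \<kappa>' w v c"
    and E: "\<And>c. c > 0 \<Longrightarrow> (LINT s:{0..1}|lborel. competitor.E \<alpha> h U w v c s) = c * kinetic w + Pt / c"
    using H_coll_competitor[OF wH fin v] by metis
  have bound: "S 0 \<le> c * kinetic w + Pt / c" if "c > 0" for c
    using competitor.calibrated_lower_bound[OF comp[OF that]] E[OF that] by simp
  note P = potential_integral_pos[OF K bound]
  \<comment> \<open>This weight is also \<open>rescaling\<close> of \<open>w\<close>.\<close>
  define c where "c = sqrt (Pt / kinetic w)"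
  have c: "c > 0" unfolding c_def by (rule two_sqrt_bound(1)[OF K P])
  interpret competitor \<alpha> h \<theta>s U r0 d \<theta> p k \<delta> Ub pb \<kappa> \<kappa>' w v c by (rule comp[OF c])
  have "kinetic w * Pt \<le> (S 0)\<^sup>2 / 4" using le by (simp add: maupertuis_def Pt)
  then have "sqrt (kinetic w * Pt) \<le> sqrt ((S 0 / 2)\<^sup>2)" by (simp add: power_divide)
  then have "(LINT s:{0..1}|lborel. E s) \<le> S 0"
    using two_sqrt_bound(2)[OF K P] E[OF c] S_0_pos by (simp add: c_def)
  note eq = calibrated_equality[OF this]
  define \<sigma> where "\<sigma> s = sx (w s)" for s
  have \<sigma>: "\<sigma> s > - d" "w s = pos (\<sigma> s)" if "s \<in> {0..<1}" for s
    using sx_greater[OF eq(1)[OF that]] \<Delta>_zero[OF eq(1,2)[OF that]] by (auto simp: \<sigma>_def)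
  have w': "(w has_vector_derivative vel (\<sigma> s) / c) (at s within {0..<1})" if "s \<in> {0..<1}" for s
    using eq(3)[OF that] A_pos[OF \<sigma>(1)[OF that]] \<sigma>(2)[OF that] by simp
  \<comment> \<open>The parameter \<open>\<sigma> s\<close> is a logarithm of the radius, so its
    derivative is minus the real part of velocity over position; \<open>dt_vel\<close> evaluates
    it.\<close>
  have \<sigma>': "((\<lambda>s. elapsed (\<sigma> s) - s / c) has_real_derivative 0) (at s within {0..<1})" if s: "s \<in> {0..<1}" for s
  proof -
    note \<sigma>s = \<sigma>[OF s]
    have "(sx has_derivative (\<lambda>y. - Re (y / w s))) (at (w s))"
      unfolding sx_def[abs_def]
      using has_derivative_diff[OF has_derivative_const[of "ln r0"] has_derivative_ln_cmod[OF sector_nonzero[OF eq(1)[OF s]]]] by simp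
    from has_derivative_in_compose[OF w'[OF s, unfolded has_vector_derivative_def] has_derivative_at_withinI[OF this]]
    have "(\<sigma> has_derivative (\<lambda>x. - Re (x *\<^sub>R (vel (\<sigma> s) / c) / w s))) (at s within {0..<1})"
      unfolding \<sigma>_def[abs_def] .
    moreover have "- Re (x *\<^sub>R (vel (\<sigma> s) / c) / w s) = inverse (c * dt (\<sigma> s)) * x" for x
    proof -
      define z where "z = vel (\<sigma> s) / w s"
      have "dt (\<sigma> s) *\<^sub>R z = - (1 + \<i> * p (\<sigma> s))"
        using dt_vel[OF \<sigma>s(1)] pos_nonzero[of "\<sigma> s"] unfolding \<sigma>s(2)[symmetric] z_def
        by (simp add: scaleR_conv_of_real divide_eq_eq)
      then have "Re (dt (\<sigma> s) *\<^sub>R z) = - 1" by simp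
      then have "Re z = - inverse (dt (\<sigma> s))"
        using dt_pos[OF \<sigma>s(1)] by (simp add: field_simps)
      moreover have "x *\<^sub>R (vel (\<sigma> s) / c) / w s = of_real (x / c) * z"
        by (simp add: scaleR_conv_of_real z_def)
      then have "Re (x *\<^sub>R (vel (\<sigma> s) / c) / w s) = x / c * Re z"
        by (metis scaleR_complex.sel(1) scaleR_conv_of_real)
      ultimately show ?thesis by (simp add: divide_inverse)
    qed
    ultimately have "(\<sigma> has_real_derivative inverse (c * dt (\<sigma> s))) (at s within {0..<1})"
      unfolding has_field_derivative_def by (simp only:)
    from DERIV_chain2[OF elapsed_deriv[OF \<sigma>s(1)] this]
    have "((\<lambda>s. elapsed (\<sigma> s)) has_real_derivative dt (\<sigma> s) * inverse (c * dt (\<sigma> s))) (at s within {0..<1})" .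
    also have "dt (\<sigma> s) * inverse (c * dt (\<sigma> s)) = 1 / c"
      using dt_pos[OF \<sigma>s(1)] c by (simp add: field_simps)
    finally show ?thesis using c by (auto intro!: derivative_eq_intros)
  qed
  obtain e where e: "\<And>s. s \<in> {0..<1} \<Longrightarrow> elapsed (\<sigma> s) - s / c = e"
    using has_field_derivative_zero_constant[OF _ \<sigma>'] by auto
  have "\<sigma> 0 = 0" using u_start by (simp add: \<sigma>_def sx_pos)
  then have "e = 0" using e[of 0] elapsed_0 by simp
  then have time: "elapsed (\<sigma> s) = s / c" if "s \<in> {0..<1}" for s using e[OF that] by simp
  \<comment> \<open>As \<open>s\<close> tends to 1, the radius tends to 0 and
    \<open>\<sigma> s\<close> to infinity, so \<open>elapsed (\<sigma> s) = s / c\<close> tends to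
    both \<open>T\<close> and \<open>1 / c\<close>.\<close>
  have "T = 1 / c"
  proof (rule antisym)
    have "filterlim \<sigma> at_top (at_left 1)"
    proof -
      have "((\<lambda>s. cmod (w s)) \<longlongrightarrow> 0) (at_left 1)"
        using tendsto_norm[OF u_tendsto[of 1]] u_end by simp
      moreover have "\<forall>\<^sub>F s in at_left 1. cmod (w s) > 0"
        by (rule eventually_mono[OF eventually_at_left_real[OF zero_less_one]])
          (use eq(1) sector_nonzero in auto)
      ultimately have "filterlim (\<lambda>s. cmod (w s)) (at_right 0) (at_left 1)"
        by (auto simp: filterlim_at elim: eventually_mono)
      from filterlim_compose[OF ln_at_0 this]
      have "filterlim (\<lambda>s. - ln (cmod (w s))) at_top (at_left 1)"
        by (simp add: filterlim_uminus_at_top)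
      from filterlim_tendsto_add_at_top[OF tendsto_const[of "ln r0"] this]
      show ?thesis by (simp add: \<sigma>_def[abs_def] sx_def)
    qed
    then have "((\<lambda>s. elapsed (\<sigma> s)) \<longlongrightarrow> T) (at_left 1)"
      by (rule filterlim_compose[OF elapsed_limit])
    then show "T \<le> 1 / c"
    proof (rule tendsto_upperbound)
      show "\<forall>\<^sub>F s in at_left 1. elapsed (\<sigma> s) \<le> 1 / c"
        by (rule eventually_mono[OF eventually_at_left_real[OF zero_less_one]])
          (use time c in \<open>auto intro: divide_right_mono\<close>)
    qed simp
    show "1 / c \<le> T"
    proof (rule tendsto_upperbound[of "\<lambda>s. s / c" _ "at_left 1"])
      show "((\<lambda>s. s / c) \<longlongrightarrow> 1 / c) (at_left 1)" using c by (intro tendsto_intros) auto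
      show "\<forall>\<^sub>F s in at_left 1. s / c \<le> T"
      proof (rule eventually_mono[OF eventually_at_left_real[OF zero_less_one]])
        fix s :: real assume "s \<in> {0<..<1}"
        then have s: "s \<in> {0..<1}" by simp
        show "s / c \<le> T" using time[OF s] elapsed_less[OF \<sigma>(1)[OF s]] by simp
      qed
    qed simp
  qed
  then show "1 / rescaling \<alpha> U h w = T"
    by (simp add: rescaling_def Pt c_def)
  fix s :: real assume s: "s \<in> {0..1}"
  show "w s = ustar s"
  proof (cases "s < 1")
    case True
    then have s': "s \<in> {0..<1}" using s by simp
    have "clock (T * s) = \<sigma> s"
      using clock(1)[OF \<sigma>(1)[OF s']] time[OF s'] \<open>T = 1 / c\<close> by simp
    then show ?thesis using \<sigma>(2)[OF s'] True by (simp add: ustar_def)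
  next
    case False
    then show ?thesis using s u_end by (simp add: ustar_def)
  qed
qed

corollary unique_minimizer: "has_unique_minimizer \<alpha> U h (pos 0)"
  unfolding has_unique_minimizer_def using ustar_minimizer minimizer_eq_ustar(1) by blast

lemma ray_orbit_in_minimizer_orbits: "(\<lambda>t. state (tclock t)) \<in> minimizer_orbits \<alpha> U h (pos 0)"
proof -
  note T = minimizer_eq_ustar(2)[OF ustar_minimizer]
  have \<omega>: "rescaling \<alpha> U h ustar = 1 / T" unfolding T[symmetric] by simp
  have x: "ustar (1 / T * t) = pos (clock t)" if "t \<in> {0..<T}" for t
    using that T_pos by (simp add: ustar_def)
  show ?thesis
    unfolding minimizer_orbits_def
  proof (intro CollectI exI conjI)
    show "0 < maupertuis \<alpha> U h ustar" using S_0_pos by (simp add: ustar_maupertuis)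
    show "let \<omega> = rescaling \<alpha> U h ustar; x = (\<lambda>t. ustar (\<omega> * t))
        in collision_solution \<alpha> U h (1 / \<omega>) x (\<lambda>t. vel (clock t)) \<and>
          mcgehee_orbit \<alpha> U h (1 / \<omega>) x (\<lambda>t. vel (clock t)) (\<lambda>t. state (tclock t))"
      unfolding Let_def \<omega> using ray_collision_solution[OF x] ray_mcgehee_orbit[OF x] by simp
  qed (rule ustar_minimizer)
qed

text \<open>The curve is the ray by uniqueness of the minimizer, and the velocity field
  \<open>v\<close> is then determined by uniqueness of derivatives. The time change remains unknown,
  but only its range matters: each of its values is a point of \<open>{0..<T}\<close>.\<close>

lemma minimizer_orbit_on_ray:
  assumes \<gamma>: "\<gamma> \<in> minimizer_orbits \<alpha> U h (pos 0)" and t: "t \<ge> 0"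
  obtains s where "s \<ge> 0" "\<gamma> t = state s"
proof -
  obtain u v where u: "is_minimizer \<alpha> U h (pos 0) u"
    and orbit: "let \<omega> = rescaling \<alpha> U h u; x = (\<lambda>t. u (\<omega> * t))
      in collision_solution \<alpha> U h (1 / \<omega>) x v \<and> mcgehee_orbit \<alpha> U h (1 / \<omega>) x v \<gamma>"
    using \<gamma> unfolding minimizer_orbits_def by blast
  note T = minimizer_eq_ustar(2)[OF u]
  have \<omega>: "rescaling \<alpha> U h u = 1 / T" unfolding T[symmetric] by simp
  define x where "x = (\<lambda>t. u (1 / T * t))"
  have sol: "collision_solution \<alpha> U h T x v" and orb: "mcgehee_orbit \<alpha> U h T x v \<gamma>"
    using orbit unfolding Let_def \<omega> x_def by simp_all
  have x: "x r = pos (clock r)" if "r \<in> {0..<T}" for r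
    using that T_pos minimizer_eq_ustar(1)[OF u, of "1 / T * r"] by (simp add: x_def ustar_def)
  obtain r where r: "r \<in> {0..<T}" "\<gamma> t = (cmod (x r), sgn (x r), sgn (v r))"
    using orb t unfolding mcgehee_orbit_def by blast
  note s = clock_range[OF r(1)]
  have "(x has_vector_derivative v r) (at r within {0..<T})"
    using sol r(1) unfolding collision_solution_def by blast
  moreover have "(x has_vector_derivative vel (clock r)) (at r within {0..<T})"
    using ray_collision_solution[OF x] r(1) unfolding collision_solution_def by blast
  moreover have "at r within {0..<T} \<noteq> bot"
  proof -
    have "r islimpt {r<..<T}" using r(1) by (simp add: islimpt_greaterThanLessThan1)
    then have "r islimpt {0..<T}" by (rule islimpt_subset) (use r(1) in auto)
    then show ?thesis by (simp add: trivial_limit_within)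
  qed
  ultimately have "v r = vel (clock r)" using vector_derivative_unique_within by blast
  then have "\<gamma> t = state (clock r)" using r(2) x[OF r(1)] state_eq[OF s(2)] by simp
  then show ?thesis using s(1) that by blast
qed

end

section \<open>Shifts and monotonicity of rays\<close>

context collision_ray
begin

text \<open>Restarting at \<open>s1\<close> and enlarging the margin to \<open>d + s1\<close> keeps
  the outer radius \<open>r0 * exp d\<close>, so all smallness conditions carry over with the same
  constants.\<close>

lemma shifted_ray:
  assumes "s1 > - d"
  shows "collision_ray \<alpha> h \<theta>s U (r0 * exp (- s1)) (d + s1) (\<lambda>s. \<theta> (s + s1)) (\<lambda>s. p (s + s1)) k \<delta> Ub pb"
proof -
  have r: "r0 * exp (- s1) * exp (- s) = r0 * exp (- (s + s1))" "r0 * exp (- s1) * exp (d + s1) = r0 * exp d" for s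
    by (simp_all flip: exp_add)
  have lim: "((\<lambda>s. f (s + s1)) \<longlongrightarrow> l) at_top" if "(f \<longlongrightarrow> l) at_top" for f :: "real \<Rightarrow> real" and l
    using filterlim_compose[OF that filterlim_tendsto_add_at_top[OF tendsto_const[of s1] filterlim_ident]]
    by (simp add: add.commute)
  show ?thesis
  proof (unfold_locales, goal_cases)
    case (8 s)
    then show ?case using \<theta>_deriv[of "s + s1"] by (simp add: DERIV_shift)
  next
    case (9 s)
    then show ?case using p_deriv[of "s + s1"] unfolding r by (simp add: DERIV_shift)
    next
    case 3
    then show ?case using r_small unfolding r .
  qed (use assms r0 \<delta> convex near slope limits in \<open>auto intro!: lim\<close>)
qed

lemma shifted_state:
  assumes "s1 > - d" "s + s1 > - d"
  shows "collision_ray.state (r0 * exp (- s1)) (\<lambda>s. \<theta> (s + s1)) (\<lambda>s. p (s + s1)) s = state (s + s1)"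
proof -
  interpret shifted: collision_ray \<alpha> h \<theta>s U "r0 * exp (- s1)" "d + s1" "\<lambda>s. \<theta> (s + s1)" "\<lambda>s. p (s + s1)" k \<delta> Ub pb
    by (rule shifted_ray[OF assms(1)])
  show ?thesis
  proof -
    have "r0 * exp (- s1) * exp (- s) = r0 * exp (- (s + s1))" by (simp flip: exp_add)
    then show ?thesis
      unfolding shifted.state_def state_def shifted.rr_def rr_def shifted.phi_def phi_def by (simp only:)
  qed
qed

text \<open>Every point of the ray is the initial point of a restarted ray, and the orbit from there
  on is still contained in \<open>N\<close>.\<close>

lemma state_stable:
  assumes s: "s \<ge> 0" and N: "\<And>s. s > - d \<Longrightarrow> state s \<in> N"
  shows "state s \<in> stable_manifold \<alpha> U h \<theta>s N"
proof -
  have s': "s > - d" using s d by simp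
  interpret shifted: collision_ray \<alpha> h \<theta>s U "r0 * exp (- s)" "d + s" "\<lambda>r. \<theta> (r + s)" "\<lambda>r. p (r + s)" k \<delta> Ub pb
    by (rule shifted_ray[OF s'])
  have "shifted.state 0 \<in> stable_manifold \<alpha> U h \<theta>s N"
    by (rule shifted.state_in_stable_manifold) (use shifted_state[OF s'] N s d in auto)
  then show ?thesis using shifted_state[OF s', of 0] s' by simp
qed

end

text \<open>Right after the last point with \<open>f x \<le> f a\<close>, continuity keeps
  \<open>f\<close> negative, hence not increasing, so that point could not have been the
  last.\<close>

lemma negative_stays_below:
  fixes f f' :: "real \<Rightarrow> real"
  assumes ab: "a \<le> b" and f: "\<And>x. x \<in> {a..b} \<Longrightarrow> (f has_real_derivative f' x) (at x)"
    and dec: "\<And>x. x \<in> {a..b} \<Longrightarrow> f x < 0 \<Longrightarrow> f' x \<le> 0" and neg: "f a < 0"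
  shows "f b \<le> f a"
proof (rule ccontr)
  assume contr: "\<not> f b \<le> f a"
  have cont: "continuous_on {a..b} f"
    using f DERIV_isCont by (intro continuous_at_imp_continuous_on) blast
  define A where "A = {a..b} \<inter> f -` {..f a}"
  have "closed A" unfolding A_def by (rule continuous_closed_preimage[OF cont]) auto
  then have "compact A" unfolding A_def by (metis Int_absorb1 Int_lower1 closed_Int_compact compact_Icc inf.commute)
  moreover have "a \<in> A" using ab by (simp add: A_def)
  ultimately obtain c where c: "c \<in> A" "\<And>x. x \<in> A \<Longrightarrow> x \<le> c"
    using compact_attains_sup[of A] by auto
  then have cb: "a \<le> c" "c < b" "f c \<le> f a" using contr by (auto simp: A_def less_le)
  have "isCont f c" using f[of c] cb DERIV_isCont by auto
  then have "\<forall>\<^sub>F x in at c. f x < 0" using order_tendstoD(2)[of f "f c" "at c" 0] cb neg by (auto simp: isCont_def)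
  then obtain e where e: "e > 0" "\<And>x. x \<noteq> c \<Longrightarrow> dist x c < e \<Longrightarrow> f x < 0"
    unfolding eventually_at by auto
  define x where "x = min (c + e / 2) b"
  have x: "c < x" "x \<le> b" "x < c + e" using e cb by (auto simp: x_def)
  obtain z where z: "z > c" "z < x" "f x - f c = (x - c) * f' z"
    using MVT2[OF x(1), of f f'] f cb x by auto
  have "f z < 0" by (rule e(2)) (use z x in \<open>auto simp: dist_real_def\<close>)
  then have "f' z \<le> 0" using dec[of z] z x cb by auto
  then have "f x \<le> f c" using z(3) x mult_nonneg_nonpos[of "x - c" "f' z"] by simp
  then have "x \<in> A" using cb x by (auto simp: A_def)
  then show False using c(2) x by force
qed

section \<open>Monotonicity of the angle along a ray\<close>

context collision_ray
begin

text \<open>While the product of angle and slope is negative, its derivative is nonpositive: this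
  holds for the contribution of \<open>- (p x)\<^sup>2\<close>, for the damping term with
  coefficient \<open>c x\<close>, and for the term with \<open>u x\<close>, whose sign comes from
  convexity. A negative value would thus persist and contradict the limit 0.\<close>

lemma angle_slope_sign:
  assumes s: "s > - d"
  shows "(\<theta> s - \<theta>s) * p s \<ge> 0"
proof (rule ccontr)
  define E where "E = (\<lambda>s. (\<theta> s - \<theta>s) * p s)"
  define u where "u = (\<lambda>s. U1 (\<theta> s) / (2 * Fs s))"
  define c where "c = (\<lambda>s. \<beta> + \<alpha> * h * rr s powr \<alpha> / (2 * Fs s))"
  assume "\<not> (\<theta> s - \<theta>s) * p s \<ge> 0"
  then have neg: "E s < 0" by (simp add: E_def)
  have E': "(E has_real_derivative (- p x) * p x + (q x)\<^sup>2 * (c x * p x - u x) * (\<theta> x - \<theta>s)) (at x)" if "x > - d" for x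
    unfolding E_def
    by (rule DERIV_cong[OF DERIV_mult[OF DERIV_diff[OF \<theta>_deriv[OF that] DERIV_const] p_deriv'[OF that]]])
      (simp add: c_def u_def)
  have dec: "(- p x) * p x + (q x)\<^sup>2 * (c x * p x - u x) * (\<theta> x - \<theta>s) \<le> 0" if x: "x > - d" "E x < 0" for x
  proof -
    have "k / 2 * (\<theta>s - \<theta> x)\<^sup>2 \<le> Ua \<theta>s - Ua (\<theta> x) - U1 (\<theta> x) * (\<theta>s - \<theta> x)"
      using near(1)[OF x(1)] \<delta> by (intro Ua_tangent) auto
    moreover have "k / 2 * (\<theta>s - \<theta> x)\<^sup>2 \<ge> 0" using convex(1) by simp
    ultimately have "U1 (\<theta> x) * (\<theta> x - \<theta>s) \<ge> 0"
      using Ua_min[of "\<theta> x"] by (simp add: algebra_simps)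
    then have u: "u x * (\<theta> x - \<theta>s) \<ge> 0"
      using Fs_pos[OF x(1)] by (simp add: u_def)
    \<comment> \<open>The factor \<open>\<beta>\<close> in \<open>r_small\<close> is meant for this
      estimate: with \<open>\<alpha> < 2\<close> and \<open>2 * Fs x \<ge> Ua \<theta>s\<close> it
      yields \<open>c x \<ge> 0\<close>.\<close>
    have "- h * rr x powr \<alpha> \<le> - h * (r0 * exp d) powr \<alpha>"
      using h \<alpha> rr_pos[of x] rr_less[OF x(1)] by (intro mult_left_mono powr_mono2) auto
    then have "- h * rr x powr \<alpha> \<le> \<beta> * Ua \<theta>s / 2" using r_small by simp
    then have "\<alpha> * (- h * rr x powr \<alpha>) \<le> \<alpha> * (\<beta> * Ua \<theta>s / 2)" using \<alpha> by (intro mult_left_mono) auto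
    also have "\<dots> \<le> 2 * (\<beta> * Ua \<theta>s / 2)" using \<alpha> \<beta> Ua_s_pos by (intro mult_right_mono) auto
    also have "\<dots> \<le> \<beta> * (2 * Fs x)" using Fs_lower[OF x(1)] \<beta> by simp
    finally have "c x \<ge> 0" using Fs_pos[OF x(1)] by (simp add: c_def field_simps)
    moreover have "p x * (\<theta> x - \<theta>s) \<le> 0" using x(2) by (simp add: E_def mult.commute)
    ultimately have "c x * (p x * (\<theta> x - \<theta>s)) \<le> 0" by (rule mult_nonneg_nonpos)
    then have "(c x * p x - u x) * (\<theta> x - \<theta>s) \<le> 0" using u by (simp add: algebra_simps)
    then have "(q x)\<^sup>2 * ((c x * p x - u x) * (\<theta> x - \<theta>s)) \<le> 0"
      by (rule mult_nonneg_nonpos[OF zero_le_power2])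
    then show ?thesis using zero_le_square[of "p x"] unfolding mult.assoc mult_minus_left by linarith
  qed
  have below: "E x \<le> E s" if "x \<ge> s" for x
    by (rule negative_stays_below[OF that E' dec neg]) (use s in auto)
  have "(E \<longlongrightarrow> (\<theta>s - \<theta>s) * 0) at_top"
    unfolding E_def by (intro tendsto_intros limits)
  then have "(\<theta>s - \<theta>s) * 0 \<le> E s"
    by (rule tendsto_upperbound) (use eventually_mono[OF eventually_ge_at_top below] in auto)
  then show False using neg by simp
qed

text \<open>Half the derivative of the squared distance to \<open>\<theta>s\<close> is minus the
  product treated in \<open>angle_slope_sign\<close>.\<close>

lemma angle_nonincreasing:
  assumes ab: "- d < a" "a \<le> b"
  shows "\<bar>\<theta> b - \<theta>s\<bar> \<le> \<bar>\<theta> a - \<theta>s\<bar>"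
proof -
  have "(\<theta> b - \<theta>s)\<^sup>2 \<le> (\<theta> a - \<theta>s)\<^sup>2"
  proof (rule DERIV_nonpos_imp_nonincreasing[OF ab(2), where f = "\<lambda>s. (\<theta> s - \<theta>s)\<^sup>2"])
    fix x assume "a \<le> x" "x \<le> b"
    then have x: "x > - d" using ab by simp
    have "((\<lambda>s. (\<theta> s - \<theta>s)\<^sup>2) has_real_derivative - 2 * ((\<theta> x - \<theta>s) * p x)) (at x)"
      by (rule derivative_eq_intros \<theta>_deriv[OF x] refl | simp)+
    then show "\<exists>y. ((\<lambda>s. (\<theta> s - \<theta>s)\<^sup>2) has_real_derivative y) (at x) \<and> y \<le> 0"
      using angle_slope_sign[OF x] by (intro exI conjI) auto
  qed
  then show ?thesis by (simp add: abs_le_square_iff)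
qed

end

lemma (in calibrated_ray) shifted_calibrated_ray:
  assumes "s1 > - d"
  shows "calibrated_ray \<alpha> h \<theta>s U (r0 * exp (- s1)) (d + s1) (\<lambda>s. \<theta> (s + s1)) (\<lambda>s. p (s + s1)) k \<delta> Ub pb \<kappa> \<kappa>'"
proof -
  interpret shifted: collision_ray \<alpha> h \<theta>s U "r0 * exp (- s1)" "d + s1" "\<lambda>s. \<theta> (s + s1)" "\<lambda>s. p (s + s1)" k \<delta> Ub pb
    by (rule shifted_ray[OF assms])
  have r: "exp (- s1) * exp (d + s1) = exp d" by (simp flip: exp_add)
  show ?thesis
    by unfold_locales (use \<kappa>_deriv \<kappa>'_continuous \<kappa>_nonneg hump side in
      \<open>auto simp: shifted.W_bound_def W_bound_def mult.assoc r\<close>)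
qed

lemma DERIV_positive_part_square:
  "((\<lambda>x. (max 0 x)\<^sup>2) has_real_derivative 2 * max 0 x) (at (x::real))"
proof (cases x "0::real" rule: linorder_cases)
  case less
  have "((\<lambda>x::real. 0) has_real_derivative 0) (at x)" by simp
  then have "((\<lambda>x. (max 0 x)\<^sup>2) has_real_derivative 0) (at x)"
    by (rule has_field_derivative_transform_within_open[where S = "{..<0}"]) (use less in auto)
  then show ?thesis using less by simp
next
  case equal
  have "((\<lambda>y::real. (max 0 y)\<^sup>2 / y) \<longlongrightarrow> 0) (at 0)"
  proof (rule Lim_null_comparison)
    show "\<forall>\<^sub>F y in at 0. norm ((max 0 y)\<^sup>2 / y) \<le> \<bar>y::real\<bar>"
      by (rule always_eventually) (auto simp: max_def power2_eq_square)
    show "((\<lambda>y::real. \<bar>y\<bar>) \<longlongrightarrow> 0) (at 0)" by (rule tendsto_rabs_zero) (rule tendsto_ident_at)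
  qed
  then show ?thesis using equal by (simp add: DERIV_def)
next
  case greater
  have "((\<lambda>x::real. x\<^sup>2) has_real_derivative 2 * x) (at x)" by (auto intro!: derivative_eq_intros)
  then have "((\<lambda>x. (max 0 x)\<^sup>2) has_real_derivative 2 * x) (at x)"
    by (rule has_field_derivative_transform_within_open[where S = "{0<..}"]) (use greater in auto)
  then show ?thesis using greater by simp
qed

section \<open>The hump of the second subsolution\<close>

context anisotropic_potential
begin

text \<open>The hump has to vanish at the direction \<open>\<theta>s\<close>, where the right side
  is 0, and beyond the angle \<open>\<delta>1\<close>, where nothing better than
  \<open>Ua t \<ge> Ua \<theta>s\<close> is known. In the variable
  \<open>c = cos (t - \<theta>s)\<close> these are the zeros \<open>c = 1\<close> and
  \<open>c = cos \<delta>1\<close> of the polynomial in \<open>m\<close>; squaring its positive part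
  makes it continuously differentiable. In between, all terms are at most a multiple of
  \<open>1 - c\<close>, while convexity gives
  \<open>Ua t - Ua \<theta>s \<ge> k * (1 - c)\<close>.\<close>

lemma exists_hump:
  assumes \<delta>1: "0 < \<delta>1" "\<delta>1 \<le> pi / 3" and convex: "k > 0" "\<And>t. \<bar>t - \<theta>s\<bar> \<le> \<delta>1 \<Longrightarrow> k \<le> U2 t"
  obtains \<kappa> \<kappa>' :: "real \<Rightarrow> real" where "\<And>c. (\<kappa> has_real_derivative \<kappa>' c) (at c)" "continuous_on UNIV \<kappa>'"
    "\<And>c. \<kappa> c \<ge> 0" "\<kappa> (cos (\<delta>1 / 2)) > 0"
    "\<And>t. 2 * \<beta> * sqrt (2 * Ua \<theta>s) * \<kappa> (cos (t - \<theta>s)) + (\<beta> * \<kappa> (cos (t - \<theta>s)))\<^sup>2 +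
      (\<kappa>' (cos (t - \<theta>s)) * sin (t - \<theta>s))\<^sup>2 \<le> 2 * (Ua t - Ua \<theta>s)"
proof -
  define c2 where "c2 = cos \<delta>1"
  define m where "m = (\<lambda>c. max 0 ((1 - c) * (c - c2)))"
  \<comment> \<open>The summands are the weights of \<open>\<kappa>\<close>, of its square and of
    the square of the derivative term; each of these three quantities will be at most
    \<open>\<epsilon> * (1 - c)\<close>.\<close>
  define C where "C = 2 * \<beta> * sqrt (2 * Ua \<theta>s) + \<beta>\<^sup>2 + 1"
  define \<epsilon> where "\<epsilon> = min 1 (2 * k / C)"
  define \<kappa> where "\<kappa> = (\<lambda>c. \<epsilon> * (m c)\<^sup>2)"
  define \<kappa>' where "\<kappa>' = (\<lambda>c. \<epsilon> * (2 * m c * (1 + c2 - 2 * c)))"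
  have C: "C > 0" using \<beta> Ua_s_pos by (auto simp: C_def intro!: add_nonneg_pos)
  have \<epsilon>: "0 < \<epsilon>" "\<epsilon> \<le> 1" "C * \<epsilon> \<le> 2 * k"
  proof -
    show "0 < \<epsilon>" "\<epsilon> \<le> 1" using C convex(1) by (auto simp: \<epsilon>_def)
    have "C * \<epsilon> \<le> C * (2 * k / C)" using C by (intro mult_left_mono) (auto simp: \<epsilon>_def)
    then show "C * \<epsilon> \<le> 2 * k" using C by simp
  qed
  \<comment> \<open>The restriction \<open>\<delta>1 \<le> pi / 3\<close> gives
    \<open>c2 \<ge> 1 / 2\<close>, which keeps the factor \<open>2 * (1 + c2 - 2 * c)\<close> of the
    derivative within modulus 1.\<close>
  have pi3: "cos (pi / 3) \<le> c2" unfolding c2_def using \<delta>1 pi_gt_zero by (intro cos_monotone_0_pi_le) auto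
  then have c2: "1 / 2 \<le> c2" by (simp add: cos_60)
  show ?thesis
  proof (rule that[of \<kappa> \<kappa>'])
    show "(\<kappa> has_real_derivative \<kappa>' c) (at c)" for c
    proof -
      have "((\<lambda>c. (1 - c) * (c - c2)) has_real_derivative 1 + c2 - 2 * c) (at c)"
        by (auto intro!: derivative_eq_intros)
      from DERIV_chain2[OF DERIV_positive_part_square this]
      have "((\<lambda>c. (m c)\<^sup>2) has_real_derivative 2 * m c * (1 + c2 - 2 * c)) (at c)" unfolding m_def .
      from DERIV_cmult[OF this, of \<epsilon>] show ?thesis unfolding \<kappa>_def \<kappa>'_def .
    qed
    show "continuous_on UNIV \<kappa>'" unfolding \<kappa>'_def m_def by (intro continuous_intros)
    show "\<kappa> c \<ge> 0" for c using \<epsilon> by (simp add: \<kappa>_def)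
    have "c2 < cos (\<delta>1 / 2)" unfolding c2_def using \<delta>1 pi_gt_zero by (intro cos_monotone_0_pi) auto
    moreover have "cos (\<delta>1 / 2) < cos 0" using \<delta>1 pi_gt_zero by (intro cos_monotone_0_pi) auto
    ultimately have "(1 - cos (\<delta>1 / 2)) * (cos (\<delta>1 / 2) - c2) > 0" by simp
    then have "m (cos (\<delta>1 / 2)) > 0" by (simp add: m_def)
    then show "\<kappa> (cos (\<delta>1 / 2)) > 0" using \<epsilon> by (simp add: \<kappa>_def)
    fix t
    define c where "c = cos (t - \<theta>s)"
    show "2 * \<beta> * sqrt (2 * Ua \<theta>s) * \<kappa> (cos (t - \<theta>s)) + (\<beta> * \<kappa> (cos (t - \<theta>s)))\<^sup>2 +
      (\<kappa>' (cos (t - \<theta>s)) * sin (t - \<theta>s))\<^sup>2 \<le> 2 * (Ua t - Ua \<theta>s)"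
    proof (cases "c \<le> c2")
      case True
      have "c \<le> 1" by (simp add: c_def)
      then have "(1 - c) * (c - c2) \<le> 0" using True by (intro mult_nonneg_nonpos) auto
      then have "m c = 0" by (simp add: m_def)
      then have "\<kappa> c = 0" "\<kappa>' c = 0" by (auto simp: \<kappa>_def \<kappa>'_def)
      then show ?thesis using Ua_min[of t] by (simp flip: c_def)
    next
      case False
      have c1: "c \<le> 1" "c > c2" "c \<ge> - 1" using False by (auto simp: c_def)
      define a where "a = arccos c"
      have ca: "cos a = c" unfolding a_def using c1 by (intro cos_arccos) auto
      have a: "0 \<le> a" "a \<le> \<delta>1"
      proof -
        show "0 \<le> a" unfolding a_def using c1 by (intro arccos_lbound) auto
        have "a \<le> arccos c2" unfolding a_def using c1 c2 by (intro arccos_le_arccos) auto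
        also have "\<dots> = \<delta>1" unfolding c2_def using \<delta>1 pi_gt_zero by (intro arccos_cos) auto
        finally show "a \<le> \<delta>1" .
      qed
      have "(sin (t - \<theta>s))\<^sup>2 = (sin a)\<^sup>2" using ca by (simp add: sin_squared_eq c_def)
      then have "sin (t - \<theta>s) = sin a \<or> sin (t - \<theta>s) = - sin a" by (simp add: power2_eq_iff)
      \<comment> \<open>Only the cosine of \<open>t - \<theta>s\<close> is known to be large, so
        \<open>t\<close> is replaced by a representative \<open>\<theta>s + b\<close> modulo
        \<open>2 * pi\<close> inside the interval of convexity.\<close>
      then obtain b where b: "\<bar>b\<bar> = a" "cis (t - \<theta>s) = cis b"
      proof
        assume "sin (t - \<theta>s) = sin a"
        then show ?thesis using that[of a] ca a by (simp add: complex_eq_iff c_def)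
      next
        assume "sin (t - \<theta>s) = - sin a"
        then show ?thesis using that[of "- a"] ca a by (simp add: complex_eq_iff c_def)
      qed
      have "cis t = cis (t - \<theta>s) * cis \<theta>s" by (simp add: cis_mult)
      also have "\<dots> = cis (\<theta>s + b)" by (simp add: b cis_mult add.commute)
      finally have Ut: "Ua t = Ua (\<theta>s + b)" by (simp add: Ua_def)
      have "k / 2 * (\<theta>s + b - \<theta>s)\<^sup>2 \<le> Ua (\<theta>s + b) - Ua \<theta>s - U1 \<theta>s * (\<theta>s + b - \<theta>s)"
      proof (rule convex_tangent[where I = "{\<theta>s - \<delta>1..\<theta>s + \<delta>1}", OF Ua_deriv U1_deriv])
        show "\<theta>s + b \<in> {\<theta>s - \<delta>1..\<theta>s + \<delta>1}" using a b(1) by auto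
        show "k \<le> U2 t" if "t \<in> {\<theta>s - \<delta>1..\<theta>s + \<delta>1}" for t
          using that by (intro convex(2)) auto
      qed (use \<delta>1 in auto)
      moreover have "b\<^sup>2 = a\<^sup>2" using b(1) power2_abs[of b] by simp
      ultimately have "k / 2 * a\<^sup>2 \<le> Ua t - Ua \<theta>s" by (simp add: Ut U1_s)
      moreover have "1 - c \<le> a\<^sup>2 / 2"
      proof -
        have "1 - c = 2 * (sin (a / 2))\<^sup>2" using cos_double_sin[of "a / 2"] ca by simp
        also have "\<dots> \<le> 2 * (a / 2)\<^sup>2"
          using abs_sin_x_le_abs_x[of "a / 2"] unfolding abs_le_square_iff by (rule mult_left_mono) simp
        finally show ?thesis by (simp add: power2_eq_square)
      qed
      then have "2 * k * (1 - c) \<le> k * a\<^sup>2" using mult_left_mono[of "1 - c" "a\<^sup>2 / 2" "2 * k"] convex(1) by simp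
      ultimately have main: "2 * k * (1 - c) \<le> 2 * (Ua t - Ua \<theta>s)" by simp
      have mc: "m c = (1 - c) * (c - c2)" using c1 by (simp add: m_def)
      have m: "0 \<le> m c" "m c \<le> 1 - c" "m c \<le> 1"
      proof -
        show "0 \<le> m c" by (simp add: m_def)
        show "m c \<le> 1 - c" unfolding mc using c1 c2 by (intro mult_left_le) auto
        then show "m c \<le> 1" using c1 c2 by simp
      qed
      have m2: "(m c)\<^sup>2 \<le> 1 - c"
        using m mult_mono[of "m c" "1 - c" "m c" 1] by (simp add: power2_eq_square)
      have \<epsilon>2: "\<epsilon>\<^sup>2 \<le> \<epsilon>" using \<epsilon> by (simp add: power2_eq_square mult_left_le)
      have k1: "\<kappa> c \<le> \<epsilon> * (1 - c)" unfolding \<kappa>_def using m2 \<epsilon> by (intro mult_left_mono) auto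
      have k2: "(\<kappa> c)\<^sup>2 \<le> \<epsilon> * (1 - c)"
      proof -
        have "\<epsilon> * (1 - c) \<le> 1" using \<epsilon> c1 c2 by (intro mult_le_one) auto
        then have "\<kappa> c \<le> 1" using k1 by linarith
        moreover have "0 \<le> \<kappa> c" using \<epsilon> by (simp add: \<kappa>_def)
        ultimately have "(\<kappa> c)\<^sup>2 \<le> \<kappa> c" by (simp add: power2_eq_square mult_left_le)
        then show ?thesis using k1 by simp
      qed
      have k3: "(\<kappa>' c * sin (t - \<theta>s))\<^sup>2 \<le> \<epsilon> * (1 - c)"
      proof -
        have "\<bar>2 * (1 + c2 - 2 * c)\<bar> \<le> 1" using c1 c2 by (simp add: abs_le_iff)
        then have "(2 * (1 + c2 - 2 * c))\<^sup>2 \<le> 1" by (simp add: abs_square_le_1)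
        moreover have "(sin (t - \<theta>s))\<^sup>2 \<le> 1" by (simp add: abs_square_le_1)
        ultimately have "(2 * (1 + c2 - 2 * c))\<^sup>2 * (sin (t - \<theta>s))\<^sup>2 \<le> 1" by (intro mult_le_one) auto
        then have "(\<epsilon>\<^sup>2 * (m c)\<^sup>2) * ((2 * (1 + c2 - 2 * c))\<^sup>2 * (sin (t - \<theta>s))\<^sup>2) \<le> \<epsilon>\<^sup>2 * (m c)\<^sup>2"
          by (intro mult_left_le) auto
        also have "\<dots> \<le> \<epsilon> * (1 - c)" using \<epsilon>2 m2 \<epsilon> by (intro mult_mono) auto
        finally show ?thesis unfolding \<kappa>'_def by (simp add: power_mult_distrib mult_ac)
      qed
      have "2 * \<beta> * sqrt (2 * Ua \<theta>s) * \<kappa> c + (\<beta> * \<kappa> c)\<^sup>2 + (\<kappa>' c * sin (t - \<theta>s))\<^sup>2 \<le>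
          2 * \<beta> * sqrt (2 * Ua \<theta>s) * (\<epsilon> * (1 - c)) + \<beta>\<^sup>2 * (\<epsilon> * (1 - c)) + \<epsilon> * (1 - c)"
        unfolding power_mult_distrib[of \<beta>]
        using k1 k2 k3[unfolded power_mult_distrib] \<beta> Ua_s_pos
        by (intro add_mono mult_left_mono) (auto simp: power_mult_distrib)
      also have "\<dots> = (C * \<epsilon>) * (1 - c)" by (simp add: C_def algebra_simps)
      also have "\<dots> \<le> 2 * k * (1 - c)" using \<epsilon>(3) c1 by (intro mult_right_mono) auto
      finally show ?thesis using main by (simp flip: c_def)
    qed
  qed
qed

end

section \<open>Existence of rays\<close>

context anisotropic_potential
begin

definition m :: real where "m = U2 \<theta>s / (2 * Ua \<theta>s)"

text \<open>The nonlinear part of the equation \<open>p' = \<beta> p - m x + \<dots>\<close> at \<open>\<theta> = \<theta>s + x\<close>, \<open>r powr \<alpha> = R\<close>.\<close>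

definition FR :: "real \<Rightarrow> real \<Rightarrow> real" where "FR R x = Ua (\<theta>s + x) + h * R"
definition NL :: "real \<Rightarrow> real \<Rightarrow> real \<Rightarrow> real" where
  "NL R x p = (1 + p\<^sup>2) * ((\<beta> + \<alpha> * h * R / (2 * FR R x)) * p - U1 (\<theta>s + x) / (2 * FR R x)) - \<beta> * p + m * x"
definition NLx :: "real \<Rightarrow> real \<Rightarrow> real \<Rightarrow> real" where
  "NLx R x p = (1 + p\<^sup>2) * (- (\<alpha> * h * R * U1 (\<theta>s + x) / (2 * (FR R x)\<^sup>2)) * p -
     (U2 (\<theta>s + x) / (2 * FR R x) - (U1 (\<theta>s + x))\<^sup>2 / (2 * (FR R x)\<^sup>2))) + m"
definition NLp :: "real \<Rightarrow> real \<Rightarrow> real \<Rightarrow> real" where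
  "NLp R x p = 2 * p * ((\<beta> + \<alpha> * h * R / (2 * FR R x)) * p - U1 (\<theta>s + x) / (2 * FR R x)) +
     (1 + p\<^sup>2) * (\<beta> + \<alpha> * h * R / (2 * FR R x)) - \<beta>"

lemma FR_deriv: "((\<lambda>x. FR R x) has_real_derivative U1 (\<theta>s + x)) (at x)"
  unfolding FR_def by (rule derivative_eq_intros Ua_chain refl | simp)+

lemma NL_deriv_x:
  assumes "FR R x \<noteq> 0"
  shows "((\<lambda>x. NL R x p) has_real_derivative NLx R x p) (at x)"
proof -
  have 1: "((\<lambda>x. U1 (\<theta>s + x)) has_real_derivative U2 (\<theta>s + x)) (at x)"
  proof -
    have "((\<lambda>x. \<theta>s + x) has_real_derivative 1) (at x)" by (auto intro!: derivative_eq_intros)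
    from U1_chain[OF this] show ?thesis by simp
  qed
  have A: "((\<lambda>x. \<alpha> * h * R / (2 * FR R x)) has_real_derivative - (\<alpha> * h * R * U1 (\<theta>s + x) / (2 * (FR R x)\<^sup>2))) (at x)"
    by (rule DERIV_cong[OF DERIV_divide[OF DERIV_const DERIV_cmult[OF FR_deriv]]])
      (use assms in \<open>auto simp: field_simps power2_eq_square\<close>)
  have B: "((\<lambda>x. U1 (\<theta>s + x) / (2 * FR R x)) has_real_derivative
      U2 (\<theta>s + x) / (2 * FR R x) - (U1 (\<theta>s + x))\<^sup>2 / (2 * (FR R x)\<^sup>2)) (at x)"
    by (rule DERIV_cong[OF DERIV_divide[OF 1 DERIV_cmult[OF FR_deriv]]])
      (use assms in \<open>auto simp: field_simps power2_eq_square\<close>)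
  have "((\<lambda>x. (1 + p\<^sup>2) * ((\<beta> + f x) * p - g x) - \<beta> * p + m * x) has_real_derivative (1 + p\<^sup>2) * (f' * p - g') + m) (at x)"
    if "(f has_real_derivative f') (at x)" "(g has_real_derivative g') (at x)" for f g :: "real \<Rightarrow> real" and f' g'
    by (rule derivative_eq_intros that refl | simp)+
  from this[OF A B] show ?thesis unfolding NL_def NLx_def .
qed

lemma NL_deriv_p: "((\<lambda>p. NL R x p) has_real_derivative NLp R x p) (at p)"
  unfolding NL_def NLp_def by (rule derivative_eq_intros refl | simp)+

text \<open>\<open>R\<close> stands for \<open>r powr \<alpha>\<close> and is treated as an
  independent variable, which hides the lack of smoothness at \<open>r = 0\<close>. As
  \<open>NL\<close> omits the linear part at the equilibrium, both partial derivatives vanish there,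
  and they are continuous because \<open>U2\<close> is.\<close>

lemma NL_small_derivatives:
  assumes "L > 0"
  obtains e where "e > 0" and "\<And>R x p. \<lbrakk>0 \<le> R; R \<le> e; \<bar>x\<bar> \<le> e; \<bar>p\<bar> \<le> e\<rbrakk> \<Longrightarrow>
    FR R x > 0 \<and> \<bar>NLx R x p\<bar> \<le> L \<and> \<bar>NLp R x p\<bar> \<le> L"
proof -
  have Ua: "isCont (\<lambda>z. Ua (\<theta>s + f z)) z" if "isCont f z" for f :: "real \<times> real \<times> real \<Rightarrow> real" and z
    by (rule isCont_o2[OF isCont_add[OF continuous_const that] DERIV_isCont[OF Ua_deriv]])
  have U1: "isCont (\<lambda>z. U1 (\<theta>s + f z)) z" if "isCont f z" for f :: "real \<times> real \<times> real \<Rightarrow> real" and z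
    by (rule isCont_o2[OF isCont_add[OF continuous_const that] DERIV_isCont[OF U1_deriv]])
  have U2: "isCont (\<lambda>z. U2 (\<theta>s + f z)) z" if "isCont f z" for f :: "real \<times> real \<times> real \<Rightarrow> real" and z
  proof (rule isCont_o2[OF isCont_add[OF continuous_const that]])
    show "isCont U2 y" for y using U2_continuous by (simp add: continuous_on_eq_continuous_at)
  qed
  let ?z = "(0, 0, 0) :: real \<times> real \<times> real"
  have F0: "FR (fst ?z) (fst (snd ?z)) \<noteq> 0" using Ua_s_pos by (simp add: FR_def)
  have F: "isCont (\<lambda>z. FR (fst z) (fst (snd z))) ?z"
    unfolding FR_def by (intro continuous_intros Ua)
  have zero: "NLx 0 0 0 = 0" "NLp 0 0 0 = 0" "FR 0 0 > 0"
    using Ua_s_pos by (auto simp: NLx_def NLp_def FR_def m_def U1_s)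
  have "isCont (\<lambda>z. NLx (fst z) (fst (snd z)) (snd (snd z))) ?z"
    unfolding NLx_def using F0 by (intro continuous_intros F U1 U2) auto
  then have Lx: "(\<lambda>z. NLx (fst z) (fst (snd z)) (snd (snd z))) \<midarrow>?z\<rightarrow> 0"
    by (simp add: isCont_def zero)
  have "isCont (\<lambda>z. NLp (fst z) (fst (snd z)) (snd (snd z))) ?z"
    unfolding NLp_def using F0 by (intro continuous_intros F U1) auto
  then have Lp: "(\<lambda>z. NLp (fst z) (fst (snd z)) (snd (snd z))) \<midarrow>?z\<rightarrow> 0"
    by (simp add: isCont_def zero)
  have LF: "(\<lambda>z. FR (fst z) (fst (snd z))) \<midarrow>?z\<rightarrow> FR 0 0"
    using F by (simp add: isCont_def)
  note tendstoD[OF Lx \<open>L > 0\<close>] tendstoD[OF Lp \<open>L > 0\<close>] order_tendstoD(1)[OF LF zero(3)]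
  then have "\<forall>\<^sub>F z in at ?z. \<bar>NLx (fst z) (fst (snd z)) (snd (snd z))\<bar> < L \<and>
      \<bar>NLp (fst z) (fst (snd z)) (snd (snd z))\<bar> < L \<and> FR (fst z) (fst (snd z)) > 0"
    by eventually_elim (simp add: dist_real_def)
  then obtain d where d: "d > 0" "\<And>z. z \<noteq> ?z \<Longrightarrow> dist z ?z < d \<Longrightarrow> \<bar>NLx (fst z) (fst (snd z)) (snd (snd z))\<bar> < L \<and>
      \<bar>NLp (fst z) (fst (snd z)) (snd (snd z))\<bar> < L \<and> FR (fst z) (fst (snd z)) > 0"
    unfolding eventually_at by blast
  show ?thesis
  proof (rule that[of "d / 4"])
    fix R x p :: real assume *: "0 \<le> R" "R \<le> d / 4" "\<bar>x\<bar> \<le> d / 4" "\<bar>p\<bar> \<le> d / 4"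
    show "FR R x > 0 \<and> \<bar>NLx R x p\<bar> \<le> L \<and> \<bar>NLp R x p\<bar> \<le> L"
    proof (cases "(R, x, p) = ?z")
      case True
      then show ?thesis
        using zero \<open>L > 0\<close> by simp
    next
      case False
      have "dist (R, x, p) ?z \<le> \<bar>R\<bar> + (\<bar>x\<bar> + \<bar>p\<bar>)"
        unfolding dist_norm minus_prod_def
        using norm_Pair_le[of R "(x, p)"] norm_Pair_le[of x p] by simp
      also have "\<dots> < d" using * d(1) by simp
      finally show ?thesis using d(2)[OF False] by force
    qed
  qed (use d in simp)
qed

lemma NL_lipschitz:
  assumes "L > 0"
  obtains e where "e > 0" and "\<And>R x. \<lbrakk>0 \<le> R; R \<le> e; \<bar>x\<bar> \<le> e\<rbrakk> \<Longrightarrow> FR R x > 0"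
    and "\<And>R x p x' p'. \<lbrakk>0 \<le> R; R \<le> e; \<bar>x\<bar> \<le> e; \<bar>p\<bar> \<le> e; \<bar>x'\<bar> \<le> e; \<bar>p'\<bar> \<le> e\<rbrakk> \<Longrightarrow>
      \<bar>NL R x p - NL R x' p'\<bar> \<le> L * (\<bar>x - x'\<bar> + \<bar>p - p'\<bar>)"
proof -
  obtain e where e: "e > 0" and D: "\<And>R x p. \<lbrakk>0 \<le> R; R \<le> e; \<bar>x\<bar> \<le> e; \<bar>p\<bar> \<le> e\<rbrakk> \<Longrightarrow>
    FR R x > 0 \<and> \<bar>NLx R x p\<bar> \<le> L \<and> \<bar>NLp R x p\<bar> \<le> L"
    using NL_small_derivatives[OF assms] by metis
  show ?thesis
  proof (rule that[OF e])
    show "FR R x > 0" if "0 \<le> R" "R \<le> e" "\<bar>x\<bar> \<le> e" for R x using D[OF that, of 0] e by simp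
    fix R x p x' p' :: real
    assume *: "0 \<le> R" "R \<le> e" "\<bar>x\<bar> \<le> e" "\<bar>p\<bar> \<le> e" "\<bar>x'\<bar> \<le> e" "\<bar>p'\<bar> \<le> e"
    have "norm (NL R x p - NL R x' p) \<le> L * norm (x - x')"
    proof (rule field_differentiable_bound[where S = "{-e..e}" and f' = "\<lambda>x. NLx R x p"])
      fix z assume z: "z \<in> {-e..e}"
      then have "FR R z > 0" "\<bar>NLx R z p\<bar> \<le> L" using D[of R z p] * by auto
      then show "((\<lambda>x. NL R x p) has_field_derivative NLx R z p) (at z within {-e..e})" "norm (NLx R z p) \<le> L"
        using NL_deriv_x[of R z p] by (auto intro: has_field_derivative_at_within)
    qed (use * in auto)
    moreover have "norm (NL R x' p - NL R x' p') \<le> L * norm (p - p')"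
    proof (rule field_differentiable_bound[where S = "{-e..e}" and f' = "\<lambda>p. NLp R x' p"])
      fix z assume z: "z \<in> {-e..e}"
      then show "((\<lambda>p. NL R x' p) has_field_derivative NLp R x' z) (at z within {-e..e})" "norm (NLp R x' z) \<le> L"
        using NL_deriv_p[of R x' z] D[of R x' z] * by (auto intro: has_field_derivative_at_within)
    qed (use * in auto)
    ultimately show "\<bar>NL R x p - NL R x' p'\<bar> \<le> L * (\<bar>x - x'\<bar> + \<bar>p - p'\<bar>)"
      by (simp add: distrib_left)
  qed
qed

text \<open>The saddle lemma prescribes the value at time 1 of an orbit living on positive times.
  Shifting by 1 turns this into a ray that starts at 0 and extends back to \<open>s > - 1\<close>,
  which explains the radius \<open>r * exp 1\<close> in the smallness condition.\<close>

lemma stable_solutions: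
  assumes "\<epsilon> > 0"
  obtains \<delta>0 R1 where "\<delta>0 > 0" "R1 > 0"
    and "\<And>r x0. \<lbrakk>0 < r; (r * exp 1) powr \<alpha> \<le> R1; \<bar>x0\<bar> \<le> \<delta>0\<rbrakk> \<Longrightarrow> \<exists>\<theta> p. \<theta> 0 = \<theta>s + x0 \<and>
      (\<forall>s>-1. (\<theta> has_real_derivative - p s) (at s) \<and>
        (p has_real_derivative (1 + (p s)\<^sup>2) *
          ((\<beta> + \<alpha> * h * (r * exp (- s)) powr \<alpha> / (2 * F (r * exp (- s)) (\<theta> s))) * p s -
            U1 (\<theta> s) / (2 * F (r * exp (- s)) (\<theta> s)))) (at s) \<and>
        \<bar>\<theta> s - \<theta>s\<bar> \<le> \<epsilon> \<and> \<bar>p s\<bar> \<le> \<epsilon>) \<and>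
      (\<theta> \<longlongrightarrow> \<theta>s) at_top \<and> (p \<longlongrightarrow> 0) at_top"
proof -
  have m: "m > 0" using U2_pos Ua_s_pos by (simp add: m_def)
  \<comment> \<open>\<open>- a\<close> and \<open>b\<close> are the roots of
    \<open>l\<^sup>2 - \<beta> * l - m = 0\<close>, the characteristic equation of the linear part;
    \<open>\<mu>\<close> is a decay rate between 0 and \<open>a\<close>.\<close>
  define D where "D = sqrt (\<beta>\<^sup>2 + 4 * m)"
  define a b \<mu> where "a = (D - \<beta>) / 2" and "b = (D + \<beta>) / 2" and "\<mu> = a / 2"
  have D: "D > \<beta>" "D * D = \<beta>\<^sup>2 + 4 * m"
    unfolding D_def using \<beta> m by (auto intro: real_less_rsqrt)
  have ab: "0 < a" "0 < b" "0 < \<mu>" "\<mu> < a" "b - a = \<beta>" "a * b = m"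
    using D \<beta> by (auto simp: a_def b_def \<mu>_def field_simps power2_eq_square)
  define K where "K = ((1 + a) * (exp (a - \<mu>) / (a - \<mu>)) + 1) / (b + \<mu>)"
  have K: "K > 0" unfolding K_def using ab by (auto intro!: divide_pos_pos add_pos_pos)
  \<comment> \<open>The largest Lipschitz constant allowed by the contraction.\<close>
  define L where "L = 1 / (2 * K)"
  have L: "L > 0" using K by (simp add: L_def)
  obtain e where e: "e > 0" and FR_pos: "\<And>R x. \<lbrakk>0 \<le> R; R \<le> e; \<bar>x\<bar> \<le> e\<rbrakk> \<Longrightarrow> FR R x > 0"
    and lip: "\<And>R x p x' p'. \<lbrakk>0 \<le> R; R \<le> e; \<bar>x\<bar> \<le> e; \<bar>p\<bar> \<le> e; \<bar>x'\<bar> \<le> e; \<bar>p'\<bar> \<le> e\<rbrakk> \<Longrightarrow>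
      \<bar>NL R x p - NL R x' p'\<bar> \<le> L * (\<bar>x - x'\<bar> + \<bar>p - p'\<bar>)"
    using NL_lipschitz[OF L] by metis
  define \<epsilon>1 where "\<epsilon>1 = min \<epsilon> e"
  have \<epsilon>1: "0 < \<epsilon>1" "\<epsilon>1 \<le> \<epsilon>" "\<epsilon>1 \<le> e" using assms e by (auto simp: \<epsilon>1_def)
  define \<delta>0 where "\<delta>0 = \<epsilon>1 / (2 * (1 + a) * exp a)"
  show ?thesis
  proof (rule that[of \<delta>0 e])
    show "\<delta>0 > 0" using \<epsilon>1 ab by (simp add: \<delta>0_def)
    show "e > 0" by (rule e)
    fix r x0 :: real assume r: "0 < r" "(r * exp 1) powr \<alpha> \<le> e" and x0: "\<bar>x0\<bar> \<le> \<delta>0"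
    \<comment> \<open>The term \<open>r powr \<alpha>\<close> along the orbit in shifted time, where
      the radius is \<open>r * exp (1 - s)\<close>.\<close>
    define R where "R s = r powr \<alpha> * exp (\<alpha> * (1 - s))" for s
    have R_eq: "R (s + 1) = (r * exp (- s)) powr \<alpha>" for s
      using r by (simp add: R_def powr_mult exp_powr_real mult.commute)
    have R: "0 \<le> R s" "R s \<le> e" if "s \<ge> 0" for s
    proof -
      show "0 \<le> R s" by (simp add: R_def)
      have "R s \<le> r powr \<alpha> * exp \<alpha>" unfolding R_def using that \<alpha> by (intro mult_left_mono) (auto simp: mult_left_le)
      also have "\<dots> = (r * exp 1) powr \<alpha>" using r by (simp add: powr_mult exp_powr_real)
      finally show "R s \<le> e" using r by simp
    qed
    obtain x p where x1: "x 1 = x0"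
      and x': "\<And>s. s > 0 \<Longrightarrow> (x has_real_derivative - p s) (at s)"
      and p': "\<And>s. s > 0 \<Longrightarrow> (p has_real_derivative (b - a) * p s - a * b * x s + NL (R s) (x s) (p s)) (at s)"
      and xb: "\<And>s. s \<ge> 0 \<Longrightarrow> \<bar>x s\<bar> \<le> \<epsilon>1 * exp (- \<mu> * s)"
      and pb: "\<And>s. s \<ge> 0 \<Longrightarrow> \<bar>p s\<bar> \<le> \<epsilon>1 * exp (- \<mu> * s)"
    proof (rule saddle_stable_orbit[OF ab(3,4,2) \<epsilon>1(1), where f = "\<lambda>s. NL (R s)" and L = L and ?x0.0 = x0])
      show "continuous_on ({0..} \<times> {- \<epsilon>1..\<epsilon>1} \<times> {- \<epsilon>1..\<epsilon>1}) (\<lambda>(s, x, p). NL (R s) x p)"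
      proof -
        let ?Z = "{0..} \<times> {- \<epsilon>1..\<epsilon>1} \<times> {- \<epsilon>1..\<epsilon>1}"
        have U: "continuous_on ?Z (\<lambda>z. Ua (\<theta>s + fst (snd z)))" "continuous_on ?Z (\<lambda>z. U1 (\<theta>s + fst (snd z)))"
          by (auto intro!: continuous_on_compose2[OF Ua_continuous[of UNIV]]
            continuous_on_compose2[OF U1_continuous[of UNIV]] continuous_intros)
        have R': "continuous_on ?Z (\<lambda>z. R (fst z))" unfolding R_def by (intro continuous_intros)
        have "continuous_on ?Z (\<lambda>z. FR (R (fst z)) (fst (snd z)))" unfolding FR_def by (intro continuous_intros U R')
        moreover have "FR (R (fst z)) (fst (snd z)) \<noteq> 0" if "z \<in> ?Z" for z
          using FR_pos[of "R (fst z)" "fst (snd z)"] R[of "fst z"] that \<epsilon>1 by (auto simp: abs_le_iff)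
        ultimately have "continuous_on ?Z (\<lambda>z. NL (R (fst z)) (fst (snd z)) (snd (snd z)))"
          unfolding NL_def by (intro continuous_intros U R') auto
        then show ?thesis by (simp add: case_prod_unfold)
      qed
      show "NL (R s) 0 0 = 0" for s by (simp add: NL_def U1_s)
      show "2 * (((1 + a) * (exp (a - \<mu>) / (a - \<mu>)) + 1) / (b + \<mu>)) * L \<le> 1"
        unfolding K_def[symmetric] L_def using K by simp
      have "2 * (1 + a) * exp a * \<bar>x0\<bar> \<le> 2 * (1 + a) * exp a * \<delta>0"
        using x0 ab by (intro mult_left_mono) auto
      also have "\<dots> = \<epsilon>1" using ab by (simp add: \<delta>0_def)
      finally show "2 * (1 + a) * exp a * \<bar>x0\<bar> \<le> \<epsilon>1" .
    qed (use lip R \<epsilon>1 L in auto)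
    have lim0: "(f \<longlongrightarrow> 0) at_top" if "\<And>s. s \<ge> 0 \<Longrightarrow> \<bar>f s\<bar> \<le> \<epsilon>1 * exp (- \<mu> * s)" for f
    proof (rule Lim_null_comparison)
      show "\<forall>\<^sub>F s in at_top. norm (f s) \<le> \<epsilon>1 * exp (- \<mu> * s)"
        by (rule eventually_mono[OF eventually_ge_at_top[of 0]]) (use that in simp)
      have "filterlim (\<lambda>s. - (\<mu> * s)) at_bot at_top"
        using ab by (simp add: filterlim_uminus_at_bot filterlim_tendsto_pos_mult_at_top[OF tendsto_const] filterlim_ident)
      from tendsto_mult_left[OF filterlim_compose[OF exp_at_bot this], of \<epsilon>1]
      show "((\<lambda>s. \<epsilon>1 * exp (- \<mu> * s)) \<longlongrightarrow> 0) at_top" by simp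
    qed
    have shift: "filterlim (\<lambda>s::real. s + 1) at_top at_top"
      using filterlim_tendsto_add_at_top[OF tendsto_const[of "1::real"] filterlim_ident] by (simp add: add.commute)
    have small: "\<bar>f s\<bar> \<le> \<epsilon>" if "\<And>s. s \<ge> 0 \<Longrightarrow> \<bar>f s\<bar> \<le> \<epsilon>1 * exp (- \<mu> * s)" "s \<ge> 0" for f and s :: real
    proof -
      have "\<epsilon>1 * exp (- \<mu> * s) \<le> \<epsilon>1 * 1" using that(2) ab \<epsilon>1 by (intro mult_left_mono) auto
      then show ?thesis using that(1)[OF that(2)] \<epsilon>1 by linarith
    qed
    show "\<exists>\<theta> p. \<theta> 0 = \<theta>s + x0 \<and>
      (\<forall>s>-1. (\<theta> has_real_derivative - p s) (at s) \<and>
        (p has_real_derivative (1 + (p s)\<^sup>2) *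
          ((\<beta> + \<alpha> * h * (r * exp (- s)) powr \<alpha> / (2 * F (r * exp (- s)) (\<theta> s))) * p s -
            U1 (\<theta> s) / (2 * F (r * exp (- s)) (\<theta> s)))) (at s) \<and>
        \<bar>\<theta> s - \<theta>s\<bar> \<le> \<epsilon> \<and> \<bar>p s\<bar> \<le> \<epsilon>) \<and>
      (\<theta> \<longlongrightarrow> \<theta>s) at_top \<and> (p \<longlongrightarrow> 0) at_top"
    proof (rule exI[of _ "\<lambda>s. \<theta>s + x (s + 1)"], rule exI[of _ "\<lambda>s. p (s + 1)"], intro conjI allI impI)
      show "\<theta>s + x (0 + 1) = \<theta>s + x0" by (simp add: x1)
      have "((\<lambda>s. \<theta>s + x (s + 1)) \<longlongrightarrow> \<theta>s + 0) at_top"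
        by (intro tendsto_intros filterlim_compose[OF lim0[OF xb] shift])
      then show "((\<lambda>s. \<theta>s + x (s + 1)) \<longlongrightarrow> \<theta>s) at_top" by simp
      show "((\<lambda>s. p (s + 1)) \<longlongrightarrow> 0) at_top" by (rule filterlim_compose[OF lim0[OF pb] shift])
      fix s :: real assume "s > - 1"
      then have s: "s + 1 > 0" by simp
      have "((\<lambda>s. x (s + 1)) has_real_derivative - p (s + 1)) (at s)"
        using x'[OF s] by (simp add: DERIV_shift)
      from DERIV_add[OF DERIV_const[of \<theta>s] this]
      show "((\<lambda>s. \<theta>s + x (s + 1)) has_real_derivative - p (s + 1)) (at s)" by simp
      have FR_eq: "FR (R (s + 1)) (x (s + 1)) = F (r * exp (- s)) (\<theta>s + x (s + 1))"
        by (simp add: FR_def F_def R_eq)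
      have "((\<lambda>s. p (s + 1)) has_real_derivative
          (b - a) * p (s + 1) - a * b * x (s + 1) + NL (R (s + 1)) (x (s + 1)) (p (s + 1))) (at s)"
        using p'[OF s] by (simp add: DERIV_shift)
      also have "(b - a) * p (s + 1) - a * b * x (s + 1) + NL (R (s + 1)) (x (s + 1)) (p (s + 1)) =
          (1 + (p (s + 1))\<^sup>2) *
          ((\<beta> + \<alpha> * h * (r * exp (- s)) powr \<alpha> / (2 * F (r * exp (- s)) (\<theta>s + x (s + 1)))) * p (s + 1) -
            U1 (\<theta>s + x (s + 1)) / (2 * F (r * exp (- s)) (\<theta>s + x (s + 1))))"
        unfolding NL_def FR_eq unfolding R_eq ab(5,6) by simp
      finally show "((\<lambda>s. p (s + 1)) has_real_derivative (1 + (p (s + 1))\<^sup>2) *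
          ((\<beta> + \<alpha> * h * (r * exp (- s)) powr \<alpha> / (2 * F (r * exp (- s)) (\<theta>s + x (s + 1)))) * p (s + 1) -
            U1 (\<theta>s + x (s + 1)) / (2 * F (r * exp (- s)) (\<theta>s + x (s + 1))))) (at s)" .
      show "\<bar>\<theta>s + x (s + 1) - \<theta>s\<bar> \<le> \<epsilon>" "\<bar>p (s + 1)\<bar> \<le> \<epsilon>"
        using small[OF xb, of "s + 1"] small[OF pb, of "s + 1"] s by auto
    qed
  qed
qed

end

text \<open>The order of the choices matters. Curvature and angle determine the hump, whose height
  at the side of the sector is then a fixed positive number; only afterwards is \<open>pb\<close>
  taken small against that height, and finally the amplitude of the rays and their radius. None of
  these constants depends on the starting point.\<close>

lemma (in anisotropic_potential) exists_calibrated_rays: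
  assumes N: "open N" "(0, cis \<theta>s, cis (\<theta>s + pi)) \<in> N"
  obtains k \<delta> Ub pb \<kappa> \<kappa>' \<delta>0 r1 where "\<delta>0 > 0" "r1 > 0"
    and "\<And>r x0. \<lbrakk>0 < r; r < r1; \<bar>x0\<bar> < \<delta>0\<rbrakk> \<Longrightarrow> \<exists>\<theta> p. calibrated_ray \<alpha> h \<theta>s U r 1 \<theta> p k \<delta> Ub pb \<kappa> \<kappa>' \<and>
      \<theta> 0 = \<theta>s + x0 \<and> (\<forall>s>-1. collision_ray.state r \<theta> p s \<in> N)"
proof -
  define k where "k = U2 \<theta>s / 2"
  have k: "0 < k" "k < U2 \<theta>s" using U2_pos by (auto simp: k_def)
  have near: "\<exists>e>0. \<forall>t. \<bar>t - \<theta>s\<bar> \<le> e \<longrightarrow> P (f t)"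
    if f: "isCont f \<theta>s" and P: "open {y. P y}" "P (f \<theta>s)" for f :: "real \<Rightarrow> real" and P
  proof -
    have "\<forall>\<^sub>F t in at \<theta>s. f t \<in> {y. P y}"
      by (rule topological_tendstoD[OF f[unfolded isCont_def] P(1)]) (use P in simp)
    then obtain e where e: "e > 0" "\<And>t. t \<noteq> \<theta>s \<Longrightarrow> dist t \<theta>s < e \<Longrightarrow> P (f t)"
      unfolding eventually_at by auto
    have "P (f t)" if "\<bar>t - \<theta>s\<bar> \<le> e / 2" for t
      by (cases "t = \<theta>s") (use that e P(2) in \<open>auto simp: dist_real_def\<close>)
    then show ?thesis using e(1) by (intro exI[of _ "e / 2"]) auto
  qed
  have "isCont U2 \<theta>s" using U2_continuous by (simp add: continuous_on_eq_continuous_at)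
  then obtain e2 where e2: "e2 > 0" "\<And>t. \<bar>t - \<theta>s\<bar> \<le> e2 \<Longrightarrow> k < U2 t"
    using near[of U2 "\<lambda>y. k < y"] k by (auto simp: open_Collect_less)
  define \<delta>1 where "\<delta>1 = min e2 (pi / 3)"
  have \<delta>1: "0 < \<delta>1" "\<delta>1 \<le> pi / 3" "\<And>t. \<bar>t - \<theta>s\<bar> \<le> \<delta>1 \<Longrightarrow> k \<le> U2 t"
    using e2 by (auto simp: \<delta>1_def less_imp_le)
  obtain \<kappa> \<kappa>' :: "real \<Rightarrow> real" where \<kappa>: "\<And>c. (\<kappa> has_real_derivative \<kappa>' c) (at c)" "continuous_on UNIV \<kappa>'"
    "\<And>c. \<kappa> c \<ge> 0" "\<kappa> (cos (\<delta>1 / 2)) > 0"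
    "\<And>t. 2 * \<beta> * sqrt (2 * Ua \<theta>s) * \<kappa> (cos (t - \<theta>s)) + (\<beta> * \<kappa> (cos (t - \<theta>s)))\<^sup>2 +
      (\<kappa>' (cos (t - \<theta>s)) * sin (t - \<theta>s))\<^sup>2 \<le> 2 * (Ua t - Ua \<theta>s)"
    by (rule exists_hump[OF \<delta>1(1,2) k(1) \<delta>1(3)]) blast+
  define \<delta> where "\<delta> = \<delta>1 / 2"
  have \<delta>: "0 < \<delta>" "\<delta> < pi / 2" "\<And>t. \<bar>t - \<theta>s\<bar> < \<delta> \<Longrightarrow> k \<le> U2 t"
    using \<delta>1 pi_gt_zero by (auto simp: \<delta>_def)
  \<comment> \<open>The excess of \<open>W_bound\<close> over the radial part of \<open>W3\<close>
    when \<open>pb = e\<close>, \<open>Ub = Ua \<theta>s + e\<close> and the term in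
    \<open>h\<close> costs at most \<open>e\<close>. It tends to 0 with \<open>e\<close>, so the
    hump can cover it.\<close>
  define \<psi> where "\<psi> e = sqrt (2 * (Ua \<theta>s + e)) * sqrt (1 + e\<^sup>2) / \<beta> + sqrt (2 * (Ua \<theta>s + e)) * e * (2 * \<delta>) -
      sqrt (2 * (Ua \<theta>s - e)) / \<beta>" for e
  have "isCont \<psi> 0" unfolding \<psi>_def using \<beta> by (intro continuous_intros) auto
  moreover have "\<psi> 0 = 0" by (simp add: \<psi>_def)
  ultimately have "(\<psi> \<longlongrightarrow> 0) (at_right 0)"
    by (simp add: isCont_def filterlim_at_split)
  then have "\<forall>\<^sub>F e in at_right 0. \<psi> e < \<kappa> (cos \<delta>)"
    by (rule order_tendstoD(2)) (use \<kappa>(4) in \<open>simp add: \<delta>_def\<close>)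
  moreover have "\<forall>\<^sub>F e in at_right 0. e \<in> {0<..<min (\<delta> / 2) 1}"
    by (rule eventually_at_right_real) (use \<delta> in simp)
  ultimately have "\<forall>\<^sub>F e in at_right 0. \<psi> e < \<kappa> (cos \<delta>) \<and> e \<in> {0<..<min (\<delta> / 2) 1}"
    by (rule eventually_conj)
  from eventually_happens'[OF trivial_limit_at_right_real this]
  obtain pb where pb: "\<psi> pb < \<kappa> (cos \<delta>)" "0 < pb" "pb < \<delta>" "pb \<le> 1"
    using \<delta>(1) by auto
  obtain e3 where e3: "e3 > 0" "\<And>t. \<bar>t - \<theta>s\<bar> \<le> e3 \<Longrightarrow> Ua t < Ua \<theta>s + pb"
    using near[of Ua "\<lambda>y. y < Ua \<theta>s + pb"] DERIV_isCont[OF Ua_deriv] pb by (auto simp: open_Collect_less)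
  have "isCont (\<lambda>t. 2 * (U1 t)\<^sup>2) \<theta>s" by (intro continuous_intros DERIV_isCont[OF U1_deriv])
  then obtain e4 where e4: "e4 > 0" "\<And>t. \<bar>t - \<theta>s\<bar> \<le> e4 \<Longrightarrow> 2 * (U1 t)\<^sup>2 < k * Ua \<theta>s"
    using near[of "\<lambda>t. 2 * (U1 t)\<^sup>2" "\<lambda>y. y < k * Ua \<theta>s"] k Ua_s_pos U1_s by (auto simp: open_Collect_less)
  \<comment> \<open>States parametrized by radius, angle deviation and slope. Continuity at the
    equilibrium places all states with small parameters in \<open>N\<close>.\<close>
  define st where "st z = (fst z, cis (\<theta>s + fst (snd z)), cis (\<theta>s + fst (snd z) + pi + arctan (snd (snd z))))"
    for z :: "real \<times> real \<times> real"
  have st: "isCont st (0, 0, 0)"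
    unfolding st_def cis_conv_exp by (intro continuous_intros)
  have st0: "st (0, 0, 0) \<in> N" using N(2) by (simp add: st_def)
  from topological_tendstoD[OF st[unfolded isCont_def] N(1) this]
  obtain e5 where e5: "e5 > 0" "\<And>z. z \<noteq> (0, 0, 0) \<Longrightarrow> dist z (0, 0, 0) < e5 \<Longrightarrow> st z \<in> N"
    unfolding eventually_at by blast
  then have e5: "e5 > 0" "\<And>z. dist z (0, 0, 0) < e5 \<Longrightarrow> st z \<in> N"
    using st0 by metis+
  define \<epsilon> where "\<epsilon> = min pb (min e3 (min e4 (e5 / 4)))"
  have \<epsilon>: "\<epsilon> > 0" "\<epsilon> \<le> pb" "\<epsilon> \<le> e3" "\<epsilon> \<le> e4" "\<epsilon> \<le> e5 / 4"
    using pb e3 e4 e5 by (auto simp: \<epsilon>_def)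
  obtain \<delta>0 R1 where \<delta>0: "\<delta>0 > 0" and R1: "R1 > 0"
    and sol: "\<And>r x0. \<lbrakk>0 < r; (r * exp 1) powr \<alpha> \<le> R1; \<bar>x0\<bar> \<le> \<delta>0\<rbrakk> \<Longrightarrow> \<exists>\<theta> p. \<theta> 0 = \<theta>s + x0 \<and>
      (\<forall>s>-1. (\<theta> has_real_derivative - p s) (at s) \<and>
        (p has_real_derivative (1 + (p s)\<^sup>2) *
          ((\<beta> + \<alpha> * h * (r * exp (- s)) powr \<alpha> / (2 * F (r * exp (- s)) (\<theta> s))) * p s -
            U1 (\<theta> s) / (2 * F (r * exp (- s)) (\<theta> s)))) (at s) \<and>
        \<bar>\<theta> s - \<theta>s\<bar> \<le> \<epsilon> \<and> \<bar>p s\<bar> \<le> \<epsilon>) \<and>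
      (\<theta> \<longlongrightarrow> \<theta>s) at_top \<and> (p \<longlongrightarrow> 0) at_top"
    using stable_solutions[OF \<epsilon>(1)] by blast
  \<comment> \<open>Three thresholds for \<open>r powr \<alpha>\<close>: solvability, the condition
    \<open>r_small\<close>, and the loss \<open>pb\<close> allowed in \<open>\<psi>\<close>.\<close>
  define R2 where "R2 = min R1 (min (\<beta> * Ua \<theta>s / 2) pb / (- h))"
  have R2: "R2 > 0" "R2 \<le> R1" "- h * R2 \<le> \<beta> * Ua \<theta>s / 2" "- h * R2 \<le> pb"
  proof -
    have "min (\<beta> * Ua \<theta>s / 2) pb / (- h) > 0"
      by (rule divide_pos_pos) (use pb h \<beta> Ua_s_pos in auto)
    then show "R2 > 0" "R2 \<le> R1" using R1 by (simp_all add: R2_def)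
    have "- h * R2 \<le> - h * (min (\<beta> * Ua \<theta>s / 2) pb / (- h))" using h by (intro mult_left_mono) (auto simp: R2_def)
    also have "\<dots> = min (\<beta> * Ua \<theta>s / 2) pb" using h by simp
    finally show "- h * R2 \<le> \<beta> * Ua \<theta>s / 2" "- h * R2 \<le> pb" by auto
  qed
  \<comment> \<open>Division by \<open>exp 1\<close>, since a ray starting at radius
    \<open>r\<close> reaches back to radius \<open>r * exp 1\<close>.\<close>
  define r1 where "r1 = min (R2 powr (1 / \<alpha>)) (e5 / 4) / exp 1"
  show ?thesis
  proof (rule that[of \<delta>0 r1])
    show "\<delta>0 > 0" by (rule \<delta>0)
    show "r1 > 0" using R2 e5 by (simp add: r1_def)
    fix r x0 :: real assume r: "0 < r" "r < r1" and x0: "\<bar>x0\<bar> < \<delta>0"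
    have re: "r * exp 1 < R2 powr (1 / \<alpha>)" "r * exp 1 < e5 / 4"
      using r(2) by (simp_all add: r1_def pos_less_divide_eq)
    have "(r * exp 1) powr \<alpha> \<le> (R2 powr (1 / \<alpha>)) powr \<alpha>"
      using re r \<alpha> by (intro powr_mono2) auto
    also have "\<dots> = R2" using R2 \<alpha> by (simp add: powr_powr)
    finally have R: "(r * exp 1) powr \<alpha> \<le> R2" .
    obtain \<theta> p where \<theta>0: "\<theta> 0 = \<theta>s + x0"
      and ode: "\<And>s. s > - 1 \<Longrightarrow> (\<theta> has_real_derivative - p s) (at s)"
        "\<And>s. s > - 1 \<Longrightarrow> (p has_real_derivative (1 + (p s)\<^sup>2) *
          ((\<beta> + \<alpha> * h * (r * exp (- s)) powr \<alpha> / (2 * F (r * exp (- s)) (\<theta> s))) * p s -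
            U1 (\<theta> s) / (2 * F (r * exp (- s)) (\<theta> s)))) (at s)"
      and small: "\<And>s. s > - 1 \<Longrightarrow> \<bar>\<theta> s - \<theta>s\<bar> \<le> \<epsilon>" "\<And>s. s > - 1 \<Longrightarrow> \<bar>p s\<bar> \<le> \<epsilon>"
      and lim: "(\<theta> \<longlongrightarrow> \<theta>s) at_top" "(p \<longlongrightarrow> 0) at_top"
      using sol[OF r(1) order_trans[OF R R2(2)] less_imp_le[OF x0]]
      by (elim exE conjE) (rule that; (assumption | blast))
    have hR: "- h * (r * exp 1) powr \<alpha> \<le> - h * R2" using h R by (intro mult_left_mono) auto
    interpret collision_ray \<alpha> h \<theta>s U r 1 \<theta> p k \<delta> "Ua \<theta>s + pb" pb
    proof (unfold_locales, goal_cases)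
      case 3
      then show ?case using hR R2 by simp
    next
      case (10 s)
      then show ?case using small(1) \<epsilon> pb by fastforce
    next
      case (11 s)
      then show ?case using small(2) \<epsilon> by fastforce
    next
      case (13 s)
      then show ?case using e3(2)[of "\<theta> s"] small(1) \<epsilon> by fastforce
    next
      case (14 s)
      then show ?case using e4(2)[of "\<theta> s"] small(1) \<epsilon> by fastforce
    qed (use r \<delta> k pb ode lim in auto)
    have "calibrated_ray \<alpha> h \<theta>s U r 1 \<theta> p k \<delta> (Ua \<theta>s + pb) pb \<kappa> \<kappa>'"
    proof unfold_locales
      have "W_bound < sqrt (2 * (Ua \<theta>s - pb)) / \<beta> + \<kappa> (cos \<delta>)"
        using pb(1) by (simp add: W_bound_def \<psi>_def)
      also have "\<dots> \<le> sqrt (2 * F (r * exp 1) \<theta>s) / \<beta> + \<kappa> (cos \<delta>)"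
        using hR R2 \<beta> by (intro add_right_mono divide_right_mono) (auto simp: F_def)
      finally show "W_bound < sqrt (2 * F (r * exp 1) \<theta>s) / \<beta> + \<kappa> (cos \<delta>)" .
    qed (use \<kappa> in auto)
    moreover have "state s \<in> N" if s: "s > - 1" for s
    proof -
      have "rr s < r * exp 1" using r s by (simp add: rr_def)
      then have "rr s < e5 / 4" using re by simp
      have "dist (rr s, \<theta> s - \<theta>s, p s) (0, 0, 0) \<le> \<bar>rr s\<bar> + (\<bar>\<theta> s - \<theta>s\<bar> + \<bar>p s\<bar>)"
        unfolding dist_norm minus_prod_def
        using norm_Pair_le[of "rr s" "(\<theta> s - \<theta>s, p s)"] norm_Pair_le[of "\<theta> s - \<theta>s" "p s"] by simp
      also have "\<dots> < e5" using \<open>rr s < e5 / 4\<close> rr_pos[of s] small[OF s] \<epsilon>(5) e5(1) by linarith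
      finally have "st (rr s, \<theta> s - \<theta>s, p s) \<in> N" by (rule e5(2))
      then show ?thesis by (simp add: st_def state_def phi_def)
    qed
    ultimately show "\<exists>\<theta> p. calibrated_ray \<alpha> h \<theta>s U r 1 \<theta> p k \<delta> (Ua \<theta>s + pb) pb \<kappa> \<kappa>' \<and>
      \<theta> 0 = \<theta>s + x0 \<and> (\<forall>s>-1. collision_ray.state r \<theta> p s \<in> N)"
      using \<theta>0 by blast
  qed
qed

text \<open>Minimizer orbits have positive radius at every finite time, whereas \<open>W_loc\<close>
  contains the edge \<open>r = 0\<close>; hence the restriction to points with
  \<open>fst p > 0\<close>.\<close>

theorem theorem5p2:
  fixes \<alpha> h \<theta>s rloc \<delta>loc :: real
    and U :: "complex \<Rightarrow> real"
    and N :: "(real \<times> complex \<times> complex) set"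
    and \<Psi> :: "real \<Rightarrow> real \<Rightarrow> complex"
  assumes "0 < \<alpha>" and "\<alpha> < 2"
    and "C2_circle U"
    and "\<And>\<theta>. U (cis \<theta>) \<ge> U (cis \<theta>s)"
    and "U (cis \<theta>s) > 0"
    and "deriv (deriv (\<lambda>\<theta>. U (cis \<theta>))) \<theta>s > 0"
    and "h < 0"
    and "stable_graph \<alpha> U h \<theta>s N rloc \<delta>loc \<Psi>"
  shows "\<exists>rb \<delta>b. 0 < rb \<and> rb \<le> rloc \<and> 0 < \<delta>b \<and> \<delta>b \<le> \<delta>loc \<and>
     {p \<in> W_loc \<theta>s \<Psi> rb \<delta>b. fst p > 0} =
       (\<Union>q\<in>Q0 \<theta>s rb \<delta>b. \<Union>\<gamma>\<in>minimizer_orbits \<alpha> U h q. \<gamma> ` {0<..}) \<and>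
     (\<forall>q\<in>Q0 \<theta>s rb \<delta>b. has_unique_minimizer \<alpha> U h q)"
proof -
  interpret anisotropic_potential \<alpha> h \<theta>s U
    by unfold_locales (use assms in auto)
  have N: "open N" "(0, cis \<theta>s, cis (\<theta>s + pi)) \<in> N" and loc: "rloc > 0" "\<delta>loc > 0"
    and graph: "\<And>r \<theta> \<phi>. \<lbrakk>r \<in> {0<..<rloc}; \<theta> \<in> {\<theta>s - \<delta>loc<..<\<theta>s + \<delta>loc}\<rbrakk> \<Longrightarrow>
      (r, cis \<theta>, cis \<phi>) \<in> stable_manifold \<alpha> U h \<theta>s N \<longleftrightarrow> cis \<phi> = \<Psi> r \<theta>"
    using assms(8) unfolding stable_graph_def by blast+
  obtain k \<delta> Ub pb \<kappa> \<kappa>' \<delta>0 r1 where "\<delta>0 > 0" "r1 > 0"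
    and rays: "\<And>r x0. \<lbrakk>0 < r; r < r1; \<bar>x0\<bar> < \<delta>0\<rbrakk> \<Longrightarrow> \<exists>\<theta> p. calibrated_ray \<alpha> h \<theta>s U r 1 \<theta> p k \<delta> Ub pb \<kappa> \<kappa>' \<and>
      \<theta> 0 = \<theta>s + x0 \<and> (\<forall>s>-1. collision_ray.state r \<theta> p s \<in> N)"
    by (rule exists_calibrated_rays[OF N]) (rule that, assumption+)
  define rb where "rb = min r1 rloc"
  define \<delta>b where "\<delta>b = min \<delta>0 \<delta>loc"
  have b: "0 < rb" "rb \<le> rloc" "rb \<le> r1" "0 < \<delta>b" "\<delta>b \<le> \<delta>loc" "\<delta>b \<le> \<delta>0"
    using \<open>\<delta>0 > 0\<close> \<open>r1 > 0\<close> loc by (auto simp: rb_def \<delta>b_def)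
  let ?box = "{\<theta>s - \<delta>b<..<\<theta>s + \<delta>b}"
  have ray: "\<exists>\<theta> p. calibrated_ray \<alpha> h \<theta>s U r 1 \<theta> p k \<delta> Ub pb \<kappa> \<kappa>' \<and>
      \<theta> 0 = t \<and> (\<forall>s>-1. collision_ray.state r \<theta> p s \<in> N)" if "r \<in> {0<..<rb}" "t \<in> ?box" for r t
    using rays[of r "t - \<theta>s"] that b by (auto simp: abs_less_iff)
  \<comment> \<open>The later points of a ray belong to the stable manifold relative to
    \<open>N\<close>, and the graph hypothesis then identifies their direction. The angle does not
    move away from \<open>\<theta>s\<close> and the radius decreases, so the box is not
    left.\<close>
  have on_graph: "collision_ray.state r \<theta> p s = (r * exp (- s), cis (\<theta> s), \<Psi> (r * exp (- s)) (\<theta> s)) \<and>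
      r * exp (- s) \<in> {0<..<rb} \<and> \<theta> s \<in> ?box"
    if cal: "calibrated_ray \<alpha> h \<theta>s U r 1 \<theta> p k \<delta> Ub pb \<kappa> \<kappa>'" and st: "\<forall>s>-1. collision_ray.state r \<theta> p s \<in> N"
      and "r \<in> {0<..<rb}" "\<theta> 0 \<in> ?box" "s \<ge> 0" for r \<theta> p s
  proof -
    interpret calibrated_ray \<alpha> h \<theta>s U r 1 \<theta> p k \<delta> Ub pb \<kappa> \<kappa>' by (rule cal)
    have "rr s \<le> r" using that by (simp add: rr_def)
    then have r: "rr s \<in> {0<..<rb}" using rr_pos[of s] that by auto
    have "\<bar>\<theta> s - \<theta>s\<bar> \<le> \<bar>\<theta> 0 - \<theta>s\<bar>" using that by (intro angle_nonincreasing) auto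
    then have \<theta>: "\<theta> s \<in> ?box" using that(4) by auto
    have "state s \<in> stable_manifold \<alpha> U h \<theta>s N" by (rule state_stable) (use st that in auto)
    moreover have "rr s \<in> {0<..<rloc}" "\<theta> s \<in> {\<theta>s - \<delta>loc<..<\<theta>s + \<delta>loc}" using r \<theta> b by auto
    ultimately have "cis (phi s) = \<Psi> (rr s) (\<theta> s)" using graph by (simp add: state_def)
    then show ?thesis using r \<theta> by (simp add: state_def rr_def)
  qed
  have "{p \<in> W_loc \<theta>s \<Psi> rb \<delta>b. fst p > 0} =
       (\<Union>q\<in>Q0 \<theta>s rb \<delta>b. \<Union>\<gamma>\<in>minimizer_orbits \<alpha> U h q. \<gamma> ` {0<..})" (is "?L = ?R")
  proof (intro equalityI subsetI)
    fix z assume "z \<in> ?L"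
    then obtain r t where z: "z = (r, cis t, \<Psi> r t)" and rt: "r \<in> {0<..<rb}" "t \<in> ?box"
      by (auto simp: W_loc_def)
    obtain \<theta> p where cal: "calibrated_ray \<alpha> h \<theta>s U r 1 \<theta> p k \<delta> Ub pb \<kappa> \<kappa>'"
      and \<theta>0: "\<theta> 0 = t" and st: "\<forall>s>-1. collision_ray.state r \<theta> p s \<in> N"
      using ray[OF rt] by blast
    interpret calibrated_ray \<alpha> h \<theta>s U r 1 \<theta> p k \<delta> Ub pb \<kappa> \<kappa>' by (rule cal)
    have z0: "z = state 0" using on_graph[OF cal st rt(1), of 0] \<theta>0 rt z by simp
    \<comment> \<open>Orbits are read at positive times only, while \<open>z\<close> is the initial
      point of its own ray. By continuity the ray can be started slightly earlier, at some
      \<open>s1 < 0\<close>, still inside the box.\<close>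
    have "isCont \<theta> 0" "isCont (\<lambda>s. r * exp (- s)) 0"
      using DERIV_isCont[OF \<theta>_deriv[of 0]] by (auto intro!: continuous_intros)
    then have lim0: "(\<theta> \<longlongrightarrow> t) (at_left 0)" "((\<lambda>s. r * exp (- s)) \<longlongrightarrow> r) (at_left 0)"
      using \<theta>0 by (auto simp: isCont_def filterlim_at_split)
    note topological_tendstoD[OF lim0(1) open_greaterThanLessThan rt(2)]
      topological_tendstoD[OF lim0(2) open_greaterThanLessThan rt(1)]
    moreover have "\<forall>\<^sub>F s in at_left 0. s \<in> {-1<..<0::real}" by (rule eventually_at_left_real) simp
    ultimately have "\<forall>\<^sub>F s in at_left 0. \<theta> s \<in> ?box \<and> r * exp (- s) \<in> {0<..<rb} \<and> s \<in> {-1<..<0::real}"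
      by eventually_elim auto
    from eventually_happens'[OF trivial_limit_at_left_real this]
    obtain s1 where s1: "\<theta> s1 \<in> ?box" "r * exp (- s1) \<in> {0<..<rb}" "-1 < s1" "s1 < 0"
      by auto
    interpret shifted: calibrated_ray \<alpha> h \<theta>s U "r * exp (- s1)" "1 + s1" "\<lambda>s. \<theta> (s + s1)" "\<lambda>s. p (s + s1)" k \<delta> Ub pb \<kappa> \<kappa>'
      by (rule shifted_calibrated_ray) (use s1 in simp)
    have q: "shifted.pos 0 = complex_of_real (r * exp (- s1)) * cis (\<theta> s1)"
      unfolding shifted.pos_def shifted.rr_def by simp
    have "shifted.pos 0 \<in> Q0 \<theta>s rb \<delta>b"
      unfolding q Q0_def using s1 by blast
    moreover have "(\<lambda>t. shifted.state (shifted.tclock t)) \<in> minimizer_orbits \<alpha> U h (shifted.pos 0)"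
      by (rule shifted.ray_orbit_in_minimizer_orbits)
    moreover have "z \<in> (\<lambda>t. shifted.state (shifted.tclock t)) ` {0<..}"
    proof (rule image_eqI)
      \<comment> \<open>On the restarted ray \<open>z\<close> has the parameter
        \<open>- s1 > 0\<close>, hence a positive McGehee time.\<close>
      have "shifted.tau 0 < shifted.tau (- s1)" by (rule shifted.tau_strict_mono) (use s1 in auto)
      then show "shifted.tau (- s1) \<in> {0<..}" by (simp add: shifted.tau_0)
      have "shifted.tclock (shifted.tau (- s1)) = - s1" by (rule shifted.tclock(1)) (use s1 in auto)
      then show "z = shifted.state (shifted.tclock (shifted.tau (- s1)))"
        using shifted_state[of s1 "- s1"] s1 z0 by simp
    qed
    ultimately show "z \<in> ?R" by blast
  next
    fix z assume "z \<in> ?R"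
    then obtain q \<gamma> \<tau> where q: "q \<in> Q0 \<theta>s rb \<delta>b" and \<gamma>: "\<gamma> \<in> minimizer_orbits \<alpha> U h q" and \<tau>: "\<tau> > 0" "z = \<gamma> \<tau>"
      by blast
    obtain r t where qr: "q = complex_of_real r * cis t" and rt: "r \<in> {0<..<rb}" "t \<in> ?box"
      using q unfolding Q0_def by blast
    obtain \<theta> p where cal: "calibrated_ray \<alpha> h \<theta>s U r 1 \<theta> p k \<delta> Ub pb \<kappa> \<kappa>'"
      and \<theta>0: "\<theta> 0 = t" and st: "\<forall>s>-1. collision_ray.state r \<theta> p s \<in> N"
      using ray[OF rt] by blast
    interpret calibrated_ray \<alpha> h \<theta>s U r 1 \<theta> p k \<delta> Ub pb \<kappa> \<kappa>' by (rule cal)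
    have "q = pos 0" by (simp add: pos_def rr_def \<theta>0 qr)
    then obtain s where s: "s \<ge> 0" "\<gamma> \<tau> = state s"
      using minimizer_orbit_on_ray[of \<gamma> \<tau>] \<gamma> \<tau> by (metis less_imp_le)
    then show "z \<in> ?L"
      using on_graph[OF cal st rt(1) _ s(1)] \<theta>0 rt \<tau> by (fastforce simp: W_loc_def)
  qed
  moreover have "has_unique_minimizer \<alpha> U h q" if q: "q \<in> Q0 \<theta>s rb \<delta>b" for q
  proof -
    obtain r t where qr: "q = complex_of_real r * cis t" and rt: "r \<in> {0<..<rb}" "t \<in> ?box"
      using q unfolding Q0_def by blast
    obtain \<theta> p where cal: "calibrated_ray \<alpha> h \<theta>s U r 1 \<theta> p k \<delta> Ub pb \<kappa> \<kappa>'" and \<theta>0: "\<theta> 0 = t"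
      using ray[OF rt] by blast
    interpret calibrated_ray \<alpha> h \<theta>s U r 1 \<theta> p k \<delta> Ub pb \<kappa> \<kappa>' by (rule cal)
    have "q = pos 0" by (simp add: pos_def rr_def \<theta>0 qr)
    then show ?thesis using unique_minimizer by simp
  qed
  ultimately show ?thesis using b by blast
qed

end
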